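(* If $A$ is a finite-dimensional von Neumann algebra, then $(A,\{1_A\})$ is an object of $\mathbf Q$. Moreover, the functor $H:\mathbf H\to\mathbf Q$ defined by $H(A)=(A,\{1_A\})$ and $H(f)=f$ is fully faithful, strict monoidal with respect to $\check\otimes$, and it strictly preserves finite products.
   Context: An operator space is a complex vector space $X$ with a norm on $\mathbb M_n(X)$ for every $n$, such that $\mathbb M_1(X)$ is Banach, $\|x\oplus y\|_{m+n}=\max\{\|x\|_m,\|y\|_n\}$, and $\|\alpha x\beta\|_m\le\|\alpha\|\|x\|_m\|\beta\|$ for scalar matrices $\alpha,\beta\in\mathbb M_m(\mathbb C)$ with the operator norm. $\mathbb C$ carries the operator norms on $\mathbb M_n(\mathbb C)$. $\mathbf{FdOS}$: f.d. operator spaces and complete contractions (linear maps all of whose entrywise amplifications are contractive). $\mathrm{CB}(X,Y)$ has matrix norms from $\mathbb M_n(\mathrm{CB}(X,Y))\cong\mathrm{CB}(X,M_n(Y))$; $X^*=\mathrm{CB}(X,\mathbb C)$. $X\oplus_\infty Y$: max norms on $\mathbb M_n(X\oplus Y)\cong M_n(X)\oplus M_n(Y)$; $X\check\otimes Y$: structure on $X\otimes Y$ from $\mathrm{CB}(Y^*,X)$. $\mathrm{Ball}(X)$ is the closed unit ball of $X$. For $S\subseteq\mathrm{Ball}(X)$, $S^\circ=\{f\in\mathrm{Ball}(X^* )\mid\forall s\in S,\ f(s)=1\}$; $S$ is bipolar if $S=d^{-1}[S^{\circ\circ}]$ with $d:X\cong X^{**}$ canonical (identification along $d$ is implicit). $\mathbf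 Q$: objects are pairs $(X,S)$ with $X\in\mathbf{FdOS}$, $S\subseteq\mathrm{Ball}(X)$ bipolar; morphisms $(X,S)\to(Y,R)$ are complete contractions $f:X\to Y$ with $f[S]\subseteq R$. In $\mathbf Q$: $(X,S)\check\otimes(Y,R)=(X\check\otimes Y,(S^\circ\otimes R^\circ)^\circ)$ with $S^\circ\otimes R^\circ=\{s'\otimes r'\}$, unit $(\mathbb C,\{1\})$; products are $(X\oplus_\infty Y,S\times R)$ with terminal object $(0,\{0\})$. A f.d. vN-algebra is a f.d. unital C*-algebra (zero algebra allowed), viewed as an operator space by giving each $\mathbb M_n(A)$ its unique C*-norm. $\mathbf H$: objects are f.d. vN-algebras, morphisms are completely positive unital maps (positive elements are those of the form $a^*a$; $\varphi$ is completely positive if $M_n\check\otimes\varphi:M_n\check\otimes A\to M_n\check\otimes B$ preserves positive elements for all $n$, $M_n$ being the C*-algebra of $n\times n$ matrices). $\mathbf H$ is symmetric monoidal with $A\check\otimes B$ (factorwise multiplication and involution, unit $1_A\otimes1_B$) and has finite products $A\oplus_\infty B$ (componentwise operations). *)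

theory Defs
  imports "HOL-Analysis.Analysis" "HOL-Library.Function_Algebras"
begin

section \<open>Finite-dimensional complex vector spaces\<close>

text \<open>A complex vector space is given as a complex subspace of an ambient type of the class below,
  from which it inherits addition and scalar multiplication. The ambient type is always a type
  variable or built from type variables, and the subspace may be all of it.\<close>

class complex_vector = ab_group_add +
  fixes scaleC :: "complex \<Rightarrow> 'a \<Rightarrow> 'a"  (infixr "*\<^sub>C" 75)
  assumes scaleC_add_right: "a *\<^sub>C (x + y) = a *\<^sub>C x + a *\<^sub>C y"
    and scaleC_add_left: "(a + b) *\<^sub>C x = a *\<^sub>C x + b *\<^sub>C x"
    and scaleC_scaleC: "a *\<^sub>C b *\<^sub>C x = (a * b) *\<^sub>C x"
    and scaleC_one: "1 *\<^sub>C x = x"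

global_interpretation cvs: vector_space "scaleC :: complex \<Rightarrow> 'a \<Rightarrow> 'a::complex_vector"
  by unfold_locales (simp_all add: scaleC_add_right scaleC_add_left scaleC_scaleC scaleC_one)

instantiation complex :: complex_vector
begin
definition scaleC_complex :: "complex \<Rightarrow> complex \<Rightarrow> complex"
  where scaleC_complex_def [simp]: "c *\<^sub>C z = c * z"
instance by standard (simp_all add: algebra_simps)
end

instantiation prod :: (complex_vector, complex_vector) complex_vector
begin
definition scaleC_prod :: "complex \<Rightarrow> 'a \<times> 'b \<Rightarrow> 'a \<times> 'b"
  where scaleC_prod_def: "c *\<^sub>C p = (c *\<^sub>C fst p, c *\<^sub>C snd p)"
instance
  by standard (simp_all add: scaleC_prod_def scaleC_add_right scaleC_add_left scaleC_scaleC scaleC_one)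
end

instantiation "fun" :: (type, complex_vector) complex_vector
begin
definition scaleC_fun :: "complex \<Rightarrow> ('a \<Rightarrow> 'b) \<Rightarrow> 'a \<Rightarrow> 'b"
  where scaleC_fun_def: "c *\<^sub>C f = (\<lambda>x. c *\<^sub>C f x)"
instance
  by standard (simp_all add: scaleC_fun_def fun_eq_iff scaleC_add_right scaleC_add_left
      scaleC_scaleC scaleC_one)
end

definition fd_space :: "'a::complex_vector set \<Rightarrow> bool" where
  "fd_space V \<longleftrightarrow> cvs.subspace V \<and> (\<exists>B. finite B \<and> cvs.span B = V)"

text \<open>Maps on a subspace are normalised to vanish off it, so that the linear maps \<open>V \<rightarrow> W\<close> form a
  subspace of the function type, maps are equal iff they agree on \<open>V\<close>, and composition is \<open>\<circ>\<close>.\<close>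

definition lin :: "'a::complex_vector set \<Rightarrow> 'b::complex_vector set \<Rightarrow> ('a \<Rightarrow> 'b) set" where
  "lin V W = {f. (\<forall>x\<in>V. f x \<in> W) \<and> (\<forall>x\<in>V. \<forall>y\<in>V. f (x + y) = f x + f y)
     \<and> (\<forall>c. \<forall>x\<in>V. f (c *\<^sub>C x) = c *\<^sub>C f x) \<and> (\<forall>x. x \<notin> V \<longrightarrow> f x = 0)}"

definition restr0 :: "'a set \<Rightarrow> ('a \<Rightarrow> 'b::zero) \<Rightarrow> 'a \<Rightarrow> 'b" where
  "restr0 V f = (\<lambda>x. if x \<in> V then f x else 0)"

definition is_norm_on :: "'a::complex_vector set \<Rightarrow> ('a \<Rightarrow> real) \<Rightarrow> bool" where
  "is_norm_on V N \<longleftrightarrow>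
     (\<forall>x\<in>V. 0 \<le> N x \<and> (N x = 0 \<longleftrightarrow> x = 0)) \<and>
     (\<forall>x\<in>V. \<forall>c. N (c *\<^sub>C x) = cmod c * N x) \<and>
     (\<forall>x\<in>V. \<forall>y\<in>V. N (x + y) \<le> N x + N y)"

definition is_complete_on :: "'a::complex_vector set \<Rightarrow> ('a \<Rightarrow> real) \<Rightarrow> bool" where
  "is_complete_on V N \<longleftrightarrow>
     (\<forall>s :: nat \<Rightarrow> 'a. (\<forall>k. s k \<in> V) \<and> (\<forall>e>0. \<exists>K. \<forall>m\<ge>K. \<forall>k\<ge>K. N (s m - s k) < e)
        \<longrightarrow> (\<exists>l\<in>V. (\<lambda>k. N (s k - l)) \<longlonglongrightarrow> 0))"

subsection \<open>Tensor products\<close>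

text \<open>For finite-dimensional \<open>V\<close> and \<open>W\<close>, the assignment \<open>x \<otimes> y \<mapsto> (f \<mapsto> f y \<cdot> x)\<close> identifies the
  algebraic tensor product with the linear maps \<open>W\<^sup>* \<rightarrow> V\<close>. Lemma \<open>tensor_universal\<close> below is the
  universal property.\<close>

definition tens :: "'a::complex_vector set \<Rightarrow> 'b::complex_vector set \<Rightarrow> (('b \<Rightarrow> complex) \<Rightarrow> 'a) set" where
  "tens V W = lin (lin W UNIV) V"

definition pure :: "'b::complex_vector set \<Rightarrow> 'a::complex_vector \<Rightarrow> 'b \<Rightarrow> ('b \<Rightarrow> complex) \<Rightarrow> 'a" where
  "pure W x y = restr0 (lin W UNIV) (\<lambda>f. f y *\<^sub>C x)"

definition extends_pure ::
  "'a::complex_vector set \<Rightarrow> 'b::complex_vector set \<Rightarrow> ('a \<Rightarrow> 'b \<Rightarrow> 'c::ab_group_add) \<Rightarrow>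
   ((('b \<Rightarrow> complex) \<Rightarrow> 'a) \<Rightarrow> 'c) \<Rightarrow> bool" where
  "extends_pure V W b F \<longleftrightarrow>
     (\<forall>s\<in>tens V W. \<forall>t\<in>tens V W. F (s + t) = F s + F t) \<and>
     (\<forall>x\<in>V. \<forall>y\<in>W. F (pure W x y) = b x y) \<and>
     (\<forall>t. t \<notin> tens V W \<longrightarrow> F t = 0)"

text \<open>The extension of \<open>x \<otimes> y \<mapsto> b x y\<close> to the tensor product. Only additivity is demanded, so that
  the same operator serves for bilinear and for conjugate-bilinear \<open>b\<close>; the extension is then
  automatically linear respectively conjugate-linear.\<close>

definition tensor_ext ::
  "'a::complex_vector set \<Rightarrow> 'b::complex_vector set \<Rightarrow> ('a \<Rightarrow> 'b \<Rightarrow> 'c::ab_group_add) \<Rightarrow>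
   (('b \<Rightarrow> complex) \<Rightarrow> 'a) \<Rightarrow> 'c" where
  "tensor_ext V W b = (THE F. extends_pure V W b F)"

lemma lin_add: "f \<in> lin V W \<Longrightarrow> x \<in> V \<Longrightarrow> y \<in> V \<Longrightarrow> f (x + y) = f x + f y"
  and lin_scale: "f \<in> lin V W \<Longrightarrow> x \<in> V \<Longrightarrow> f (c *\<^sub>C x) = c *\<^sub>C f x"
  and lin_mem: "f \<in> lin V W \<Longrightarrow> x \<in> V \<Longrightarrow> f x \<in> W"
  and lin_off: "f \<in> lin V W \<Longrightarrow> x \<notin> V \<Longrightarrow> f x = 0"
  by (simp_all add: lin_def)

lemma sum_additive_on:
  assumes V: "cvs.subspace V" and add: "\<And>x y. x \<in> V \<Longrightarrow> y \<in> V \<Longrightarrow> f (x + y) = f x + f y"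
    and g: "\<And>e. e \<in> E \<Longrightarrow> g e \<in> V"
  shows "f (\<Sum>e\<in>E. g e) = (\<Sum>e\<in>E. (f (g e) :: 'c::ab_group_add))"
proof -
  have "f (0 + 0) = f 0 + f 0" using V by (intro add) (auto simp: cvs.subspace_0)
  then have f0: "f 0 = 0" by simp
  show ?thesis using g
  proof (induction E rule: infinite_finite_induct)
    case (insert e E)
    then show ?case using V by (simp add: add cvs.subspace_sum)
  qed (simp_all add: f0)
qed

lemma lin_subspace:
  assumes "cvs.subspace V" "cvs.subspace W" shows "cvs.subspace (lin V W)"
proof (rule cvs.subspaceI)
  show "0 \<in> lin V W" using assms by (auto simp: lin_def cvs.subspace_0)
next
  fix f g assume "f \<in> lin V W" "g \<in> lin V W"
  then show "f + g \<in> lin V W"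
    using assms by (auto simp: lin_def cvs.subspace_add scaleC_add_right)
next
  fix c f assume "f \<in> lin V W"
  then show "c *\<^sub>C f \<in> lin V W"
    using assms
    by (auto simp: lin_def cvs.subspace_scale scaleC_add_right scaleC_fun_def scaleC_scaleC mult.commute)
qed

lemma fd_space_coordinates:
  assumes "fd_space W"
  obtains E and d :: "'b::complex_vector \<Rightarrow> 'b \<Rightarrow> complex"
  where "finite E" "E \<subseteq> W" "\<And>e. e \<in> E \<Longrightarrow> d e \<in> lin W UNIV"
    "\<And>y. y \<in> W \<Longrightarrow> y = (\<Sum>e\<in>E. d e y *\<^sub>C e)"
proof -
  from assms obtain B where B: "finite B" "cvs.span B = W" by (auto simp: fd_space_def)
  obtain E where E: "E \<subseteq> B" "cvs.independent E" "B \<subseteq> cvs.span E"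
    using cvs.maximal_independent_subset by blast
  have sp: "cvs.span E = W"
    using E B by (metis cvs.span_mono cvs.span_span subset_antisym)
  define d where "d e = restr0 W (\<lambda>y. cvs.representation E y e)" for e
  have 1: "d e \<in> lin W UNIV" for e
    using E(2) cvs.subspace_add[OF cvs.subspace_span, of _ E] cvs.subspace_scale[OF cvs.subspace_span, of _ E]
    by (auto simp: lin_def d_def restr0_def sp cvs.representation_add cvs.representation_scale)
  have 2: "y = (\<Sum>e\<in>E. d e y *\<^sub>C e)" if "y \<in> W" for y
    using cvs.sum_representation_eq[of E y E] E(2) that sp B(1) E(1)
    by (auto simp: d_def restr0_def finite_subset)
  have fin: "finite E" using B(1) E(1) finite_subset by blast
  have sub: "E \<subseteq> W" using sp cvs.span_superset by blast
  show ?thesis by (rule that[OF fin sub 1 2])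
qed

lemma pure_in_tens:
  assumes "cvs.subspace V" "cvs.subspace W" "x \<in> V" "y \<in> W"
  shows "pure W x y \<in> tens V W"
proof -
  have L: "cvs.subspace (lin W (UNIV :: complex set))"
    by (intro lin_subspace assms) simp
  show ?thesis
    using assms cvs.subspace_add[OF L] cvs.subspace_scale[OF L]
    by (auto simp: tens_def pure_def lin_def[of "lin W UNIV"] restr0_def cvs.subspace_scale
        scaleC_add_left scaleC_fun_def scaleC_scaleC)
qed

lemma tens_expand:
  assumes "fd_space V" "fd_space W" and E: "finite E" "E \<subseteq> W"
    and d: "\<And>e. e \<in> E \<Longrightarrow> d e \<in> lin W UNIV" "\<And>y. y \<in> W \<Longrightarrow> y = (\<Sum>e\<in>E. d e y *\<^sub>C e)"
    and t: "t \<in> tens V W"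
  shows "t = (\<Sum>e\<in>E. pure W (t (d e)) e)"
proof
  fix h
  have sW: "cvs.subspace W" using assms by (auto simp: fd_space_def)
  have L: "cvs.subspace (lin W (UNIV :: complex set))" by (intro lin_subspace sW) simp
  have ev: "(\<Sum>e\<in>E. pure W (t (d e)) e) h = (\<Sum>e\<in>E. pure W (t (d e)) e h)"
    by (induction E rule: infinite_finite_induct) auto
  show "t h = (\<Sum>e\<in>E. pure W (t (d e)) e) h"
  proof (cases "h \<in> lin W UNIV")
    case False
    then show ?thesis using t unfolding ev by (simp add: tens_def lin_off pure_def restr0_def)
  next
    case h: True
    have "h = (\<Sum>e\<in>E. h e *\<^sub>C d e)"
    proof
      fix y
      have ev2: "(\<Sum>e\<in>E. h e *\<^sub>C d e) y = (\<Sum>e\<in>E. h e * d e y)"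
        by (induction E rule: infinite_finite_induct) (auto simp: scaleC_fun_def)
      show "h y = (\<Sum>e\<in>E. h e *\<^sub>C d e) y"
      proof (cases "y \<in> W")
        case True
        have "h y = h (\<Sum>e\<in>E. d e y *\<^sub>C e)" using d(2)[OF True] by simp
        also have "\<dots> = (\<Sum>e\<in>E. h (d e y *\<^sub>C e))"
          by (rule sum_additive_on[OF sW]) (use h E sW in \<open>auto simp: lin_add cvs.subspace_scale\<close>)
        also have "\<dots> = (\<Sum>e\<in>E. h e * d e y)"
          using h E by (intro sum.cong refl) (auto simp: lin_scale subset_iff)
        finally show ?thesis by (simp add: ev2)
      next
        case False
        then have "d e y = 0" if "e \<in> E" for e using d(1)[OF that] by (rule lin_off[rotated])
        then show ?thesis using h False by (simp add: ev2 lin_off)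
      qed
    qed
    then have "t h = t (\<Sum>e\<in>E. h e *\<^sub>C d e)" by simp
    also have "\<dots> = (\<Sum>e\<in>E. t (h e *\<^sub>C d e))"
      by (rule sum_additive_on[OF L])
        (use t d(1) in \<open>auto simp only: tens_def lin_add intro: cvs.subspace_scale[OF L]\<close>)
    also have "\<dots> = (\<Sum>e\<in>E. pure W (t (d e)) e h)"
      using t d h by (intro sum.cong refl) (auto simp: tens_def lin_scale pure_def restr0_def)
    finally show ?thesis by (simp add: ev)
  qed
qed

lemma tensor_universal:
  assumes V: "fd_space V" and W: "fd_space W"
    and b1: "\<And>x x' y. x \<in> V \<Longrightarrow> x' \<in> V \<Longrightarrow> y \<in> W \<Longrightarrow> b (x + x') y = b x y + b x' y"
    and b2: "\<And>x y y'. x \<in> V \<Longrightarrow> y \<in> W \<Longrightarrow> y' \<in> W \<Longrightarrow> b x (y + y') = b x y + b x y'"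
    and bal: "\<And>c x y. x \<in> V \<Longrightarrow> y \<in> W \<Longrightarrow> b (c *\<^sub>C x) y = b x (c *\<^sub>C y)"
  shows "\<exists>!F. extends_pure V W b F"
proof -
  have sV: "cvs.subspace V" and sW: "cvs.subspace W" using V W by (auto simp: fd_space_def)
  have L: "cvs.subspace (lin W (UNIV :: complex set))" by (intro lin_subspace sW) simp
  have T: "cvs.subspace (tens V W)" unfolding tens_def by (intro lin_subspace L sV)
  obtain E d where E: "finite E" "E \<subseteq> W" and d: "\<And>e. e \<in> E \<Longrightarrow> d e \<in> lin W UNIV"
    "\<And>y. y \<in> W \<Longrightarrow> y = (\<Sum>e\<in>E. d e y *\<^sub>C e)"
    using fd_space_coordinates[OF W] by metis
  have tV: "t (d e) \<in> V" if "t \<in> tens V W" "e \<in> E" for t e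
    using that d lin_mem by (fastforce simp: tens_def)
  define F where "F = restr0 (tens V W) (\<lambda>t. \<Sum>e\<in>E. b (t (d e)) e)"
  have "extends_pure V W b F"
    unfolding extends_pure_def
  proof (intro conjI ballI allI impI)
    fix s t assume "s \<in> tens V W" "t \<in> tens V W"
    then show "F (s + t) = F s + F t"
      using T E tV by (auto simp: F_def restr0_def cvs.subspace_add subset_iff b1
          sum.distrib[symmetric] intro!: sum.cong)
  next
    fix x y assume x: "x \<in> V" and y: "y \<in> W"
    have "F (pure W x y) = (\<Sum>e\<in>E. b (d e y *\<^sub>C x) e)"
      using pure_in_tens[OF sV sW x y] d by (auto simp: F_def restr0_def pure_def intro!: sum.cong)
    also have "\<dots> = (\<Sum>e\<in>E. b x (d e y *\<^sub>C e))"
      using x E by (intro sum.cong refl bal) auto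
    also have "\<dots> = b x (\<Sum>e\<in>E. d e y *\<^sub>C e)"
      by (rule sum_additive_on[OF sW, symmetric])
        (use x E sW in \<open>auto simp: b2 cvs.subspace_scale\<close>)
    finally show "F (pure W x y) = b x y" using d(2)[OF y] by simp
  qed (simp add: F_def restr0_def)
  moreover have "G = F" if G: "extends_pure V W b G" for G
  proof
    have G_add: "G (s + t) = G s + G t" if "s \<in> tens V W" "t \<in> tens V W" for s t
      using G that by (simp add: extends_pure_def)
    fix t
    show "G t = F t"
    proof (cases "t \<in> tens V W")
      case t: True
      have "G t = G (\<Sum>e\<in>E. pure W (t (d e)) e)"
        using tens_expand[OF V W E d t] by simp
      also have "\<dots> = (\<Sum>e\<in>E. G (pure W (t (d e)) e))"
        by (rule sum_additive_on[OF T])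
          (use G E tV[OF t] sV sW in \<open>blast intro: pure_in_tens G_add\<close>)+
      also have "\<dots> = F t"
        using G t E tV by (auto simp: extends_pure_def F_def restr0_def subset_iff intro!: sum.cong)
      finally show ?thesis .
    next
      case False
      then show ?thesis using G by (auto simp: extends_pure_def F_def restr0_def)
    qed
  qed
  ultimately show ?thesis by blast
qed

definition tensor_map ::
  "'a::complex_vector set \<Rightarrow> 'b::complex_vector set \<Rightarrow> 'd::complex_vector set \<Rightarrow>
   ('a \<Rightarrow> 'c::complex_vector) \<Rightarrow> ('b \<Rightarrow> 'd) \<Rightarrow> (('b \<Rightarrow> complex) \<Rightarrow> 'a) \<Rightarrow> (('d \<Rightarrow> complex) \<Rightarrow> 'c)" where
  "tensor_map V W W' f g = tensor_ext V W (\<lambda>x y. pure W' (f x) (g y))"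

definition assoc_map ::
  "'a::complex_vector set \<Rightarrow> 'b::complex_vector set \<Rightarrow> 'c::complex_vector set \<Rightarrow>
   (('c \<Rightarrow> complex) \<Rightarrow> ('b \<Rightarrow> complex) \<Rightarrow> 'a) \<Rightarrow> (((('c \<Rightarrow> complex) \<Rightarrow> 'b) \<Rightarrow> complex) \<Rightarrow> 'a)" where
  "assoc_map U V W = tensor_ext (tens U V) W
     (\<lambda>t z. tensor_ext U V (\<lambda>x y. pure (tens V W) x (pure W y z)) t)"

definition lunit_map :: "'a::complex_vector set \<Rightarrow> (('a \<Rightarrow> complex) \<Rightarrow> complex) \<Rightarrow> 'a" where
  "lunit_map V = tensor_ext UNIV V (\<lambda>c x. c *\<^sub>C x)"

definition runit_map :: "'a::complex_vector set \<Rightarrow> ((complex \<Rightarrow> complex) \<Rightarrow> 'a) \<Rightarrow> 'a" where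
  "runit_map V = tensor_ext V UNIV (\<lambda>x c. c *\<^sub>C x)"

section \<open>Operator spaces\<close>

text \<open>Matrices are functions vanishing outside the index range, so that \<open>mats n V\<close> is a subspace of
  the ambient function type. The size \<open>n = 0\<close> is allowed; \<open>mats 0 V\<close> is the zero space.\<close>

definition mats :: "nat \<Rightarrow> 'a::complex_vector set \<Rightarrow> (nat \<Rightarrow> nat \<Rightarrow> 'a) set" where
  "mats n V = {x. (\<forall>i<n. \<forall>j<n. x i j \<in> V) \<and> (\<forall>i j. \<not> (i < n \<and> j < n) \<longrightarrow> x i j = 0)}"

definition single :: "'a::zero \<Rightarrow> nat \<Rightarrow> nat \<Rightarrow> 'a" where
  "single x = (\<lambda>i j. if i = 0 \<and> j = 0 then x else 0)"

definition dsum :: "nat \<Rightarrow> nat \<Rightarrow> (nat \<Rightarrow> nat \<Rightarrow> 'a::zero) \<Rightarrow> (nat \<Rightarrow> nat \<Rightarrow> 'a) \<Rightarrow> nat \<Rightarrow> nat \<Rightarrow> 'a" where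
  "dsum m n x y = (\<lambda>i j. if i < m \<and> j < m then x i j
     else if m \<le> i \<and> i < m + n \<and> m \<le> j \<and> j < m + n then y (i - m) (j - m) else 0)"

definition scalar_bimult ::
  "nat \<Rightarrow> (nat \<Rightarrow> nat \<Rightarrow> complex) \<Rightarrow> (nat \<Rightarrow> nat \<Rightarrow> 'a::complex_vector) \<Rightarrow> (nat \<Rightarrow> nat \<Rightarrow> complex) \<Rightarrow>
   nat \<Rightarrow> nat \<Rightarrow> 'a" where
  "scalar_bimult n \<alpha> x \<beta> = (\<lambda>i j. \<Sum>k<n. \<Sum>l<n. (\<alpha> i k * \<beta> l j) *\<^sub>C x k l)"

definition opnorm :: "nat \<Rightarrow> (nat \<Rightarrow> nat \<Rightarrow> complex) \<Rightarrow> real" where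
  "opnorm n \<alpha> = Sup {L2_set (\<lambda>i. cmod (\<Sum>j<n. \<alpha> i j * v j)) {..<n} | v :: nat \<Rightarrow> complex.
     L2_set (\<lambda>j. cmod (v j)) {..<n} \<le> 1}"

text \<open>The norm \<open>mnorm X n\<close> is normalised to be \<open>0\<close> off \<open>mats n (carr X)\<close>, so that two operator spaces
  on the same ambient type are equal iff their carriers and matrix norms coincide.\<close>

record 'a opspace =
  carr :: "'a set"
  mnorm :: "nat \<Rightarrow> (nat \<Rightarrow> nat \<Rightarrow> 'a) \<Rightarrow> real"

definition operator_space :: "'a::complex_vector opspace \<Rightarrow> bool" where
  "operator_space X \<longleftrightarrow>
     cvs.subspace (carr X) \<and>
     (\<forall>n. is_norm_on (mats n (carr X)) (mnorm X n)) \<and>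
     (\<forall>n x. x \<notin> mats n (carr X) \<longrightarrow> mnorm X n x = 0) \<and>
     is_complete_on (mats 1 (carr X)) (mnorm X 1) \<and>
     (\<forall>m n. \<forall>x\<in>mats m (carr X). \<forall>y\<in>mats n (carr X).
        mnorm X (m + n) (dsum m n x y) = max (mnorm X m x) (mnorm X n y)) \<and>
     (\<forall>m. \<forall>x\<in>mats m (carr X). \<forall>\<alpha>\<in>mats m UNIV. \<forall>\<beta>\<in>mats m UNIV.
        mnorm X m (scalar_bimult m \<alpha> x \<beta>) \<le> opnorm m \<alpha> * mnorm X m x * opnorm m \<beta>)"

definition fd_operator_space :: "'a::complex_vector opspace \<Rightarrow> bool" where
  "fd_operator_space X \<longleftrightarrow> operator_space X \<and> fd_space (carr X)"

definition vnorm :: "'a::complex_vector opspace \<Rightarrow> 'a \<Rightarrow> real" where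
  "vnorm X x = mnorm X 1 (single x)"

definition unit_ball :: "'a::complex_vector opspace \<Rightarrow> 'a set" where
  "unit_ball X = {x \<in> carr X. vnorm X x \<le> 1}"

definition amp :: "('a \<Rightarrow> 'b) \<Rightarrow> (nat \<Rightarrow> nat \<Rightarrow> 'a) \<Rightarrow> nat \<Rightarrow> nat \<Rightarrow> 'b" where
  "amp f x = (\<lambda>i j. f (x i j))"

definition complete_contraction ::
  "'a::complex_vector opspace \<Rightarrow> 'b::complex_vector opspace \<Rightarrow> ('a \<Rightarrow> 'b) \<Rightarrow> bool" where
  "complete_contraction X Y f \<longleftrightarrow> f \<in> lin (carr X) (carr Y) \<and>
     (\<forall>n. \<forall>x\<in>mats n (carr X). mnorm Y n (amp f x) \<le> mnorm X n x)"

definition complex_os :: "complex opspace" where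
  "complex_os = \<lparr>carr = UNIV, mnorm = (\<lambda>n. restr0 (mats n UNIV) (opnorm n))\<rparr>"

text \<open>\<open>M\<^sub>n(Y)\<close> as an operator space: a \<open>k \<times> k\<close> matrix of \<open>n \<times> n\<close> matrices is read as a
  \<open>kn \<times> kn\<close> matrix.\<close>

definition flatten :: "nat \<Rightarrow> (nat \<Rightarrow> nat \<Rightarrow> nat \<Rightarrow> nat \<Rightarrow> 'a) \<Rightarrow> nat \<Rightarrow> nat \<Rightarrow> 'a" where
  "flatten n z = (\<lambda>p q. z (p div n) (q div n) (p mod n) (q mod n))"

definition mat_os :: "nat \<Rightarrow> 'a::complex_vector opspace \<Rightarrow> (nat \<Rightarrow> nat \<Rightarrow> 'a) opspace" where
  "mat_os n Y = \<lparr>carr = mats n (carr Y),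
     mnorm = (\<lambda>k. restr0 (mats k (mats n (carr Y))) (\<lambda>z. mnorm Y (k * n) (flatten n z)))\<rparr>"

definition cb_values ::
  "'a::complex_vector opspace \<Rightarrow> 'b::complex_vector opspace \<Rightarrow> ('a \<Rightarrow> 'b) \<Rightarrow> real set" where
  "cb_values X Y f = {mnorm Y n (amp f x) | n x. x \<in> mats n (carr X) \<and> mnorm X n x \<le> 1}"

definition CB ::
  "'a::complex_vector opspace \<Rightarrow> 'b::complex_vector opspace \<Rightarrow> ('a \<Rightarrow> 'b) opspace" where
  "CB X Y = (let C = {f \<in> lin (carr X) (carr Y). bdd_above (cb_values X Y f)} in
     \<lparr>carr = C,
      mnorm = (\<lambda>n. restr0 (mats n C) (\<lambda>F. Sup (cb_values X (mat_os n Y) (\<lambda>x i j. F i j x))))\<rparr>)"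

definition dual :: "'a::complex_vector opspace \<Rightarrow> ('a \<Rightarrow> complex) opspace" where
  "dual X = CB X complex_os"

definition sum_os ::
  "'a::complex_vector opspace \<Rightarrow> 'b::complex_vector opspace \<Rightarrow> ('a \<times> 'b) opspace"
  (infixr "\<oplus>\<^sub>\<infinity>" 65) where
  "X \<oplus>\<^sub>\<infinity> Y = \<lparr>carr = carr X \<times> carr Y,
     mnorm = (\<lambda>n. restr0 (mats n (carr X \<times> carr Y))
       (\<lambda>z. max (mnorm X n (amp fst z)) (mnorm Y n (amp snd z))))\<rparr>"

definition zero_os :: "'a::complex_vector opspace" where
  "zero_os = \<lparr>carr = {0}, mnorm = (\<lambda>n x. 0)\<rparr>"

definition inj_tensor ::
  "'a::complex_vector opspace \<Rightarrow> 'b::complex_vector opspace \<Rightarrow> (('b \<Rightarrow> complex) \<Rightarrow> 'a) opspace"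
  (infixr "\<otimes>\<^sub>i" 70) where
  "X \<otimes>\<^sub>i Y = \<lparr>carr = tens (carr X) (carr Y), mnorm = mnorm (CB (dual Y) X)\<rparr>"

section \<open>Bipolar sets and the category \<open>Q\<close>\<close>

definition polar :: "'a::complex_vector opspace \<Rightarrow> 'a set \<Rightarrow> ('a \<Rightarrow> complex) set" where
  "polar X S = {f \<in> unit_ball (dual X). \<forall>s\<in>S. f s = 1}"

definition canon :: "'a::complex_vector opspace \<Rightarrow> 'a \<Rightarrow> ('a \<Rightarrow> complex) \<Rightarrow> complex" where
  "canon X x = restr0 (carr (dual X)) (\<lambda>f. f x)"

text \<open>The polar of a subset of the dual of \<open>X\<close>, pulled back to \<open>X\<close> along \<open>canon X\<close>.\<close>

definition polar_back :: "'a::complex_vector opspace \<Rightarrow> ('a \<Rightarrow> complex) set \<Rightarrow> 'a set" where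
  "polar_back X T = {x \<in> carr X. canon X x \<in> polar (dual X) T}"

definition bipolar :: "'a::complex_vector opspace \<Rightarrow> 'a set \<Rightarrow> bool" where
  "bipolar X S \<longleftrightarrow> S = polar_back X (polar X S)"

type_synonym 'a Qob = "'a opspace \<times> 'a set"

definition Q_obj :: "'a::complex_vector Qob \<Rightarrow> bool" where
  "Q_obj P \<longleftrightarrow> fd_operator_space (fst P) \<and> snd P \<subseteq> unit_ball (fst P) \<and> bipolar (fst P) (snd P)"

definition Q_hom :: "'a::complex_vector Qob \<Rightarrow> 'b::complex_vector Qob \<Rightarrow> ('a \<Rightarrow> 'b) set" where
  "Q_hom P R = {f. complete_contraction (fst P) (fst R) f \<and> f ` snd P \<subseteq> snd R}"

definition Q_id :: "'a::complex_vector Qob \<Rightarrow> 'a \<Rightarrow> 'a" where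
  "Q_id P = restr0 (carr (fst P)) id"

text \<open>In the tensor product, \<open>s' \<otimes> r'\<close> is the functional with \<open>x \<otimes> y \<mapsto> s' x \<cdot> r' y\<close>.\<close>

definition functional_tensor ::
  "'a::complex_vector opspace \<Rightarrow> 'b::complex_vector opspace \<Rightarrow> ('a \<Rightarrow> complex) \<Rightarrow> ('b \<Rightarrow> complex) \<Rightarrow>
   (('b \<Rightarrow> complex) \<Rightarrow> 'a) \<Rightarrow> complex" where
  "functional_tensor X Y f g = tensor_ext (carr X) (carr Y) (\<lambda>x y. f x * g y)"

definition Q_tensor ::
  "'a::complex_vector Qob \<Rightarrow> 'b::complex_vector Qob \<Rightarrow> (('b \<Rightarrow> complex) \<Rightarrow> 'a) Qob" where
  "Q_tensor P R = (fst P \<otimes>\<^sub>i fst R,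
     polar_back (fst P \<otimes>\<^sub>i fst R)
       {functional_tensor (fst P) (fst R) s' r' | s' r'.
          s' \<in> polar (fst P) (snd P) \<and> r' \<in> polar (fst R) (snd R)})"

definition Q_tensor_hom ::
  "'a::complex_vector Qob \<Rightarrow> 'b::complex_vector Qob \<Rightarrow> 'd::complex_vector Qob \<Rightarrow>
   ('a \<Rightarrow> 'c::complex_vector) \<Rightarrow> ('b \<Rightarrow> 'd) \<Rightarrow> (('b \<Rightarrow> complex) \<Rightarrow> 'a) \<Rightarrow> (('d \<Rightarrow> complex) \<Rightarrow> 'c)" where
  "Q_tensor_hom P R R' = tensor_map (carr (fst P)) (carr (fst R)) (carr (fst R'))"

definition Q_unit :: "complex Qob" where
  "Q_unit = (complex_os, {1})"

definition Q_assoc ::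
  "'a::complex_vector Qob \<Rightarrow> 'b::complex_vector Qob \<Rightarrow> 'c::complex_vector Qob \<Rightarrow>
   (('c \<Rightarrow> complex) \<Rightarrow> ('b \<Rightarrow> complex) \<Rightarrow> 'a) \<Rightarrow> (((('c \<Rightarrow> complex) \<Rightarrow> 'b) \<Rightarrow> complex) \<Rightarrow> 'a)" where
  "Q_assoc P R T = assoc_map (carr (fst P)) (carr (fst R)) (carr (fst T))"

definition Q_lunit :: "'a::complex_vector Qob \<Rightarrow> (('a \<Rightarrow> complex) \<Rightarrow> complex) \<Rightarrow> 'a" where
  "Q_lunit P = lunit_map (carr (fst P))"

definition Q_runit :: "'a::complex_vector Qob \<Rightarrow> ((complex \<Rightarrow> complex) \<Rightarrow> 'a) \<Rightarrow> 'a" where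
  "Q_runit P = runit_map (carr (fst P))"

definition Q_prod ::
  "'a::complex_vector Qob \<Rightarrow> 'b::complex_vector Qob \<Rightarrow> ('a \<times> 'b) Qob" where
  "Q_prod P R = (fst P \<oplus>\<^sub>\<infinity> fst R, snd P \<times> snd R)"

definition Q_fst :: "'a::complex_vector Qob \<Rightarrow> 'b::complex_vector Qob \<Rightarrow> 'a \<times> 'b \<Rightarrow> 'a" where
  "Q_fst P R = restr0 (carr (fst P) \<times> carr (fst R)) fst"

definition Q_snd :: "'a::complex_vector Qob \<Rightarrow> 'b::complex_vector Qob \<Rightarrow> 'a \<times> 'b \<Rightarrow> 'b" where
  "Q_snd P R = restr0 (carr (fst P) \<times> carr (fst R)) snd"

definition Q_terminal :: "'a::complex_vector Qob" where
  "Q_terminal = (zero_os, {0})"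

section \<open>Finite-dimensional von Neumann algebras and the category \<open>H\<close>\<close>

record 'a cstar =
  acarr :: "'a set"
  amul :: "'a \<Rightarrow> 'a \<Rightarrow> 'a"
  aone :: "'a"
  astar :: "'a \<Rightarrow> 'a"
  anorm :: "'a \<Rightarrow> real"

definition unital_star_algebra :: "'a::complex_vector cstar \<Rightarrow> bool" where
  "unital_star_algebra A \<longleftrightarrow>
     cvs.subspace (acarr A) \<and>
     (\<forall>x\<in>acarr A. \<forall>y\<in>acarr A. amul A x y \<in> acarr A) \<and>
     (\<forall>x\<in>acarr A. \<forall>y\<in>acarr A. \<forall>z\<in>acarr A.
        amul A (x + y) z = amul A x z + amul A y z \<and>
        amul A x (y + z) = amul A x y + amul A x z \<and>
        amul A (amul A x y) z = amul A x (amul A y z)) \<and>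
     (\<forall>c. \<forall>x\<in>acarr A. \<forall>y\<in>acarr A.
        amul A (c *\<^sub>C x) y = c *\<^sub>C amul A x y \<and> amul A x (c *\<^sub>C y) = c *\<^sub>C amul A x y) \<and>
     aone A \<in> acarr A \<and>
     (\<forall>x\<in>acarr A. amul A (aone A) x = x \<and> amul A x (aone A) = x) \<and>
     (\<forall>x\<in>acarr A. astar A x \<in> acarr A \<and> astar A (astar A x) = x) \<and>
     (\<forall>x\<in>acarr A. \<forall>y\<in>acarr A.
        astar A (x + y) = astar A x + astar A y \<and> astar A (amul A x y) = amul A (astar A y) (astar A x)) \<and>
     (\<forall>c. \<forall>x\<in>acarr A. astar A (c *\<^sub>C x) = cnj c *\<^sub>C astar A x)"

definition is_cstar_norm :: "'a::complex_vector cstar \<Rightarrow> ('a \<Rightarrow> real) \<Rightarrow> bool" where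
  "is_cstar_norm A N \<longleftrightarrow>
     is_norm_on (acarr A) N \<and> is_complete_on (acarr A) N \<and>
     (\<forall>x\<in>acarr A. \<forall>y\<in>acarr A. N (amul A x y) \<le> N x * N y) \<and>
     (\<forall>x\<in>acarr A. N (amul A (astar A x) x) = (N x)\<^sup>2)"

definition fd_vn_algebra :: "'a::complex_vector cstar \<Rightarrow> bool" where
  "fd_vn_algebra A \<longleftrightarrow> unital_star_algebra A \<and> is_cstar_norm A (anorm A) \<and> fd_space (acarr A)"

text \<open>The norm field of \<open>mat_alg\<close> is the C*-norm vanishing off the carrier, which is unique.\<close>

definition mat_star_alg :: "nat \<Rightarrow> 'a::complex_vector cstar \<Rightarrow> (nat \<Rightarrow> nat \<Rightarrow> 'a) cstar" where
  "mat_star_alg n A = \<lparr>acarr = mats n (acarr A),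
     amul = (\<lambda>x y i j. if i < n \<and> j < n then \<Sum>k<n. amul A (x i k) (y k j) else 0),
     aone = (\<lambda>i j. if i = j \<and> i < n then aone A else 0),
     astar = (\<lambda>x i j. if i < n \<and> j < n then astar A (x j i) else 0),
     anorm = (\<lambda>x. 0)\<rparr>"

definition mat_alg :: "nat \<Rightarrow> 'a::complex_vector cstar \<Rightarrow> (nat \<Rightarrow> nat \<Rightarrow> 'a) cstar" where
  "mat_alg n A = (mat_star_alg n A)
     \<lparr>anorm := (THE N. is_cstar_norm (mat_star_alg n A) N \<and> (\<forall>x. x \<notin> mats n (acarr A) \<longrightarrow> N x = 0))\<rparr>"

definition os_of :: "'a::complex_vector cstar \<Rightarrow> 'a opspace" where
  "os_of A = \<lparr>carr = acarr A, mnorm = (\<lambda>n. anorm (mat_alg n A))\<rparr>"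

definition complex_alg :: "complex cstar" where
  "complex_alg = \<lparr>acarr = UNIV, amul = (*), aone = 1, astar = cnj, anorm = cmod\<rparr>"

definition alg_tensor ::
  "'a::complex_vector cstar \<Rightarrow> 'b::complex_vector cstar \<Rightarrow> (('b \<Rightarrow> complex) \<Rightarrow> 'a) cstar" where
  "alg_tensor A B = \<lparr>acarr = tens (acarr A) (acarr B),
     amul = (\<lambda>s t. tensor_ext (acarr A) (acarr B)
       (\<lambda>a b. tensor_ext (acarr A) (acarr B) (\<lambda>c d. pure (acarr B) (amul A a c) (amul B b d)) t) s),
     aone = pure (acarr B) (aone A) (aone B),
     astar = tensor_ext (acarr A) (acarr B) (\<lambda>a b. pure (acarr B) (astar A a) (astar B b)),
     anorm = vnorm (os_of A \<otimes>\<^sub>i os_of B)\<rparr>"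

definition alg_prod ::
  "'a::complex_vector cstar \<Rightarrow> 'b::complex_vector cstar \<Rightarrow> ('a \<times> 'b) cstar" where
  "alg_prod A B = \<lparr>acarr = acarr A \<times> acarr B,
     amul = (\<lambda>p q. (amul A (fst p) (fst q), amul B (snd p) (snd q))),
     aone = (aone A, aone B),
     astar = (\<lambda>p. (astar A (fst p), astar B (snd p))),
     anorm = (\<lambda>p. max (anorm A (fst p)) (anorm B (snd p)))\<rparr>"

definition zero_alg :: "'a::complex_vector cstar" where
  "zero_alg = \<lparr>acarr = {0}, amul = (\<lambda>x y. 0), aone = 0, astar = (\<lambda>x. 0), anorm = (\<lambda>x. 0)\<rparr>"

definition positive :: "'a cstar \<Rightarrow> 'a set" where
  "positive A = {amul A (astar A a) a | a. a \<in> acarr A}"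

definition completely_positive ::
  "'a::complex_vector cstar \<Rightarrow> 'b::complex_vector cstar \<Rightarrow> ('a \<Rightarrow> 'b) \<Rightarrow> bool" where
  "completely_positive A B \<phi> \<longleftrightarrow> \<phi> \<in> lin (acarr A) (acarr B) \<and>
     (\<forall>n. \<forall>t\<in>positive (alg_tensor (mat_alg n complex_alg) A).
        tensor_map (mats n UNIV) (acarr A) (acarr B) id \<phi> t
          \<in> positive (alg_tensor (mat_alg n complex_alg) B))"

definition H_hom :: "'a::complex_vector cstar \<Rightarrow> 'b::complex_vector cstar \<Rightarrow> ('a \<Rightarrow> 'b) set" where
  "H_hom A B = {\<phi>. completely_positive A B \<phi> \<and> \<phi> (aone A) = aone B}"

definition H_id :: "'a::complex_vector cstar \<Rightarrow> 'a \<Rightarrow> 'a" where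
  "H_id A = restr0 (acarr A) id"

definition H_tensor_hom ::
  "'a::complex_vector cstar \<Rightarrow> 'b::complex_vector cstar \<Rightarrow> 'd::complex_vector cstar \<Rightarrow>
   ('a \<Rightarrow> 'c::complex_vector) \<Rightarrow> ('b \<Rightarrow> 'd) \<Rightarrow> (('b \<Rightarrow> complex) \<Rightarrow> 'a) \<Rightarrow> (('d \<Rightarrow> complex) \<Rightarrow> 'c)" where
  "H_tensor_hom A B B' = tensor_map (acarr A) (acarr B) (acarr B')"

definition H_assoc ::
  "'a::complex_vector cstar \<Rightarrow> 'b::complex_vector cstar \<Rightarrow> 'c::complex_vector cstar \<Rightarrow>
   (('c \<Rightarrow> complex) \<Rightarrow> ('b \<Rightarrow> complex) \<Rightarrow> 'a) \<Rightarrow> (((('c \<Rightarrow> complex) \<Rightarrow> 'b) \<Rightarrow> complex) \<Rightarrow> 'a)" where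
  "H_assoc A B C = assoc_map (acarr A) (acarr B) (acarr C)"

definition H_lunit :: "'a::complex_vector cstar \<Rightarrow> (('a \<Rightarrow> complex) \<Rightarrow> complex) \<Rightarrow> 'a" where
  "H_lunit A = lunit_map (acarr A)"

definition H_runit :: "'a::complex_vector cstar \<Rightarrow> ((complex \<Rightarrow> complex) \<Rightarrow> 'a) \<Rightarrow> 'a" where
  "H_runit A = runit_map (acarr A)"

definition H_fst :: "'a::complex_vector cstar \<Rightarrow> 'b::complex_vector cstar \<Rightarrow> 'a \<times> 'b \<Rightarrow> 'a" where
  "H_fst A B = restr0 (acarr A \<times> acarr B) fst"

definition H_snd :: "'a::complex_vector cstar \<Rightarrow> 'b::complex_vector cstar \<Rightarrow> 'a \<times> 'b \<Rightarrow> 'b" where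
  "H_snd A B = restr0 (acarr A \<times> acarr B) snd"

section \<open>The functor\<close>

definition functor_obj :: "'a::complex_vector cstar \<Rightarrow> 'a Qob" where
  "functor_obj A = (os_of A, {aone A})"

definition functor_hom :: "('a \<Rightarrow> 'b) \<Rightarrow> 'a \<Rightarrow> 'b" where
  "functor_hom f = f"

end

theory Submission
  imports Defs "Jordan_Normal_Form.Schur_Decomposition"
begin

text \<open>A finite-dimensional C*-algebra \<open>A\<close> has a faithful representation by complex matrices: the trace
  of left multiplication is a faithful positive functional, and \<open>A\<close> acts on itself with the resulting
  inner product. All C*-norms involved are therefore operator norms of concrete matrices, by
  uniqueness of the C*-norm of a finite-dimensional *-algebra. In these terms the injective tensor
  norm is the operator norm in the tensor product of the representations.

  The vector functionals of the representation span the dual space, hence so do the states, that is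
  the elements of the polar of \<open>{1}\<close>. As the states separate points, \<open>{1}\<close> is bipolar, and as products
  of states separate the points of the tensor product, so is \<open>{1 \<otimes> 1}\<close>. Fullness is the fact that a
  unital map between C*-algebras is completely positive iff it is completely contractive.\<close>

section \<open>Norms of complex matrices over finite index sets\<close>

text \<open>Three elementary devices do the work of spectral theory. Iterated squaring, with
  ||h^(2^k)|| = ||h||^(2^k) for hermitian h, plays the part of the spectral radius formula and gives
  uniqueness of the C*-norm. The estimate ||h + it||^2 \<le> ||h||^2 + t^2 for all real t forces
  reality twice: of the eigenvalues of left multiplication by h, which makes the trace of h^2 a sum
  of real squares, and of the numerical values of the image of h under a unital contraction. A fixed
  point iteration gives square roots of hermitian t with ||1 - t|| \<le> 1.

  The regular representation is chosen because evaluating at the unit recovers the element: every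
  functional on A is then a single vector functional, so it is completely bounded, and polarization
  splits it into vector states. For the tensor norm, the supremum over contractive matrices of
  functionals on B is attained at the coefficient functionals of the representation of B.

  The coherence maps and projections agree by definition, since on both sides they are built from
  the same carriers; the content lies in the equality of objects and of hom-sets.\<close>

definition l2 :: "'i set \<Rightarrow> ('i \<Rightarrow> complex) \<Rightarrow> real" where
  "l2 I u = L2_set (\<lambda>i. cmod (u i)) I"

definition mulv :: "'i set \<Rightarrow> ('i \<Rightarrow> 'i \<Rightarrow> complex) \<Rightarrow> ('i \<Rightarrow> complex) \<Rightarrow> 'i \<Rightarrow> complex" where
  "mulv I a v = (\<lambda>i. \<Sum>j\<in>I. a i j * v j)"

text \<open>Bilinear, not sesquilinear, which keeps conjugates out of products and reindexing;
  statements about positivity pass \<open>\<lambda>i. cnj (u i)\<close> as first vector.\<close>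

definition bil :: "'i set \<Rightarrow> ('i \<Rightarrow> 'i \<Rightarrow> complex) \<Rightarrow> ('i \<Rightarrow> complex) \<Rightarrow> ('i \<Rightarrow> complex) \<Rightarrow> complex" where
  "bil I a u v = (\<Sum>i\<in>I. \<Sum>j\<in>I. u i * a i j * v j)"

text \<open>The operator norm. The index set is arbitrary, so that products and disjoint sums of
  index sets can serve for tensor products and direct sums.\<close>

definition gnorm :: "'i set \<Rightarrow> ('i \<Rightarrow> 'i \<Rightarrow> complex) \<Rightarrow> real" where
  "gnorm I a = Sup {cmod (bil I a u v) |u v. l2 I u \<le> 1 \<and> l2 I v \<le> 1}"

lemma l2_nonneg [simp]: "0 \<le> l2 I u"
  by (simp add: l2_def)

lemma l2_power2: "(l2 I u)\<^sup>2 = (\<Sum>i\<in>I. (cmod (u i))\<^sup>2)"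
  by (simp add: l2_def L2_set_def sum_nonneg)

lemma l2_power2_complex: "complex_of_real ((l2 I u)\<^sup>2) = (\<Sum>i\<in>I. cnj (u i) * u i)"
  by (simp add: l2_power2 complex_norm_square mult.commute del: of_real_power)

lemma l2_scale: "l2 I (\<lambda>i. c * u i) = cmod c * l2 I u"
  by (simp add: l2_def norm_mult L2_set_right_distrib)

lemma l2_cong: "(\<And>i. i \<in> I \<Longrightarrow> u i = v i) \<Longrightarrow> l2 I u = l2 I v"
  by (auto simp: l2_def intro: L2_set_cong)

lemma l2_cnj [simp]: "l2 I (\<lambda>i. cnj (u i)) = l2 I u"
  by (simp add: l2_def)

lemma l2_zero [simp]: "l2 I (\<lambda>i. 0) = 0"
  by (simp add: l2_def L2_set_def)

lemma l2_component: "finite I \<Longrightarrow> i \<in> I \<Longrightarrow> cmod (u i) \<le> l2 I u"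
  using member_le_L2_set[of I i "\<lambda>i. cmod (u i)"] by (simp add: l2_def)

lemma l2_eq_0: "finite I \<Longrightarrow> l2 I u = 0 \<Longrightarrow> i \<in> I \<Longrightarrow> u i = 0"
  using l2_component[of I i u] by simp

lemma l2_cauchy: "cmod (\<Sum>i\<in>I. u i * v i) \<le> l2 I u * l2 I v"
proof -
  have "cmod (\<Sum>i\<in>I. u i * v i) \<le> (\<Sum>i\<in>I. \<bar>cmod (u i)\<bar> * \<bar>cmod (v i)\<bar>)"
    by (rule order_trans[OF norm_sum]) (simp add: norm_mult)
  also have "\<dots> \<le> l2 I u * l2 I v"
    unfolding l2_def by (rule L2_set_mult_ineq)
  finally show ?thesis .
qed

lemma l2_reindex: "bij_betw h I J \<Longrightarrow> l2 J u = l2 I (\<lambda>i. u (h i))"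
  by (simp add: l2_def L2_set_def sum.reindex_bij_betw[symmetric, of h I J])

lemma l2_le_iff: "c \<ge> 0 \<Longrightarrow> l2 I u \<le> c \<longleftrightarrow> (\<Sum>i\<in>I. (cmod (u i))\<^sup>2) \<le> c\<^sup>2"
  by (metis l2_nonneg l2_power2 power2_le_imp_le power_mono)

lemma bil_mulv: "bil I a u v = (\<Sum>i\<in>I. u i * mulv I a v i)"
  by (simp add: bil_def mulv_def sum_distrib_left mult.assoc)

lemma bil_scale: "bil I a (\<lambda>i. c * u i) (\<lambda>i. d * v i) = c * d * bil I a u v"
  by (simp add: bil_def sum_distrib_left mult_ac)

lemma bil_cong:
  assumes "\<And>i j. i \<in> I \<Longrightarrow> j \<in> I \<Longrightarrow> a i j = b i j"
    and "\<And>i. i \<in> I \<Longrightarrow> u i = u' i" and "\<And>i. i \<in> I \<Longrightarrow> v i = v' i"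
  shows "bil I a u v = bil I b u' v'"
  using assms by (simp add: bil_def)

text \<open>A crude estimate, which serves to make the supremum in \<open>gnorm\<close> one over a
  bounded set.\<close>

lemma bil_bounded:
  assumes "finite I"
  shows "cmod (bil I a u v) \<le> (\<Sum>i\<in>I. \<Sum>j\<in>I. cmod (a i j)) * l2 I u * l2 I v"
proof -
  have "cmod (bil I a u v) \<le> (\<Sum>i\<in>I. \<Sum>j\<in>I. cmod (u i * a i j * v j))"
    unfolding bil_def by (intro order_trans[OF norm_sum] sum_mono norm_sum)
  also have "\<dots> \<le> (\<Sum>i\<in>I. \<Sum>j\<in>I. l2 I u * cmod (a i j) * l2 I v)"
    unfolding norm_mult by (intro sum_mono mult_mono l2_component assms) auto
  finally show ?thesis by (simp add: sum_distrib_left sum_distrib_right mult_ac)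
qed

lemma gnorm_bdd:
  assumes "finite I"
  shows "bdd_above {cmod (bil I a u v) |u v. l2 I u \<le> 1 \<and> l2 I v \<le> 1}"
proof (rule bdd_aboveI)
  let ?C = "\<Sum>i\<in>I. \<Sum>j\<in>I. cmod (a i j)"
  fix x assume "x \<in> {cmod (bil I a u v) |u v. l2 I u \<le> 1 \<and> l2 I v \<le> 1}"
  then obtain u v where x: "x = cmod (bil I a u v)" and uv: "l2 I u \<le> 1" "l2 I v \<le> 1" by blast
  have C: "?C \<ge> 0" by (intro sum_nonneg) auto
  have "x \<le> ?C * l2 I u * l2 I v" using bil_bounded[OF assms] x by simp
  also have "\<dots> \<le> ?C * 1 * 1" by (intro mult_mono C uv) (auto simp: C)
  finally show "x \<le> ?C" by simp
qed

lemma gnorm_le: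
  assumes "c \<ge> 0" and "\<And>u v. cmod (bil I a u v) \<le> c * l2 I u * l2 I v"
  shows "gnorm I a \<le> c"
  unfolding gnorm_def
proof (rule cSup_least)
  show "{cmod (bil I a u v) |u v. l2 I u \<le> 1 \<and> l2 I v \<le> 1} \<noteq> {}"
    using l2_zero[of I] by (metis (mono_tags, lifting) empty_Collect_eq zero_le_one)
next
  fix x assume "x \<in> {cmod (bil I a u v) |u v. l2 I u \<le> 1 \<and> l2 I v \<le> 1}"
  then obtain u v where x: "x = cmod (bil I a u v)" and uv: "l2 I u \<le> 1" "l2 I v \<le> 1" by blast
  have "x \<le> c * l2 I u * l2 I v" using assms x by simp
  also have "\<dots> \<le> c * 1 * 1" using assms(1) uv by (intro mult_mono) auto
  finally show "x \<le> c" by simp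
qed

lemma gnorm_upper: "finite I \<Longrightarrow> l2 I u \<le> 1 \<Longrightarrow> l2 I v \<le> 1 \<Longrightarrow> cmod (bil I a u v) \<le> gnorm I a"
  unfolding gnorm_def by (rule cSup_upper) (auto intro: gnorm_bdd)

lemma gnorm_nonneg [simp]: "finite I \<Longrightarrow> 0 \<le> gnorm I a"
  using gnorm_upper[of I "\<lambda>i. 0" "\<lambda>i. 0" a] by (simp add: order_trans[OF norm_ge_zero])

lemma gnorm_bound:
  assumes "finite I"
  shows "cmod (bil I a u v) \<le> gnorm I a * l2 I u * l2 I v"
proof (cases "l2 I u = 0 \<or> l2 I v = 0")
  case True
  then have "(\<forall>i\<in>I. u i = 0) \<or> (\<forall>i\<in>I. v i = 0)"
    using l2_eq_0[OF assms] by blast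
  then have "bil I a u v = 0" by (auto simp: bil_def)
  then show ?thesis using assms by simp
next
  case False
  let ?c = "complex_of_real (inverse (l2 I u))" and ?d = "complex_of_real (inverse (l2 I v))"
  have "cmod (bil I a (\<lambda>i. ?c * u i) (\<lambda>i. ?d * v i)) \<le> gnorm I a"
    using False by (intro gnorm_upper assms) (auto simp: l2_scale norm_inverse)
  then have "inverse (l2 I u) * inverse (l2 I v) * cmod (bil I a u v) \<le> gnorm I a"
    by (simp only: bil_scale norm_mult norm_of_real) simp
  moreover have "l2 I u > 0" "l2 I v > 0" using False by (auto simp: less_le)
  ultimately show ?thesis by (simp add: field_simps)
qed

lemma gnorm_cong:
  assumes "\<And>i j. i \<in> I \<Longrightarrow> j \<in> I \<Longrightarrow> a i j = b i j"
  shows "gnorm I a = gnorm I b"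
proof -
  have "bil I a u v = bil I b u v" for u v by (rule bil_cong) (use assms in auto)
  then show ?thesis by (simp add: gnorm_def)
qed

lemma gnorm_reindex_le:
  assumes "bij_betw h I J" "finite I"
  shows "gnorm J a \<le> gnorm I (\<lambda>i j. a (h i) (h j))"
proof (rule gnorm_le)
  fix u v
  have "bil J a u v = bil I (\<lambda>i j. a (h i) (h j)) (\<lambda>i. u (h i)) (\<lambda>i. v (h i))"
    by (simp add: bil_def sum.reindex_bij_betw[OF assms(1), symmetric])
  then show "cmod (bil J a u v) \<le> gnorm I (\<lambda>i j. a (h i) (h j)) * l2 J u * l2 J v"
    using gnorm_bound[OF assms(2)] by (simp add: l2_reindex[OF assms(1)])
qed (use assms in simp)

lemma gnorm_reindex:
  assumes "bij_betw h I J" "finite I"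
  shows "gnorm J a = gnorm I (\<lambda>i j. a (h i) (h j))"
proof (rule antisym)
  have "gnorm I (\<lambda>i j. a (h i) (h j))
      \<le> gnorm J (\<lambda>i j. a (h (inv_into I h i)) (h (inv_into I h j)))"
    using assms bij_betw_finite by (intro gnorm_reindex_le bij_betw_inv_into) auto
  also have "\<dots> = gnorm J a"
    by (rule gnorm_cong) (use assms in \<open>simp add: bij_betw_inv_into_right\<close>)
  finally show "gnorm I (\<lambda>i j. a (h i) (h j)) \<le> gnorm J a" .
qed (rule gnorm_reindex_le[OF assms])

text \<open>Tested against the conjugate of \<open>mulv I a v\<close>, the form yields the square of
  the norm of this vector.\<close>

lemma mulv_bound:
  assumes "finite I"
  shows "l2 I (mulv I a v) \<le> gnorm I a * l2 I v"
proof (cases "l2 I (mulv I a v) = 0")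
  case False
  let ?w = "mulv I a v"
  have "complex_of_real ((l2 I ?w)\<^sup>2) = bil I a (\<lambda>i. cnj (?w i)) v"
    by (simp only: bil_mulv l2_power2_complex)
  then have "(l2 I ?w)\<^sup>2 = cmod (bil I a (\<lambda>i. cnj (?w i)) v)"
    by (metis norm_of_real abs_of_nonneg zero_le_power2)
  also have "\<dots> \<le> gnorm I a * l2 I ?w * l2 I v"
    using gnorm_bound[OF assms, of a "\<lambda>i. cnj (?w i)" v] by simp
  finally have "l2 I ?w * l2 I ?w \<le> l2 I ?w * (gnorm I a * l2 I v)"
    by (simp add: power2_eq_square mult_ac)
  moreover have "l2 I ?w > 0" using False by (simp add: less_le)
  ultimately show ?thesis by simp
qed (use assms in simp)

lemma gnorm_le_mulv:
  assumes "c \<ge> 0" and "\<And>v. l2 I (mulv I a v) \<le> c * l2 I v"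
  shows "gnorm I a \<le> c"
proof (rule gnorm_le[OF assms(1)])
  fix u v
  have "cmod (bil I a u v) \<le> l2 I u * l2 I (mulv I a v)"
    unfolding bil_mulv by (rule l2_cauchy)
  also have "\<dots> \<le> l2 I u * (c * l2 I v)" by (intro mult_left_mono assms) auto
  finally show "cmod (bil I a u v) \<le> c * l2 I u * l2 I v" by (simp add: mult_ac)
qed

text \<open>One supremum runs over \<open>v\<close> only, the other over \<open>u\<close> and
  \<open>v\<close>; Cauchy-Schwarz and \<open>mulv_bound\<close> compare them.\<close>

lemma opnorm_eq_gnorm: "opnorm n a = gnorm {..<n} a"
proof -
  let ?I = "{..<n}" and ?S = "{l2 {..<n} (mulv {..<n} a v) |v. l2 {..<n} v \<le> 1}"
  have op: "opnorm n a = Sup ?S" by (simp add: opnorm_def l2_def mulv_def)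
  have le: "x \<le> gnorm ?I a" if "x \<in> ?S" for x
  proof -
    from that obtain v where x: "x = l2 ?I (mulv ?I a v)" and v: "l2 ?I v \<le> 1" by blast
    have "x \<le> gnorm ?I a * l2 ?I v" unfolding x by (rule mulv_bound) simp
    also have "\<dots> \<le> gnorm ?I a" by (rule mult_left_le) (use v in auto)
    finally show ?thesis .
  qed
  have ne: "?S \<noteq> {}" using l2_zero[of ?I] by (metis (mono_tags, lifting) empty_Collect_eq zero_le_one)
  have bdd: "bdd_above ?S" using le by (rule bdd_aboveI)
  show ?thesis unfolding op
  proof (rule antisym)
    show "Sup ?S \<le> gnorm ?I a" by (rule cSup_least[OF ne le])
    show "gnorm ?I a \<le> Sup ?S"
      unfolding gnorm_def
    proof (rule cSup_least)
      show "{cmod (bil ?I a u v) |u v. l2 ?I u \<le> 1 \<and> l2 ?I v \<le> 1} \<noteq> {}"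
        using l2_zero[of ?I] by (metis (mono_tags, lifting) empty_Collect_eq zero_le_one)
    next
      fix x assume "x \<in> {cmod (bil ?I a u v) |u v. l2 ?I u \<le> 1 \<and> l2 ?I v \<le> 1}"
      then obtain u v where x: "x = cmod (bil ?I a u v)" and uv: "l2 ?I u \<le> 1" "l2 ?I v \<le> 1"
        by blast
      have "x \<le> l2 ?I u * l2 ?I (mulv ?I a v)" unfolding x bil_mulv by (rule l2_cauchy)
      also have "\<dots> \<le> l2 ?I (mulv ?I a v)" by (rule mult_left_le_one_le) (use uv in auto)
      also have "\<dots> \<le> Sup ?S" by (rule cSup_upper[OF _ bdd]) (use uv in auto)
      finally show "x \<le> Sup ?S" .
    qed
  qed
qed

lemma gnorm_mult:
  assumes "finite I"
  shows "gnorm I (\<lambda>i j. \<Sum>k\<in>I. a i k * b k j) \<le> gnorm I a * gnorm I b"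
proof (rule gnorm_le_mulv)
  fix v
  have "mulv I (\<lambda>i j. \<Sum>k\<in>I. a i k * b k j) v = mulv I a (mulv I b v)"
  proof
    fix i
    have "mulv I (\<lambda>i j. \<Sum>k\<in>I. a i k * b k j) v i = (\<Sum>j\<in>I. \<Sum>k\<in>I. a i k * (b k j * v j))"
      by (simp add: mulv_def sum_distrib_right mult.assoc)
    also have "\<dots> = mulv I a (mulv I b v) i"
      by (subst sum.swap) (simp add: mulv_def sum_distrib_left)
    finally show "mulv I (\<lambda>i j. \<Sum>k\<in>I. a i k * b k j) v i = mulv I a (mulv I b v) i" .
  qed
  then have "l2 I (mulv I (\<lambda>i j. \<Sum>k\<in>I. a i k * b k j) v) \<le> gnorm I a * l2 I (mulv I b v)"
    using mulv_bound[OF assms] by simp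
  also have "\<dots> \<le> gnorm I a * (gnorm I b * l2 I v)"
    by (intro mult_left_mono mulv_bound assms gnorm_nonneg)
  finally show "l2 I (mulv I (\<lambda>i j. \<Sum>k\<in>I. a i k * b k j) v) \<le> gnorm I a * gnorm I b * l2 I v"
    by (simp add: mult.assoc)
qed (use assms in simp)

lemma gnorm_adjoint_le:
  assumes "finite I"
  shows "gnorm I (\<lambda>i j. cnj (a j i)) \<le> gnorm I a"
proof (rule gnorm_le)
  fix u v
  have "bil I (\<lambda>i j. cnj (a j i)) u v = cnj (bil I a (\<lambda>i. cnj (v i)) (\<lambda>i. cnj (u i)))"
    by (subst (2) bil_def, subst sum.swap) (simp add: bil_def mult_ac)
  then show "cmod (bil I (\<lambda>i j. cnj (a j i)) u v) \<le> gnorm I a * l2 I u * l2 I v"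
    using gnorm_bound[OF assms, of a "\<lambda>i. cnj (v i)" "\<lambda>i. cnj (u i)"] by (simp add: mult_ac)
qed (use assms in simp)

lemma gnorm_adjoint:
  assumes "finite I"
  shows "gnorm I (\<lambda>i j. cnj (a j i)) = gnorm I a"
  using gnorm_adjoint_le[OF assms, of a] gnorm_adjoint_le[OF assms, of "\<lambda>i j. cnj (a j i)"] by simp

text \<open>The form of a Gram matrix is the inner product of the images under \<open>a\<close>.
  This underlies both the C*-identity and Cauchy-Schwarz for positive matrices.\<close>

lemma bil_gram:
  assumes "\<And>i j. i \<in> I \<Longrightarrow> j \<in> I \<Longrightarrow> m i j = (\<Sum>k\<in>I. cnj (a k i) * a k j)"
  shows "bil I m (\<lambda>i. cnj (u i)) v = (\<Sum>k\<in>I. cnj (mulv I a u k) * mulv I a v k)"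
proof -
  have "bil I m (\<lambda>i. cnj (u i)) v = (\<Sum>i\<in>I. \<Sum>j\<in>I. \<Sum>k\<in>I. cnj (a k i * u i) * (a k j * v j))"
    unfolding bil_def by (simp add: assms sum_distrib_left sum_distrib_right mult_ac)
  also have "\<dots> = (\<Sum>i\<in>I. \<Sum>k\<in>I. \<Sum>j\<in>I. cnj (a k i * u i) * (a k j * v j))"
    by (rule sum.cong[OF refl], rule sum.swap)
  also have "\<dots> = (\<Sum>k\<in>I. \<Sum>i\<in>I. \<Sum>j\<in>I. cnj (a k i * u i) * (a k j * v j))"
    by (rule sum.swap)
  finally show ?thesis by (simp add: mulv_def sum_product)
qed

text \<open>For the lower bound, the squared norm of \<open>mulv I a v\<close> is the value of the
  Gram form at \<open>v\<close>, hence at most \<open>?G\<close> times the squared norm of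
  \<open>v\<close>.\<close>

lemma gnorm_cstar:
  assumes "finite I"
  shows "gnorm I (\<lambda>i j. \<Sum>k\<in>I. cnj (a k i) * a k j) = (gnorm I a)\<^sup>2" (is "?G = _")
proof (rule antisym)
  show "?G \<le> (gnorm I a)\<^sup>2"
    using gnorm_mult[OF assms, of "\<lambda>i j. cnj (a j i)" a] gnorm_adjoint[OF assms, of a]
    by (simp add: power2_eq_square)
  have "gnorm I a \<le> sqrt ?G"
  proof (rule gnorm_le_mulv)
    fix v
    have "complex_of_real ((l2 I (mulv I a v))\<^sup>2)
        = bil I (\<lambda>i j. \<Sum>k\<in>I. cnj (a k i) * a k j) (\<lambda>i. cnj (v i)) v"
      by (simp only: l2_power2_complex bil_gram[OF refl])
    then have "(l2 I (mulv I a v))\<^sup>2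
        = cmod (bil I (\<lambda>i j. \<Sum>k\<in>I. cnj (a k i) * a k j) (\<lambda>i. cnj (v i)) v)"
      by (metis norm_of_real abs_of_nonneg zero_le_power2)
    also have "\<dots> \<le> ?G * l2 I v * l2 I v"
      using gnorm_bound[OF assms, of _ "\<lambda>i. cnj (v i)" v] by simp
    finally have "(l2 I (mulv I a v))\<^sup>2 \<le> (sqrt ?G * l2 I v)\<^sup>2"
      using assms by (simp add: power2_eq_square power_mult_distrib mult_ac)
    then show "l2 I (mulv I a v) \<le> sqrt ?G * l2 I v"
      by (rule power2_le_imp_le) (use assms in auto)
  qed (use assms in simp)
  then have "(gnorm I a)\<^sup>2 \<le> (sqrt ?G)\<^sup>2" by (rule power_mono) (use assms in simp)
  then show "(gnorm I a)\<^sup>2 \<le> ?G" using assms by simp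
qed

lemma gnorm_add:
  assumes "finite I"
  shows "gnorm I (\<lambda>i j. a i j + b i j) \<le> gnorm I a + gnorm I b"
proof (rule gnorm_le)
  fix u v
  have "bil I (\<lambda>i j. a i j + b i j) u v = bil I a u v + bil I b u v"
    by (simp add: bil_def algebra_simps sum.distrib)
  then have "cmod (bil I (\<lambda>i j. a i j + b i j) u v) \<le> cmod (bil I a u v) + cmod (bil I b u v)"
    using norm_triangle_ineq by simp
  also have "\<dots> \<le> gnorm I a * l2 I u * l2 I v + gnorm I b * l2 I u * l2 I v"
    by (intro add_mono gnorm_bound assms)
  finally show "cmod (bil I (\<lambda>i j. a i j + b i j) u v) \<le> (gnorm I a + gnorm I b) * l2 I u * l2 I v"
    by (simp add: algebra_simps)
qed (use assms in simp)

lemma gnorm_scale_le: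
  assumes "finite I"
  shows "gnorm I (\<lambda>i j. c * a i j) \<le> cmod c * gnorm I a"
proof (rule gnorm_le)
  fix u v
  have "bil I (\<lambda>i j. c * a i j) u v = c * bil I a u v"
    by (simp add: bil_def sum_distrib_left mult_ac)
  then show "cmod (bil I (\<lambda>i j. c * a i j) u v) \<le> cmod c * gnorm I a * l2 I u * l2 I v"
    using mult_left_mono[OF gnorm_bound[OF assms, of a u v], of "cmod c"]
    by (simp add: norm_mult mult_ac)
qed (use assms in simp)

lemma gnorm_0:
  assumes "finite I" "\<And>i j. i \<in> I \<Longrightarrow> j \<in> I \<Longrightarrow> a i j = 0"
  shows "gnorm I a = 0"
proof (rule antisym)
  show "gnorm I a \<le> 0" by (rule gnorm_le) (use assms in \<open>auto simp: bil_def\<close>)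
qed (use assms in simp)

lemma gnorm_scale:
  assumes "finite I"
  shows "gnorm I (\<lambda>i j. c * a i j) = cmod c * gnorm I a"
proof (cases "c = 0")
  case False
  have "gnorm I a = gnorm I (\<lambda>i j. inverse c * (c * a i j))"
    using False by (simp add: mult.assoc[symmetric])
  also have "\<dots> \<le> cmod (inverse c) * gnorm I (\<lambda>i j. c * a i j)" by (rule gnorm_scale_le[OF assms])
  finally have "cmod c * gnorm I a \<le> gnorm I (\<lambda>i j. c * a i j)"
    using False by (simp add: norm_inverse norm_divide field_simps)
  then show ?thesis using gnorm_scale_le[OF assms, of c a] by simp
qed (use assms in \<open>simp add: gnorm_0\<close>)

lemma bil_basis:
  assumes "finite I" "i \<in> I" "j \<in> I"
  shows "bil I a (\<lambda>k. if k = i then 1 else 0) (\<lambda>k. if k = j then 1 else 0) = a i j"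
proof -
  have "bil I a (\<lambda>k. if k = i then 1 else 0) (\<lambda>k. if k = j then 1 else 0)
      = (\<Sum>k\<in>I. if k = i then (\<Sum>l\<in>I. if l = j then a k l else 0) else 0)"
    unfolding bil_def by (intro sum.cong refl) (auto intro!: sum.cong sum.neutral)
  then show ?thesis using assms by (simp add: sum.delta)
qed

lemma l2_basis: "finite I \<Longrightarrow> l2 I (\<lambda>k. if k = i then 1 else 0) \<le> 1"
proof -
  assume "finite I"
  then have "(\<Sum>k\<in>I. (cmod (if k = i then 1 else 0))\<^sup>2) = (if i \<in> I then 1 else 0)"
    by (simp add: if_distrib[of cmod] if_distrib[of "\<lambda>x. x ^ 2"] cong: if_cong)
  then show ?thesis by (subst l2_le_iff) auto
qed

lemma gnorm_entry: "finite I \<Longrightarrow> i \<in> I \<Longrightarrow> j \<in> I \<Longrightarrow> cmod (a i j) \<le> gnorm I a"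
  using gnorm_upper[OF _ l2_basis l2_basis, of I a i j] by (simp add: bil_basis)

text \<open>Vectors on \<open>I\<close> extend by zero to \<open>K\<close> without changing their
  norm or the value of the form.\<close>

lemma gnorm_subset:
  assumes "finite K" "I \<subseteq> K"
  shows "gnorm I a \<le> gnorm K a"
proof (rule gnorm_le)
  have fI: "finite I" using assms finite_subset by blast
  fix u v
  let ?e = "\<lambda>(u :: 'a \<Rightarrow> complex) i. if i \<in> I then u i else 0"
  have l: "l2 K (?e u) = l2 I u" for u
  proof -
    have "(l2 K (?e u))\<^sup>2 = (l2 I u)\<^sup>2"
      unfolding l2_power2 by (rule sum.mono_neutral_cong_right) (use assms in auto)
    then show ?thesis by (simp add: power2_eq_iff_nonneg)
  qed
  have "bil K a (?e u) (?e v) = (\<Sum>i\<in>I. \<Sum>j\<in>K. ?e u i * a i j * ?e v j)"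
    unfolding bil_def by (rule sum.mono_neutral_right) (use assms in auto)
  also have "\<dots> = bil I a u v"
    unfolding bil_def
    by (intro sum.cong refl sum.mono_neutral_cong_right) (use assms in auto)
  finally show "cmod (bil I a u v) \<le> gnorm K a * l2 I u * l2 I v"
    using gnorm_bound[OF assms(1), of a "?e u" "?e v"] by (simp add: l)
qed (use assms in simp)

lemma gnorm_block_diag:
  assumes fin: "finite I" "finite J" and disj: "I \<inter> J = {}"
    and off: "\<And>i j. i \<in> I \<Longrightarrow> j \<in> J \<Longrightarrow> a i j = 0 \<and> a j i = 0"
  shows "gnorm (I \<union> J) a = max (gnorm I a) (gnorm J a)" (is "_ = ?M")
proof (rule antisym)
  show "?M \<le> gnorm (I \<union> J) a" using fin by (simp add: gnorm_subset)
  have M: "?M \<ge> 0" using fin by (simp add: le_max_iff_disj)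
  show "gnorm (I \<union> J) a \<le> ?M"
  proof (rule gnorm_le[OF M])
    fix u v
    have "bil (I \<union> J) a u v = bil I a u v + bil J a u v"
      using off disj fin by (simp add: bil_def sum.union_disjoint sum.distrib)
    then have "cmod (bil (I \<union> J) a u v) \<le> cmod (bil I a u v) + cmod (bil J a u v)"
      using norm_triangle_ineq by simp
    also have "\<dots> \<le> gnorm I a * l2 I u * l2 I v + gnorm J a * l2 J u * l2 J v"
      by (intro add_mono gnorm_bound fin)
    also have "\<dots> \<le> ?M * l2 I u * l2 I v + ?M * l2 J u * l2 J v"
      by (intro add_mono mult_right_mono) auto
    also have "\<dots> = ?M * (l2 I u * l2 I v + l2 J u * l2 J v)" by (simp add: algebra_simps)
    also have "\<dots> \<le> ?M * (l2 (I \<union> J) u * l2 (I \<union> J) v)"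
    proof (rule mult_left_mono[OF _ M])
      have *: "(l2 (I \<union> J) w)\<^sup>2 = (l2 I w)\<^sup>2 + (l2 J w)\<^sup>2" for w
        using fin disj by (simp add: l2_power2 sum.union_disjoint)
      \<comment> \<open>Cauchy-Schwarz in the plane: the two sides differ by the square of
        \<open>l2 I u * l2 J v - l2 J u * l2 I v\<close>.\<close>
      have "(l2 I u * l2 I v + l2 J u * l2 J v)\<^sup>2 \<le> (l2 (I \<union> J) u * l2 (I \<union> J) v)\<^sup>2"
        using zero_le_power2[of "l2 I u * l2 J v - l2 J u * l2 I v"]
        unfolding power_mult_distrib * by (simp add: power2_eq_square algebra_simps)
      then show "l2 I u * l2 I v + l2 J u * l2 J v \<le> l2 (I \<union> J) u * l2 (I \<union> J) v"
        by (rule power2_le_imp_le) auto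
    qed
    finally show "cmod (bil (I \<union> J) a u v) \<le> ?M * l2 (I \<union> J) u * l2 (I \<union> J) v"
      by (simp add: mult.assoc)
  qed
qed

section \<open>Matrices over product index sets\<close>

lemma l2_product: "l2 (I \<times> K) (\<lambda>(i, p). u i * w p) = l2 I u * l2 K w"
proof -
  have "(l2 (I \<times> K) (\<lambda>(i, p). u i * w p))\<^sup>2 = (l2 I u * l2 K w)\<^sup>2"
    by (simp add: l2_power2 power_mult_distrib sum_product sum.cartesian_product norm_mult
        case_prod_unfold)
  then show ?thesis by (simp add: power2_eq_iff_nonneg)
qed

lemma sum_Times: "(\<Sum>x\<in>I \<times> K. f x) = (\<Sum>i\<in>I. \<Sum>p\<in>K. f (i, p))"
  by (simp add: sum.cartesian_product)

lemma bil_cartesian: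
  "bil (I \<times> K) a u v = (\<Sum>i\<in>I. \<Sum>p\<in>K. \<Sum>j\<in>I. \<Sum>q\<in>K. u (i, p) * a (i, p) (j, q) * v (j, q))"
  by (simp add: bil_def sum_Times)

text \<open>The functional given by \<open>\<xi>\<close> and \<open>\<eta>\<close> is applied to
  every \<open>K\<close>-block. On product vectors this is the form of \<open>a\<close> itself, so a
  vector functional is completely bounded by the product of the two norms.\<close>

lemma gnorm_compress:
  assumes "finite I" "finite K"
  shows "gnorm I (\<lambda>i j. \<Sum>p\<in>K. \<Sum>q\<in>K. \<xi> p * a (i, p) (j, q) * \<eta> q)
    \<le> l2 K \<xi> * l2 K \<eta> * gnorm (I \<times> K) a"
proof (rule gnorm_le)
  fix u v
  have "bil I (\<lambda>i j. \<Sum>p\<in>K. \<Sum>q\<in>K. \<xi> p * a (i, p) (j, q) * \<eta> q) u v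
      = (\<Sum>i\<in>I. \<Sum>j\<in>I. \<Sum>p\<in>K. \<Sum>q\<in>K. (u i * \<xi> p) * a (i, p) (j, q) * (v j * \<eta> q))"
    unfolding bil_def by (simp add: sum_distrib_left sum_distrib_right mult_ac)
  also have "\<dots> = bil (I \<times> K) a (\<lambda>(i, p). u i * \<xi> p) (\<lambda>(j, q). v j * \<eta> q)"
    unfolding bil_cartesian by (intro sum.cong refl, subst sum.swap) simp
  finally show "cmod (bil I (\<lambda>i j. \<Sum>p\<in>K. \<Sum>q\<in>K. \<xi> p * a (i, p) (j, q) * \<eta> q) u v)
      \<le> l2 K \<xi> * l2 K \<eta> * gnorm (I \<times> K) a * l2 I u * l2 I v"
    using gnorm_bound[of "I \<times> K" a "\<lambda>(i, p). u i * \<xi> p" "\<lambda>(j, q). v j * \<eta> q"] assms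
    unfolding l2_product by (simp only: finite_cartesian_product) (simp only: mult_ac)
qed (use assms in simp)

text \<open>A crude bound by the blocks; it makes the matrix norms of the dual finite.\<close>

lemma gnorm_entries:
  assumes "finite I" "finite K"
  shows "gnorm (I \<times> K) a \<le> (\<Sum>p\<in>K. \<Sum>q\<in>K. gnorm I (\<lambda>i j. a (i, p) (j, q)))"
proof (rule gnorm_le)
  fix u v
  have l: "l2 I (\<lambda>i. w (i, p)) \<le> l2 (I \<times> K) w" if "p \<in> K" for p w
  proof -
    have "(\<Sum>i\<in>I. (cmod (w (i, p)))\<^sup>2) \<le> (\<Sum>i\<in>I. \<Sum>p\<in>K. (cmod (w (i, p)))\<^sup>2)"
      by (rule sum_mono, rule member_le_sum) (use that assms in auto)
    then show ?thesis by (simp add: l2_le_iff l2_power2 sum.cartesian_product)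
  qed
  have "bil (I \<times> K) a u v = (\<Sum>i\<in>I. \<Sum>p\<in>K. \<Sum>q\<in>K. \<Sum>j\<in>I. u (i, p) * a (i, p) (j, q) * v (j, q))"
    unfolding bil_cartesian by (intro sum.cong refl sum.swap)
  also have "\<dots> = (\<Sum>p\<in>K. \<Sum>i\<in>I. \<Sum>q\<in>K. \<Sum>j\<in>I. u (i, p) * a (i, p) (j, q) * v (j, q))"
    by (rule sum.swap)
  also have "\<dots> = (\<Sum>p\<in>K. \<Sum>q\<in>K. bil I (\<lambda>i j. a (i, p) (j, q)) (\<lambda>i. u (i, p)) (\<lambda>j. v (j, q)))"
    unfolding bil_def by (intro sum.cong refl sum.swap)
  also have "cmod \<dots> \<le> (\<Sum>p\<in>K. \<Sum>q\<in>K. cmod (bil I (\<lambda>i j. a (i, p) (j, q)) (\<lambda>i. u (i, p)) (\<lambda>j. v (j, q))))"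
    by (intro order_trans[OF norm_sum] sum_mono norm_sum)
  also have "\<dots> \<le> (\<Sum>p\<in>K. \<Sum>q\<in>K. gnorm I (\<lambda>i j. a (i, p) (j, q)) * l2 (I \<times> K) u * l2 (I \<times> K) v)"
  proof (intro sum_mono)
    fix p q assume pq: "p \<in> K" "q \<in> K"
    show "cmod (bil I (\<lambda>i j. a (i, p) (j, q)) (\<lambda>i. u (i, p)) (\<lambda>j. v (j, q)))
        \<le> gnorm I (\<lambda>i j. a (i, p) (j, q)) * l2 (I \<times> K) u * l2 (I \<times> K) v"
      by (rule order_trans[OF gnorm_bound[OF assms(1)]])
        (intro mult_mono l pq mult_nonneg_nonneg gnorm_nonneg l2_nonneg assms order_refl)
  qed
  finally show "cmod (bil (I \<times> K) a u v)
      \<le> (\<Sum>p\<in>K. \<Sum>q\<in>K. gnorm I (\<lambda>i j. a (i, p) (j, q))) * l2 (I \<times> K) u * l2 (I \<times> K) v"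
    by (simp add: sum_distrib_right)
qed (use assms in \<open>simp add: sum_nonneg\<close>)

text \<open>The matrix is \<open>a \<otimes> 1\<close>; it acts by \<open>a\<close> separately on
  each of the orthogonal slices with fixed second index.\<close>

lemma gnorm_amplify:
  assumes "finite I" "finite K"
  shows "gnorm (I \<times> K) (\<lambda>x y. if snd x = snd y then a (fst x) (fst y) else 0) \<le> gnorm I a"
    (is "gnorm _ ?a \<le> _")
proof (rule gnorm_le_mulv)
  fix v
  have mv: "mulv (I \<times> K) ?a v (i, p) = mulv I a (\<lambda>j. v (j, p)) i" if "p \<in> K" for i p
  proof -
    have "mulv (I \<times> K) ?a v (i, p) = (\<Sum>j\<in>I. \<Sum>q\<in>K. if p = q then a i j * v (j, q) else 0)"
      unfolding mulv_def sum.cartesian_product by (intro sum.cong refl) auto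
    then show ?thesis using assms that by (simp add: mulv_def sum.delta')
  qed
  have "(l2 (I \<times> K) (mulv (I \<times> K) ?a v))\<^sup>2
      = (\<Sum>i\<in>I. \<Sum>p\<in>K. (cmod (mulv I a (\<lambda>j. v (j, p)) i))\<^sup>2)"
    unfolding l2_power2 sum.cartesian_product by (intro sum.cong refl) (auto simp: mv)
  also have "\<dots> = (\<Sum>p\<in>K. (l2 I (mulv I a (\<lambda>j. v (j, p))))\<^sup>2)"
    by (subst sum.swap) (simp add: l2_power2)
  also have "\<dots> \<le> (\<Sum>p\<in>K. (gnorm I a * l2 I (\<lambda>j. v (j, p)))\<^sup>2)"
    by (intro sum_mono power_mono mulv_bound assms l2_nonneg)
  also have "\<dots> = (gnorm I a)\<^sup>2 * (\<Sum>p\<in>K. \<Sum>j\<in>I. (cmod (v (j, p)))\<^sup>2)"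
    by (simp add: power_mult_distrib sum_distrib_left l2_power2)
  also have "\<dots> = (gnorm I a * l2 (I \<times> K) v)\<^sup>2"
    by (subst sum.swap) (simp add: power_mult_distrib l2_power2 sum.cartesian_product)
  finally show "l2 (I \<times> K) (mulv (I \<times> K) ?a v) \<le> gnorm I a * l2 (I \<times> K) v"
    by (rule power2_le_imp_le) (use assms in simp)
qed (use assms in simp)

text \<open>The matrix on the left is the product of \<open>\<alpha> \<otimes> 1\<close>,
  \<open>a\<close> and \<open>\<beta> \<otimes> 1\<close>. This becomes the axiom on two-sided
  scalar multiplication of an operator space.\<close>

lemma gnorm_bimult:
  assumes "finite I" "finite K"
  shows "gnorm (I \<times> K) (\<lambda>x y. \<Sum>k\<in>I. \<Sum>l\<in>I. (\<alpha> (fst x) k * \<beta> l (fst y)) * a (k, snd x) (l, snd y))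
    \<le> gnorm I \<alpha> * gnorm (I \<times> K) a * gnorm I \<beta>"
proof -
  let ?E = "\<lambda>a x y. if snd x = snd y then a (fst x) (fst y) else 0"
  let ?m = "\<lambda>x y. \<Sum>w\<in>I \<times> K. (\<Sum>z\<in>I \<times> K. ?E \<alpha> x z * a z w) * ?E \<beta> w y"
  have "gnorm (I \<times> K) (\<lambda>x y. \<Sum>k\<in>I. \<Sum>l\<in>I. (\<alpha> (fst x) k * \<beta> l (fst y)) * a (k, snd x) (l, snd y))
      = gnorm (I \<times> K) ?m"
  proof (rule gnorm_cong)
    fix x y assume xy: "x \<in> I \<times> K" "y \<in> I \<times> K"
    have 1: "(\<Sum>z\<in>I \<times> K. ?E \<alpha> x z * a z w) = (\<Sum>k\<in>I. \<alpha> (fst x) k * a (k, snd x) w)" for w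
    proof -
      have "(\<Sum>z\<in>I \<times> K. ?E \<alpha> x z * a z w)
          = (\<Sum>k\<in>I. \<Sum>r\<in>K. if snd x = r then \<alpha> (fst x) k * a (k, r) w else 0)"
        unfolding sum.cartesian_product by (intro sum.cong refl) auto
      then show ?thesis using assms xy by (auto simp: sum.delta')
    qed
    have "?m x y = (\<Sum>l\<in>I. \<Sum>r\<in>K. if r = snd y then
        (\<Sum>k\<in>I. \<alpha> (fst x) k * a (k, snd x) (l, r)) * \<beta> l (fst y) else 0)"
      unfolding 1 sum.cartesian_product by (intro sum.cong refl) auto
    also have "\<dots> = (\<Sum>l\<in>I. \<Sum>k\<in>I. (\<alpha> (fst x) k * \<beta> l (fst y)) * a (k, snd x) (l, snd y))"
      using assms xy by (auto simp: sum.delta sum_distrib_left sum_distrib_right mult_ac)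
    also have "\<dots> = (\<Sum>k\<in>I. \<Sum>l\<in>I. (\<alpha> (fst x) k * \<beta> l (fst y)) * a (k, snd x) (l, snd y))"
      by (rule sum.swap)
    finally show "(\<Sum>k\<in>I. \<Sum>l\<in>I. (\<alpha> (fst x) k * \<beta> l (fst y)) * a (k, snd x) (l, snd y)) = ?m x y" ..
  qed
  also have "\<dots> \<le> gnorm (I \<times> K) (\<lambda>x w. \<Sum>z\<in>I \<times> K. ?E \<alpha> x z * a z w) * gnorm (I \<times> K) (?E \<beta>)"
    by (rule gnorm_mult) (use assms in simp)
  also have "\<dots> \<le> (gnorm (I \<times> K) (?E \<alpha>) * gnorm (I \<times> K) a) * gnorm (I \<times> K) (?E \<beta>)"
    by (intro mult_right_mono gnorm_mult gnorm_nonneg) (use assms in auto)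
  also have "\<dots> \<le> (gnorm I \<alpha> * gnorm (I \<times> K) a) * gnorm I \<beta>"
    by (intro mult_mono gnorm_amplify mult_nonneg_nonneg gnorm_nonneg order_refl) (use assms in auto)
  finally show ?thesis .
qed

lemma bij_flatten: "bij_betw (\<lambda>(i, p). i * k + p) ({..<l} \<times> {..<k}) {..<l * k :: nat}"
proof (rule bij_betw_byWitness[where f' = "\<lambda>r. (r div k, r mod k)"])
  show "(\<lambda>(i, p). i * k + p) ` ({..<l} \<times> {..<k}) \<subseteq> {..<l * k}"
  proof clarsimp
    fix i p assume "i < l" "p < k"
    then have "i * k + p < Suc i * k" by simp
    also have "\<dots> \<le> l * k" using \<open>i < l\<close> by (intro mult_le_mono1) simp
    finally show "i * k + p < l * k" .
  qed
  show "(\<lambda>r. (r div k, r mod k)) ` {..<l * k} \<subseteq> {..<l} \<times> {..<k}"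
    by (auto simp: less_mult_imp_div_less) (metis mod_less_divisor mult_0_right not_gr_zero not_less0)
qed auto

lemma gnorm_flatten:
  "gnorm {..<k * n} (Defs.flatten n z)
    = gnorm ({..<k} \<times> {..<n}) (\<lambda>x y. z (fst x) (fst y) (snd x) (snd y))"
proof -
  have "gnorm {..<k * n} (Defs.flatten n z) = gnorm ({..<k} \<times> {..<n})
     (\<lambda>x y. Defs.flatten n z (case x of (i, p) \<Rightarrow> i * n + p) (case y of (i, p) \<Rightarrow> i * n + p))"
    using gnorm_reindex[OF bij_flatten[where k = n and l = k], of "Defs.flatten n z"] by simp
  also have "\<dots> = gnorm ({..<k} \<times> {..<n}) (\<lambda>x y. z (fst x) (fst y) (snd x) (snd y))"
    by (rule gnorm_cong) (auto simp: Defs.flatten_def)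
  finally show ?thesis .
qed

lemma gnorm_flatten_Times:
  assumes "finite K"
  shows "gnorm ({..<l * k} \<times> K) (\<lambda>x y. f (Defs.flatten k z (fst x) (fst y)) (snd x) (snd y))
    = gnorm (({..<l} \<times> {..<k}) \<times> K)
        (\<lambda>x y. f (z (fst (fst x)) (fst (fst y)) (snd (fst x)) (snd (fst y))) (snd x) (snd y))"
    (is "gnorm _ ?a = gnorm _ ?b")
proof -
  let ?h = "map_prod (\<lambda>(i, p). i * k + p) (id :: 'k \<Rightarrow> 'k)"
  have "bij_betw ?h (({..<l} \<times> {..<k}) \<times> K) ({..<l * k} \<times> K)"
    by (intro bij_betw_map_prod bij_flatten bij_betw_id)
  from gnorm_reindex[OF this, of ?a]
  have "gnorm ({..<l * k} \<times> K) ?a = gnorm (({..<l} \<times> {..<k}) \<times> K) (\<lambda>x y. ?a (?h x) (?h y))"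
    using assms by simp
  also have "\<dots> = gnorm (({..<l} \<times> {..<k}) \<times> K) ?b"
    by (rule gnorm_cong) (auto simp: Defs.flatten_def)
  finally show ?thesis .
qed

section \<open>Positive and hermitian forms\<close>

lemma gram_cauchy_schwarz:
  assumes "\<And>i j. i \<in> I \<Longrightarrow> j \<in> I \<Longrightarrow> m i j = (\<Sum>k\<in>I. cnj (a k i) * a k j)"
    and "bil I m (\<lambda>i. cnj (u i)) u = (complex_of_real r)\<^sup>2" "r \<ge> 0"
    and "bil I m (\<lambda>i. cnj (v i)) v = (complex_of_real s)\<^sup>2" "s \<ge> 0"
  shows "cmod (bil I m (\<lambda>i. cnj (u i)) v) \<le> r * s"
proof -
  \<comment> \<open>The value of the form at \<open>w\<close> is the squared norm of the image under
    \<open>a\<close>; so \<open>r\<close> and \<open>s\<close> are the norms of the images of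
    \<open>u\<close> and \<open>v\<close>, whatever the factor \<open>a\<close> may be.\<close>
  have l: "l2 I (mulv I a w) = t" if "bil I m (\<lambda>i. cnj (w i)) w = (complex_of_real t)\<^sup>2" "t \<ge> 0" for w t
  proof -
    have "complex_of_real ((l2 I (mulv I a w))\<^sup>2) = complex_of_real (t\<^sup>2)"
      using that(1) by (simp only: l2_power2_complex bil_gram[OF assms(1)]) simp
    then show ?thesis using that(2) by (simp only: of_real_eq_iff power2_eq_iff_nonneg l2_nonneg)
  qed
  have "cmod (bil I m (\<lambda>i. cnj (u i)) v) \<le> l2 I (\<lambda>k. cnj (mulv I a u k)) * l2 I (mulv I a v)"
    by (subst bil_gram[OF assms(1)]) (auto simp del: l2_cnj intro: l2_cauchy)
  then show ?thesis using l assms by (simp only: l2_cnj)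
qed

text \<open>The form is conjugate-linear in \<open>u\<close>, hence the signs of the terms with
  \<open>\<i>\<close>. It serves to recover a matrix from its quadratic form, and later to split a
  vector functional into four vector states.\<close>

lemma bil_polarization:
  "4 * bil I m (\<lambda>i. cnj (u i)) v =
     bil I m (\<lambda>i. cnj (u i + v i)) (\<lambda>i. u i + v i) - bil I m (\<lambda>i. cnj (u i - v i)) (\<lambda>i. u i - v i)
     - \<i> * bil I m (\<lambda>i. cnj (u i + \<i> * v i)) (\<lambda>i. u i + \<i> * v i)
     + \<i> * bil I m (\<lambda>i. cnj (u i - \<i> * v i)) (\<lambda>i. u i - \<i> * v i)"
  unfolding bil_def sum_distrib_left sum_subtractf[symmetric] sum.distrib[symmetric]
  by (intro sum.cong refl) (simp add: algebra_simps)

text \<open>The difference of \<open>m\<close> and its adjoint has vanishing quadratic form, so by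
  polarization its form vanishes, in particular at pairs of basis vectors.\<close>

lemma hermitian_of_real_form:
  assumes "finite I" and real: "\<And>u. Im (bil I m (\<lambda>i. cnj (u i)) u) = 0"
    and ij: "i \<in> I" "j \<in> I"
  shows "m i j = cnj (m j i)"
proof -
  let ?k = "\<lambda>i j. m i j - cnj (m j i)"
  have q0: "bil I ?k (\<lambda>i. cnj (u i)) u = 0" for u
  proof -
    have "cnj (bil I m (\<lambda>i. cnj (u i)) u) = bil I (\<lambda>i j. cnj (m j i)) (\<lambda>i. cnj (u i)) u"
      by (subst (2) bil_def, subst sum.swap) (simp add: bil_def mult_ac)
    moreover have "cnj (bil I m (\<lambda>i. cnj (u i)) u) = bil I m (\<lambda>i. cnj (u i)) u"
      using real by (simp add: complex_eq_iff)
    ultimately show ?thesis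
      by (simp add: bil_def algebra_simps sum_subtractf)
  qed
  have "4 * bil I ?k (\<lambda>i. cnj (u i)) v = 0" for u v
    by (subst bil_polarization) (simp only: q0, simp)
  then have "bil I ?k (\<lambda>l. cnj (if l = i then 1 else 0)) (\<lambda>l. if l = j then 1 else 0) = 0"
    by simp
  then have "bil I ?k (\<lambda>l. if l = i then 1 else 0) (\<lambda>l. if l = j then 1 else 0) = 0"
    by (simp add: if_distrib[of cnj] cong: if_cong)
  then show ?thesis using assms by (simp only: bil_basis) simp
qed

section \<open>Finite-dimensional normed spaces\<close>

text \<open>The ambient type carries no topology; convergence in \<open>V\<close> is therefore
  traced back to convergence of coefficients in the complex numbers.\<close>

locale normed_subspace =
  fixes V :: "'a::complex_vector set" and N :: "'a \<Rightarrow> real"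
  assumes sub: "cvs.subspace V" and nrm: "is_norm_on V N"
begin

lemma nonneg: "x \<in> V \<Longrightarrow> 0 \<le> N x"
  and eq_0_iff: "x \<in> V \<Longrightarrow> N x = 0 \<longleftrightarrow> x = 0"
  and scale: "x \<in> V \<Longrightarrow> N (c *\<^sub>C x) = cmod c * N x"
  and triangle: "x \<in> V \<Longrightarrow> y \<in> V \<Longrightarrow> N (x + y) \<le> N x + N y"
  using nrm by (auto simp: is_norm_on_def)

lemma zero [simp]: "N 0 = 0"
  using eq_0_iff[of 0] cvs.subspace_0[OF sub] by simp

lemma minus: "x \<in> V \<Longrightarrow> N (- x) = N x"
  using scale[of x "- 1"] by simp

lemma triangle_diff: "x \<in> V \<Longrightarrow> y \<in> V \<Longrightarrow> N (x - y) \<le> N x + N y"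
  using triangle[of x "- y"] minus[of y] cvs.subspace_neg[OF sub, of y] by simp

lemma minus_commute: "x \<in> V \<Longrightarrow> y \<in> V \<Longrightarrow> N (x - y) = N (y - x)"
  using minus[of "x - y"] cvs.subspace_diff[OF sub, of x y] by simp

lemma triangle_via: "x \<in> V \<Longrightarrow> y \<in> V \<Longrightarrow> z \<in> V \<Longrightarrow> N (x - z) \<le> N (x - y) + N (y - z)"
  using triangle[of "x - y" "y - z"] cvs.subspace_diff[OF sub] by simp

lemma sum_le: "(\<And>e. e \<in> E \<Longrightarrow> f e \<in> V) \<Longrightarrow> N (\<Sum>e\<in>E. f e) \<le> (\<Sum>e\<in>E. N (f e))"
proof (induction E rule: infinite_finite_induct)
  case (insert e E)
  then have "N (f e + (\<Sum>e\<in>E. f e)) \<le> N (f e) + N (\<Sum>e\<in>E. f e)"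
    by (intro triangle cvs.subspace_sum sub) auto
  then show ?case using insert by simp
qed simp_all

text \<open>Otherwise combinations of \<open>E\<close> approach \<open>- a\<close>. By the
  coefficient bound \<open>C\<close> their coefficients are Cauchy, and the limits of the
  coefficients exhibit \<open>a\<close> in the span.\<close>

lemma distance_to_span_positive:
  assumes E: "finite E" "E \<subseteq> V" and C: "C \<ge> 0"
    "\<And>c e. e \<in> E \<Longrightarrow> cmod (c e) \<le> C * N (\<Sum>e\<in>E. c e *\<^sub>C e)"
    and a: "a \<in> V" "a \<notin> cvs.span E"
  shows "\<exists>\<delta>>0. \<forall>c. \<delta> \<le> N (a + (\<Sum>e\<in>E. c e *\<^sub>C e))"
proof (rule ccontr)
  let ?s = "\<lambda>c. \<Sum>e\<in>E. c e *\<^sub>C e"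
  have sV: "?s c \<in> V" for c using E by (intro cvs.subspace_sum sub cvs.subspace_scale) auto
  assume "\<not> ?thesis"
  then have "\<exists>c. N (a + ?s c) < inverse (real (Suc k))" for k
    by (metis inverse_positive_iff_positive not_less of_nat_0_less_iff zero_less_Suc)
  then obtain c where c: "N (a + ?s (c k)) < inverse (real (Suc k))" for k
    by metis
  have diff: "cmod (c k e - c l e) \<le> C * inverse (real (Suc k)) + C * inverse (real (Suc l))"
    if "e \<in> E" for k l e
  proof -
    have "cmod (c k e - c l e) \<le> C * N (?s (\<lambda>e. c k e - c l e))"
      using C(2)[OF that, of "\<lambda>e. c k e - c l e"] by simp
    also have "?s (\<lambda>e. c k e - c l e) = (a + ?s (c k)) - (a + ?s (c l))"
      by (simp add: cvs.scale_left_diff_distrib sum_subtractf)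
    also have "N \<dots> \<le> N (a + ?s (c k)) + N (a + ?s (c l))"
      by (intro triangle_diff cvs.subspace_add sub a sV)
    also have "\<dots> \<le> inverse (real (Suc k)) + inverse (real (Suc l))"
      using c[of k] c[of l] by simp
    finally show ?thesis using C(1) by (simp add: mult_left_mono distrib_left)
  qed
  have lim0: "(\<lambda>k. C * inverse (real (Suc k))) \<longlonglongrightarrow> 0"
    using tendsto_mult_left[OF LIMSEQ_inverse_real_of_nat, of C] by simp
  have "Cauchy (\<lambda>k. c k e)" if e: "e \<in> E" for e
  proof (rule metric_CauchyI)
    fix \<epsilon> :: real assume "\<epsilon> > 0"
    then have "\<forall>\<^sub>F k in sequentially. C * inverse (real (Suc k)) < \<epsilon> / 2"
      by (intro order_tendstoD(2)[OF lim0]) simp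
    then obtain K where K: "C * inverse (real (Suc k)) < \<epsilon> / 2" if "k \<ge> K" for k
      by (auto simp: eventually_sequentially)
    show "\<exists>K. \<forall>m\<ge>K. \<forall>n\<ge>K. dist (c m e) (c n e) < \<epsilon>"
    proof (intro exI allI impI)
      fix m n assume "m \<ge> K" "n \<ge> K"
      then show "dist (c m e) (c n e) < \<epsilon>"
        using K[of m] K[of n] diff[OF e, of m n] by (simp add: dist_norm)
    qed
  qed
  then have "\<forall>e\<in>E. \<exists>l. (\<lambda>k. c k e) \<longlonglongrightarrow> l"
    using Cauchy_convergent convergent_def by blast
  then obtain l where l: "(\<lambda>k. c k e) \<longlonglongrightarrow> l e" if "e \<in> E" for e by metis
  have bound: "N (a + ?s l) \<le> inverse (real (Suc k)) + (\<Sum>e\<in>E. cmod (c k e - l e) * N e)" for k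
  proof -
    have "a + ?s l = (a + ?s (c k)) - ?s (\<lambda>e. c k e - l e)"
      by (simp add: cvs.scale_left_diff_distrib sum_subtractf)
    also have "N \<dots> \<le> N (a + ?s (c k)) + N (?s (\<lambda>e. c k e - l e))"
      by (intro triangle_diff cvs.subspace_add sub a sV)
    also have "\<dots> \<le> inverse (real (Suc k)) + (\<Sum>e\<in>E. N ((c k e - l e) *\<^sub>C e))"
      using c[of k] E by (intro add_mono sum_le cvs.subspace_scale sub) auto
    finally show ?thesis using E by (simp add: scale subset_iff)
  qed
  have "(\<lambda>k. inverse (real (Suc k)) + (\<Sum>e\<in>E. cmod (c k e - l e) * N e)) \<longlonglongrightarrow> 0 + (\<Sum>e\<in>E. 0 * N e)"
    by (intro tendsto_add LIMSEQ_inverse_real_of_nat tendsto_sum tendsto_mult tendsto_const)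
      (use l in \<open>simp add: tendsto_norm_zero_iff LIM_zero_iff\<close>)
  then have "N (a + ?s l) \<le> 0"
    using bound by (intro LIMSEQ_le_const[of _ 0]) auto
  then have "a + ?s l = 0"
    using nonneg[of "a + ?s l"] eq_0_iff[of "a + ?s l"] cvs.subspace_add[OF sub a(1) sV] by simp
  then have "a = - ?s l" by (simp add: eq_neg_iff_add_eq_0)
  moreover have "- ?s l \<in> cvs.span E"
    by (intro cvs.span_neg cvs.span_sum cvs.span_scale cvs.span_base)
  ultimately show False using a by simp
qed

text \<open>Induction on the independent set: the distance \<open>\<delta>\<close> from the new
  vector to the old span controls the new coefficient, and subtracting the new term leaves the old
  coefficients to the induction hypothesis.\<close>

lemma independent_coefficients_bounded:
  assumes "finite E" "E \<subseteq> V" "cvs.independent E"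
  shows "\<exists>C\<ge>0. \<forall>c. \<forall>e\<in>E. cmod (c e) \<le> C * N (\<Sum>e\<in>E. c e *\<^sub>C e)"
  using assms
proof (induction E rule: finite_induct)
  case (insert a E)
  let ?s = "\<lambda>c. \<Sum>e\<in>E. c e *\<^sub>C e"
  from insert.prems insert.hyps have ind: "cvs.independent E" "a \<notin> cvs.span E"
    and EV: "E \<subseteq> V" "a \<in> V" by (auto simp: cvs.independent_insert)
  have sV: "?s c \<in> V" for c using EV by (intro cvs.subspace_sum sub cvs.subspace_scale) auto
  from insert.IH[OF EV(1) ind(1)] obtain C where C: "C \<ge> 0" "\<And>c e. e \<in> E \<Longrightarrow> cmod (c e) \<le> C * N (?s c)"
    by blast
  obtain \<delta> where \<delta>: "\<delta> > 0" "\<And>c. \<delta> \<le> N (a + ?s c)"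
    using distance_to_span_positive[OF insert.hyps(1) EV(1) C EV(2) ind(2)] by blast
  \<comment> \<open>The first summand bounds the coefficient of \<open>a\<close>; the factor
    \<open>1 + inverse \<delta> * N a\<close> bounds the norm of what remains after subtracting the
    term of \<open>a\<close>.\<close>
  let ?C = "inverse \<delta> + C * (1 + inverse \<delta> * N a)"
  have C0: "?C \<ge> 0" using C \<delta> nonneg[OF EV(2)] by simp
  have bound: "cmod (c e) \<le> ?C * N (c a *\<^sub>C a + ?s c)" if e: "e \<in> insert a E" for c e
  proof -
    let ?x = "c a *\<^sub>C a + ?s c"
    have xV: "?x \<in> V" by (intro cvs.subspace_add cvs.subspace_scale sub EV sV)
    have ca: "cmod (c a) \<le> inverse \<delta> * N ?x"
    proof (cases "c a = 0")
      case False
      have "?x = c a *\<^sub>C (a + ?s (\<lambda>e. c e / c a))"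
        using False by (simp add: scaleC_add_right cvs.scale_sum_right scaleC_scaleC)
      then have "N ?x = cmod (c a) * N (a + ?s (\<lambda>e. c e / c a))"
        by (simp only: scale cvs.subspace_add[OF sub EV(2) sV])
      also have "\<dots> \<ge> cmod (c a) * \<delta>" by (intro mult_left_mono \<delta>) simp
      finally show ?thesis using \<delta>(1) by (simp add: field_simps)
    next
      case True
      have "0 \<le> inverse \<delta> * N ?x" using \<delta>(1) nonneg[OF xV] by simp
      then show ?thesis using True by (simp only: norm_zero)
    qed
    show ?thesis
    proof (cases "e = a")
      case True
      have "inverse \<delta> * N ?x \<le> ?C * N ?x"
        using C \<delta>(1) nonneg[OF EV(2)] by (intro mult_right_mono nonneg xV) simp
      with ca show ?thesis unfolding True by (rule order_trans)
    next
      case False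
      then have "cmod (c e) \<le> C * N (?s c)" using e C by blast
      also have "?s c = ?x - c a *\<^sub>C a" by simp
      also have "N \<dots> \<le> N ?x + cmod (c a) * N a"
        using triangle_diff[OF xV, of "c a *\<^sub>C a"] EV by (simp add: scale cvs.subspace_scale[OF sub])
      also have "\<dots> \<le> N ?x + (inverse \<delta> * N ?x) * N a"
        by (intro add_left_mono mult_right_mono ca nonneg EV)
      also have "C * \<dots> \<le> ?C * N ?x"
        using \<delta>(1) nonneg[OF xV] by (simp add: algebra_simps)
      finally show ?thesis using C(1) by (simp add: mult_left_mono)
    qed
  qed
  show ?case
    using insert.hyps by (intro exI[of _ ?C] conjI C0 allI ballI) (use bound in simp)
qed auto

lemma coordinates_bounded:
  assumes "fd_space V"
  obtains E d C where "finite E" "E \<subseteq> V" "\<And>e. e \<in> E \<Longrightarrow> d e \<in> lin V UNIV"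
    "\<And>y. y \<in> V \<Longrightarrow> y = (\<Sum>e\<in>E. d e y *\<^sub>C e)" "C \<ge> 0"
    "\<And>e y. e \<in> E \<Longrightarrow> y \<in> V \<Longrightarrow> cmod (d e y) \<le> C * N y"
proof -
  from assms obtain B where B: "finite B" "cvs.span B = V" by (auto simp: fd_space_def)
  obtain E where E: "E \<subseteq> B" "cvs.independent E" "B \<subseteq> cvs.span E"
    using cvs.maximal_independent_subset by blast
  have sp: "cvs.span E = V"
    using E B by (metis cvs.span_mono cvs.span_span subset_antisym)
  have fin: "finite E" using B(1) E(1) finite_subset by blast
  have EV: "E \<subseteq> V" using sp cvs.span_superset by blast
  define d where "d e = restr0 V (\<lambda>y. cvs.representation E y e)" for e
  have d: "d e \<in> lin V UNIV" for e
    using E(2) cvs.subspace_add[OF sub] cvs.subspace_scale[OF sub]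
    by (auto simp: lin_def d_def restr0_def sp cvs.representation_add cvs.representation_scale)
  have exp: "y = (\<Sum>e\<in>E. d e y *\<^sub>C e)" if "y \<in> V" for y
    using cvs.sum_representation_eq[of E y E] E(2) that sp fin by (auto simp: d_def restr0_def)
  obtain C where C: "C \<ge> 0" "\<And>c e. e \<in> E \<Longrightarrow> cmod (c e) \<le> C * N (\<Sum>e\<in>E. c e *\<^sub>C e)"
    using independent_coefficients_bounded[OF fin EV E(2)] by blast
  have bound: "cmod (d e y) \<le> C * N y" if "e \<in> E" "y \<in> V" for e y
    using C(2)[OF that(1), of "\<lambda>e. d e y"] exp[OF that(2)] by simp
  show ?thesis by (rule that[OF fin EV d exp C(1) bound])
qed

lemma complete:
  assumes "fd_space V"
  shows "is_complete_on V N"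
  unfolding is_complete_on_def
proof (intro allI impI, elim conjE)
  obtain E d C where E: "finite E" "E \<subseteq> V" and d: "\<And>e. e \<in> E \<Longrightarrow> d e \<in> lin V UNIV"
    "\<And>y. y \<in> V \<Longrightarrow> y = (\<Sum>e\<in>E. d e y *\<^sub>C e)" and C: "C \<ge> 0"
    "\<And>e y. e \<in> E \<Longrightarrow> y \<in> V \<Longrightarrow> cmod (d e y) \<le> C * N y"
    using coordinates_bounded[OF assms] by blast
  fix s :: "nat \<Rightarrow> 'a"
  assume s: "\<forall>k. s k \<in> V" and cau: "\<forall>e>0. \<exists>K. \<forall>m\<ge>K. \<forall>k\<ge>K. N (s m - s k) < e"
  have dd: "d e (x - y) = d e x - d e y" if "e \<in> E" "x \<in> V" "y \<in> V" for e x y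
    using lin_add[OF d(1)[OF that(1)], of "x - y" y] that cvs.subspace_diff[OF sub] by simp
  have "Cauchy (\<lambda>k. d e (s k))" if e: "e \<in> E" for e
  proof (rule metric_CauchyI)
    fix \<epsilon> :: real assume "\<epsilon> > 0"
    with C have "\<epsilon> / (C + 1) > 0" by simp
    with cau obtain K where K: "\<And>m k. m \<ge> K \<Longrightarrow> k \<ge> K \<Longrightarrow> N (s m - s k) < \<epsilon> / (C + 1)" by blast
    show "\<exists>K. \<forall>m\<ge>K. \<forall>n\<ge>K. dist (d e (s m)) (d e (s n)) < \<epsilon>"
    proof (intro exI allI impI)
      fix m n assume mn: "m \<ge> K" "n \<ge> K"
      have sV: "s m - s n \<in> V" using s sub by (simp add: cvs.subspace_diff)
      have "dist (d e (s m)) (d e (s n)) \<le> C * N (s m - s n)"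
        using C(2)[OF e sV] s e by (simp add: dist_norm dd)
      also have "\<dots> \<le> (C + 1) * N (s m - s n)" using nonneg[OF sV] by (simp add: mult_right_mono)
      also have "\<dots> < \<epsilon>" using K[OF mn] C(1) by (simp add: field_simps)
      finally show "dist (d e (s m)) (d e (s n)) < \<epsilon>" .
    qed
  qed
  then have "\<forall>e\<in>E. \<exists>l. (\<lambda>k. d e (s k)) \<longlonglongrightarrow> l"
    using Cauchy_convergent convergent_def by blast
  then obtain l where l: "(\<lambda>k. d e (s k)) \<longlonglongrightarrow> l e" if "e \<in> E" for e by metis
  define y where "y = (\<Sum>e\<in>E. l e *\<^sub>C e)"
  have yV: "y \<in> V" unfolding y_def using E by (intro cvs.subspace_sum sub cvs.subspace_scale) auto
  have upper: "N (s k - y) \<le> (\<Sum>e\<in>E. cmod (d e (s k) - l e) * N e)" for k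
  proof -
    have "s k - y = (\<Sum>e\<in>E. (d e (s k) - l e) *\<^sub>C e)"
      using d(2)[of "s k"] s by (simp add: y_def cvs.scale_left_diff_distrib sum_subtractf)
    also have "N \<dots> \<le> (\<Sum>e\<in>E. N ((d e (s k) - l e) *\<^sub>C e))"
      using E by (intro sum_le cvs.subspace_scale sub) auto
    finally show ?thesis using E by (simp add: scale subset_iff)
  qed
  have lower: "0 \<le> N (s k - y)" for k
    using s yV sub by (intro nonneg cvs.subspace_diff) auto
  have "(\<lambda>k. \<Sum>e\<in>E. cmod (d e (s k) - l e) * N e) \<longlonglongrightarrow> (\<Sum>e\<in>E. 0 * N e)"
    by (intro tendsto_sum tendsto_mult tendsto_const)
      (use l in \<open>simp add: tendsto_norm_zero_iff LIM_zero_iff\<close>)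
  then have "(\<lambda>k. \<Sum>e\<in>E. cmod (d e (s k) - l e) * N e) \<longlonglongrightarrow> 0" by simp
  then have "(\<lambda>k. N (s k - y)) \<longlonglongrightarrow> 0"
    by (rule tendsto_sandwich[OF always_eventually always_eventually tendsto_const, rotated 2])
      (use upper lower in auto)
  then show "\<exists>l\<in>V. (\<lambda>k. N (s k - l)) \<longlonglongrightarrow> 0" using yV by blast
qed

text \<open>\<open>M\<close> is bounded through coordinates, and coordinates are bounded by
  \<open>N\<close>. This equivalence of norms is what finite dimension contributes to the uniqueness
  of the C*-norm.\<close>

lemma dominated:
  assumes "fd_space V" and M: "is_norm_on V M"
  shows "\<exists>C. \<forall>x\<in>V. M x \<le> C * N x"
proof -
  interpret M: normed_subspace V M using sub M by unfold_locales
  obtain E d C where E: "finite E" "E \<subseteq> V" and d: "\<And>e. e \<in> E \<Longrightarrow> d e \<in> lin V UNIV"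
    "\<And>y. y \<in> V \<Longrightarrow> y = (\<Sum>e\<in>E. d e y *\<^sub>C e)" and C: "C \<ge> 0"
    "\<And>e y. e \<in> E \<Longrightarrow> y \<in> V \<Longrightarrow> cmod (d e y) \<le> C * N y"
    using coordinates_bounded[OF assms(1)] by blast
  have "M x \<le> (C * (\<Sum>e\<in>E. M e)) * N x" if x: "x \<in> V" for x
  proof -
    have "M x = M (\<Sum>e\<in>E. d e x *\<^sub>C e)" using d(2)[OF x] by simp
    also have "\<dots> \<le> (\<Sum>e\<in>E. M (d e x *\<^sub>C e))"
      using E by (intro M.sum_le cvs.subspace_scale sub) auto
    also have "\<dots> = (\<Sum>e\<in>E. cmod (d e x) * M e)" using E by (simp add: M.scale subset_iff)
    also have "\<dots> \<le> (\<Sum>e\<in>E. (C * N x) * M e)"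
      using E x by (intro sum_mono mult_right_mono C M.nonneg) auto
    finally show ?thesis by (simp add: sum_distrib_left mult_ac)
  qed
  then show ?thesis by blast
qed

end

section \<open>Finite-dimensional C*-algebras\<close>

locale star_alg =
  fixes A :: "'a::complex_vector cstar"
  assumes star_algebra: "unital_star_algebra A"
begin

lemma sub: "cvs.subspace (acarr A)"
  and mul_closed [simp]: "x \<in> acarr A \<Longrightarrow> y \<in> acarr A \<Longrightarrow> amul A x y \<in> acarr A"
  and one_closed [simp]: "aone A \<in> acarr A"
  and star_closed [simp]: "x \<in> acarr A \<Longrightarrow> astar A x \<in> acarr A"
  and mul_add_left: "x \<in> acarr A \<Longrightarrow> y \<in> acarr A \<Longrightarrow> z \<in> acarr A \<Longrightarrow>
    amul A (x + y) z = amul A x z + amul A y z"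
  and mul_add_right: "x \<in> acarr A \<Longrightarrow> y \<in> acarr A \<Longrightarrow> z \<in> acarr A \<Longrightarrow>
    amul A x (y + z) = amul A x y + amul A x z"
  and mul_assoc: "x \<in> acarr A \<Longrightarrow> y \<in> acarr A \<Longrightarrow> z \<in> acarr A \<Longrightarrow>
    amul A (amul A x y) z = amul A x (amul A y z)"
  and mul_scale_left: "x \<in> acarr A \<Longrightarrow> y \<in> acarr A \<Longrightarrow> amul A (c *\<^sub>C x) y = c *\<^sub>C amul A x y"
  and mul_scale_right: "x \<in> acarr A \<Longrightarrow> y \<in> acarr A \<Longrightarrow> amul A x (c *\<^sub>C y) = c *\<^sub>C amul A x y"
  and one_left [simp]: "x \<in> acarr A \<Longrightarrow> amul A (aone A) x = x"
  and one_right [simp]: "x \<in> acarr A \<Longrightarrow> amul A x (aone A) = x"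
  and star_star [simp]: "x \<in> acarr A \<Longrightarrow> astar A (astar A x) = x"
  and star_add: "x \<in> acarr A \<Longrightarrow> y \<in> acarr A \<Longrightarrow> astar A (x + y) = astar A x + astar A y"
  and star_mul: "x \<in> acarr A \<Longrightarrow> y \<in> acarr A \<Longrightarrow> astar A (amul A x y) = amul A (astar A y) (astar A x)"
  and star_scale: "x \<in> acarr A \<Longrightarrow> astar A (c *\<^sub>C x) = cnj c *\<^sub>C astar A x"
  using star_algebra unfolding unital_star_algebra_def by blast+

lemma add_closed [simp]: "x \<in> acarr A \<Longrightarrow> y \<in> acarr A \<Longrightarrow> x + y \<in> acarr A"
  and diff_closed [simp]: "x \<in> acarr A \<Longrightarrow> y \<in> acarr A \<Longrightarrow> x - y \<in> acarr A"
  and scale_closed [simp]: "x \<in> acarr A \<Longrightarrow> c *\<^sub>C x \<in> acarr A"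
  and zero_closed [simp]: "0 \<in> acarr A"
  using sub by (auto intro: cvs.subspace_add cvs.subspace_diff cvs.subspace_scale cvs.subspace_0)

lemma mul_diff_left: "x \<in> acarr A \<Longrightarrow> y \<in> acarr A \<Longrightarrow> z \<in> acarr A \<Longrightarrow>
    amul A (x - y) z = amul A x z - amul A y z"
  using mul_add_left[of "x - y" y z] by simp

lemma mul_diff_right: "x \<in> acarr A \<Longrightarrow> y \<in> acarr A \<Longrightarrow> z \<in> acarr A \<Longrightarrow>
    amul A x (y - z) = amul A x y - amul A x z"
  using mul_add_right[of x "y - z" z] by simp

lemma star_diff: "x \<in> acarr A \<Longrightarrow> y \<in> acarr A \<Longrightarrow> astar A (x - y) = astar A x - astar A y"
  using star_add[of "x - y" y] by simp

lemma star_one [simp]: "astar A (aone A) = aone A"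
  using star_mul[of "astar A (aone A)" "aone A"] by simp

lemma mul_zero [simp]: "x \<in> acarr A \<Longrightarrow> amul A x 0 = 0" "x \<in> acarr A \<Longrightarrow> amul A 0 x = 0"
  using mul_diff_right[of x 0 0] mul_diff_left[of 0 0 x] by auto

lemma star_zero [simp]: "astar A 0 = 0"
  using star_diff[of 0 0] by simp

end

text \<open>The norm is a parameter separate from the field \<open>anorm\<close>, so that two
  C*-norms on one algebra can be compared and the operator norm of a representation can be used on
  \<open>mat_star_alg\<close>, whose norm field is a dummy.\<close>

locale cstar_alg = star_alg A for A :: "'a::complex_vector cstar" +
  fixes N :: "'a \<Rightarrow> real"
  assumes cstar_norm: "is_cstar_norm A N"
begin

sublocale normed_subspace "acarr A" N
  using cstar_norm by unfold_locales (auto simp: is_cstar_norm_def sub)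

lemma submult: "x \<in> acarr A \<Longrightarrow> y \<in> acarr A \<Longrightarrow> N (amul A x y) \<le> N x * N y"
  and cstar: "x \<in> acarr A \<Longrightarrow> N (amul A (astar A x) x) = (N x)\<^sup>2"
  and norm_complete: "is_complete_on (acarr A) N"
  using cstar_norm by (auto simp: is_cstar_norm_def)

text \<open>The C*-identity and submultiplicativity bound the norm of \<open>x\<close> by that of
  its adjoint; applying this to the adjoint gives equality.\<close>

lemma norm_star: "x \<in> acarr A \<Longrightarrow> N (astar A x) = N x"
proof -
  have le: "N x \<le> N (astar A x)" if x: "x \<in> acarr A" for x
  proof (cases "N x = 0")
    case False
    have "N x * N x \<le> N (astar A x) * N x"
      using submult[of "astar A x" x] x by (simp add: cstar power2_eq_square)
    then show ?thesis using False nonneg[OF x] by simp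
  qed (use x in \<open>simp add: nonneg\<close>)
  show "x \<in> acarr A \<Longrightarrow> N (astar A x) = N x"
    using le[of x] le[of "astar A x"] by simp
qed

text \<open>For hermitian elements the C*-identity says that squaring squares the norm. Repeated
  squaring thus determines the norm from the growth of powers, as the spectral radius formula
  would.\<close>

lemma hermitian_iterated_square:
  assumes "h \<in> acarr A" "astar A h = h"
  shows "((\<lambda>x. amul A x x) ^^ k) h \<in> acarr A \<and>
    astar A (((\<lambda>x. amul A x x) ^^ k) h) = ((\<lambda>x. amul A x x) ^^ k) h \<and>
    N (((\<lambda>x. amul A x x) ^^ k) h) = N h ^ (2 ^ k)"
proof (induction k)
  case (Suc k)
  let ?y = "((\<lambda>x. amul A x x) ^^ k) h"
  have "N (amul A ?y ?y) = (N ?y)\<^sup>2" using cstar[of ?y] Suc by simp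
  then show ?case using Suc by (simp add: star_mul power_mult[symmetric] mult.commute)
qed (use assms in simp)

text \<open>The norm of the unit equals its own square, so it is 0 or 1; the value 0 occurs in the
  zero algebra.\<close>

lemma norm_one_le: "N (aone A) \<le> 1"
proof -
  have "N (aone A) = (N (aone A))\<^sup>2" using cstar[of "aone A"] by simp
  then have "N (aone A) * (N (aone A) - 1) = 0" by (simp add: power2_eq_square algebra_simps)
  then show ?thesis by auto
qed

end

section \<open>Uniqueness of the C*-norm\<close>

lemma le_of_powers_dominated:
  fixes a b C :: real
  assumes "a \<ge> 0" "b \<ge> 0" and le: "\<And>k. a ^ (2 ^ k) \<le> C * b ^ (2 ^ k)" and b0: "b = 0 \<Longrightarrow> a = 0"
  shows "a \<le> b"
proof (rule ccontr)
  assume "\<not> a \<le> b"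
  with assms have b: "b > 0" and r: "a / b > 1" by (fastforce simp: less_le field_simps)+
  have "(a / b) ^ (2 ^ k) \<le> C" for k
    using le[of k] b by (simp add: power_divide field_simps)
  moreover obtain n where "C < (a / b) ^ n" using real_arch_pow[OF r] by blast
  moreover have "(a / b) ^ n \<le> (a / b) ^ (2 ^ n)" using r by (intro power_increasing) auto
  ultimately show False by (meson leD less_le_trans)
qed

text \<open>On hermitian \<open>h\<close> both norms satisfy the power law of iterated squaring, so
  the constant that compares two norms in finite dimension disappears under roots of order 2^k. The
  C*-identity transfers the result to all \<open>x\<close>.\<close>

lemma cstar_norm_unique:
  assumes "unital_star_algebra A" "fd_space (acarr A)" "is_cstar_norm A N" "is_cstar_norm A M"
    and x: "x \<in> acarr A"
  shows "N x = M x"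
proof -
  have le: "N x \<le> M x" if N: "is_cstar_norm A N" and M: "is_cstar_norm A M" for N M
  proof -
    interpret N: cstar_alg A N using assms N by unfold_locales
    interpret M: cstar_alg A M using assms M by unfold_locales
    obtain C where C: "\<And>x. x \<in> acarr A \<Longrightarrow> N x \<le> C * M x"
      using M.dominated[OF assms(2) N.nrm] by blast
    define h where "h = amul A (astar A x) x"
    have h: "h \<in> acarr A" "astar A h = h" using x by (simp_all add: h_def N.star_mul)
    have "N h \<le> M h"
    proof (rule le_of_powers_dominated)
      show "N h ^ 2 ^ k \<le> C * M h ^ 2 ^ k" for k
        using C N.hermitian_iterated_square[OF h, of k] M.hermitian_iterated_square[OF h, of k] by metis
      show "M h = 0 \<Longrightarrow> N h = 0" using h by (simp add: N.eq_0_iff M.eq_0_iff)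
    qed (use h in \<open>auto simp: N.nonneg M.nonneg\<close>)
    then have "(N x)\<^sup>2 \<le> (M x)\<^sup>2" using x by (simp add: h_def N.cstar M.cstar)
    then show ?thesis using M.nonneg[OF x] by (rule power2_le_imp_le)
  qed
  show ?thesis using le assms by (intro antisym) auto
qed

section \<open>Square roots of hermitian elements near the unit\<close>

context cstar_alg
begin

text \<open>The iteration \<open>y \<mapsto> (z + y\<^sup>2) / 2\<close> with \<open>z = 1 - t\<close> converges to \<open>1 - \<surd>t\<close>; it is dominated by the
  same iteration on real numbers with \<open>z = 1\<close>.\<close>

lemma hermitian_square_root:
  assumes t: "t \<in> acarr A" "astar A t = t" and le1: "N (aone A - t) \<le> 1"
  obtains b where "b \<in> acarr A" "amul A (astar A b) b = t"
proof -
  define z where "z = aone A - t"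
  have z: "z \<in> acarr A" "astar A z = z" "N z \<le> 1" using t le1 by (simp_all add: z_def star_diff)
  define Y where "Y k = ((\<lambda>y. (1/2) *\<^sub>C (z + amul A y y)) ^^ k) 0" for k
  define r where "r k = ((\<lambda>y. (1 + y * y) / 2) ^^ k) (0::real)" for k
  have Y0: "Y 0 = 0" and YS: "\<And>k. Y (Suc k) = (1/2) *\<^sub>C (z + amul A (Y k) (Y k))"
    by (simp_all add: Y_def)
  have r0: "r 0 = 0" and rS: "\<And>k. r (Suc k) = (1 + r k * r k) / 2" by (simp_all add: r_def)
  have Yc [simp]: "Y k \<in> acarr A" for k by (induction k) (simp_all add: Y0 YS z)
  have Yh: "astar A (Y k) = Y k" for k
    by (induction k) (simp_all add: Y0 YS z star_scale star_add star_mul)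
  have r01: "0 \<le> r k \<and> r k \<le> 1" for k
  proof (induction k)
    case (Suc k)
    then have "r k * r k \<le> 1" by (intro mult_le_one) auto
    then show ?case using Suc by (simp add: rS)
  qed (simp add: r0)
  have sq_le: "N (amul A x x - amul A y y) \<le> (N x + N y) * N (x - y)"
    if "x \<in> acarr A" "y \<in> acarr A" for x y
  proof -
    have "amul A x x - amul A y y = amul A x (x - y) + amul A (x - y) y"
      using that by (simp add: mul_diff_left mul_diff_right)
    also have "N \<dots> \<le> N (amul A x (x - y)) + N (amul A (x - y) y)"
      using that by (intro triangle) auto
    also have "\<dots> \<le> N x * N (x - y) + N (x - y) * N y"
      using that by (intro add_mono submult) auto
    finally show ?thesis by (simp add: algebra_simps)
  qed
  have Yr: "N (Y k) \<le> r k" for k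
  proof (induction k)
    case (Suc k)
    have "N (Y (Suc k)) = N (z + amul A (Y k) (Y k)) / 2" using z by (simp add: YS scale)
    also have "N (z + amul A (Y k) (Y k)) \<le> N z + N (Y k) * N (Y k)"
      using triangle[of z "amul A (Y k) (Y k)"] submult[of "Y k" "Y k"] z by simp
    also have "\<dots> \<le> 1 + r k * r k"
      using z Suc nonneg[of "Y k"] r01[of k] by (intro add_mono mult_mono) auto
    finally show ?case by (simp add: rS)
  qed (simp add: Y0 r0)
  have step: "N (Y (Suc k) - Y k) \<le> r (Suc k) - r k" for k
  proof (induction k)
    case 0
    then show ?case using z by (simp add: YS Y0 rS r0 scale)
  next
    case (Suc k)
    have "Y (Suc (Suc k)) - Y (Suc k) = (1/2) *\<^sub>C (amul A (Y (Suc k)) (Y (Suc k)) - amul A (Y k) (Y k))"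
      unfolding YS[of "Suc k"] YS[of k] by (simp add: cvs.scale_right_diff_distrib[symmetric])
    then have "N (Y (Suc (Suc k)) - Y (Suc k)) = N (amul A (Y (Suc k)) (Y (Suc k)) - amul A (Y k) (Y k)) / 2"
      by (simp add: scale)
    also have "N (amul A (Y (Suc k)) (Y (Suc k)) - amul A (Y k) (Y k))
        \<le> (N (Y (Suc k)) + N (Y k)) * N (Y (Suc k) - Y k)" by (rule sq_le) simp_all
    also have "\<dots> \<le> (r (Suc k) + r k) * (r (Suc k) - r k)"
      using Yr[of k] Yr[of "Suc k"] Suc r01[of k] r01[of "Suc k"] by (intro mult_mono) (auto simp: nonneg)
    finally show ?case by (simp add: rS[of "Suc k"] rS[of k] field_simps)
  qed
  have dist: "N (Y (k + m) - Y k) \<le> r (k + m) - r k" for k m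
  proof (induction m)
    case (Suc m)
    have "N (Y (Suc (k + m)) - Y k) \<le> N (Y (Suc (k + m)) - Y (k + m)) + N (Y (k + m) - Y k)"
      by (rule triangle_via) simp_all
    then show ?case using step[of "k + m"] Suc by simp
  qed simp
  \<comment> \<open>Every increment of \<open>r\<close> bounds a norm and is therefore
    nonnegative.\<close>
  have "incseq r"
  proof (rule incseq_SucI)
    fix k
    show "r k \<le> r (Suc k)" using step[of k] nonneg[of "Y (Suc k) - Y k"] by simp
  qed
  moreover have "bdd_above (range r)" using r01 by (intro bdd_aboveI[of _ 1]) auto
  ultimately have "convergent r"
    using LIMSEQ_incseq_SUP[of r] convergent_def by blast
  then have "Cauchy r" by (rule convergent_Cauchy)
  have "\<forall>e>0. \<exists>K. \<forall>m\<ge>K. \<forall>k\<ge>K. N (Y m - Y k) < e"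
  proof (intro allI impI)
    fix e :: real assume "e > 0"
    with \<open>Cauchy r\<close> obtain K where K: "\<And>m k. m \<ge> K \<Longrightarrow> k \<ge> K \<Longrightarrow> dist (r m) (r k) < e"
      by (meson metric_CauchyD)
    have "N (Y m - Y k) < e" if "m \<ge> K" "k \<ge> K" for m k
      using that
    proof (induction m k rule: linorder_wlog)
      case (le a b)
      then have "N (Y b - Y a) \<le> r b - r a" using dist[of a "b - a"] by simp
      then show ?case using K[of a b] le minus_commute[of "Y a" "Y b"] by (simp add: dist_norm)
    qed (metis minus_commute Yc)
    then show "\<exists>K. \<forall>m\<ge>K. \<forall>k\<ge>K. N (Y m - Y k) < e" by blast
  qed
  then obtain y where y: "y \<in> acarr A" and lim: "(\<lambda>k. N (Y k - y)) \<longlonglongrightarrow> 0"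
    using norm_complete[unfolded is_complete_on_def, THEN spec, of Y] Yc by blast
  have zero: "x = 0" if "x \<in> acarr A" "\<And>k. N x \<le> g k" "g \<longlonglongrightarrow> 0" for x g
    using LIMSEQ_le_const[OF that(3)] that nonneg[of x] eq_0_iff[of x]
    by (metis order_antisym)
  have "astar A y - y = 0"
  proof (rule zero)
    fix k
    have "N (astar A y - y) \<le> N (astar A y - Y k) + N (Y k - y)"
      using y by (intro triangle_via) auto
    also have "N (astar A y - Y k) = N (Y k - y)"
      using norm_star[of "y - Y k"] y minus_commute[of y "Y k"] by (simp add: star_diff Yh)
    finally show "N (astar A y - y) \<le> N (Y k - y) + N (Y k - y)" .
  qed (use y tendsto_add[OF lim lim] in auto)
  then have yh: "astar A y = y" by simp
  have "y - (1/2) *\<^sub>C (z + amul A y y) = 0"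
  proof (rule zero)
    fix k
    have "N (y - (1/2) *\<^sub>C (z + amul A y y)) \<le> N (y - Y (Suc k)) + N (Y (Suc k) - (1/2) *\<^sub>C (z + amul A y y))"
      using y z by (intro triangle_via) auto
    also have "Y (Suc k) - (1/2) *\<^sub>C (z + amul A y y) = (1/2) *\<^sub>C (amul A (Y k) (Y k) - amul A y y)"
      by (simp add: YS cvs.scale_right_diff_distrib[symmetric])
    also have "N \<dots> = N (amul A (Y k) (Y k) - amul A y y) / 2" using y by (simp add: scale)
    also have "N (amul A (Y k) (Y k) - amul A y y) \<le> (N (Y k) + N y) * N (Y k - y)"
      using y by (intro sq_le) auto
    also have "\<dots> \<le> (1 + N y) * N (Y k - y)"
      using Yr[of k] r01[of k] y by (intro mult_right_mono nonneg) auto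
    finally show "N (y - (1/2) *\<^sub>C (z + amul A y y)) \<le> N (Y (Suc k) - y) + (1 + N y) * N (Y k - y) / 2"
      using minus_commute[of y "Y (Suc k)"] y by simp
    show "(\<lambda>k. N (Y (Suc k) - y) + (1 + N y) * N (Y k - y) / 2) \<longlonglongrightarrow> 0"
      using tendsto_add[OF LIMSEQ_Suc[OF lim] tendsto_divide[OF tendsto_mult[OF tendsto_const[of "1
        + N y"] lim] tendsto_const[of 2]]]
      by simp
  qed (use y z in simp)
  then have "2 *\<^sub>C y = 2 *\<^sub>C (1/2) *\<^sub>C (z + amul A y y)" by simp
  then have yy: "y + y = z + amul A y y"
    using scaleC_add_left[of 1 1 y] by (simp add: scaleC_scaleC scaleC_one)
  \<comment> \<open>By the fixed point equation \<open>yy\<close>, the square of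
    \<open>aone A - y\<close> is \<open>aone A - z\<close>, which is \<open>t\<close>.\<close>
  show ?thesis
  proof (rule that[of "aone A - y"])
    have "amul A (aone A - y) (aone A - y) = aone A - (y + y) + amul A y y"
      using y by (simp add: mul_diff_left mul_diff_right)
    also have "\<dots> = t" unfolding yy by (simp add: z_def)
    finally show "amul A (astar A (aone A - y)) (aone A - y) = t" using y by (simp add: star_diff yh)
  qed (use y in simp)
qed

end

section \<open>Faithful matrix representations\<close>

text \<open>Of \<open>A\<close> only a closed carrier is assumed. All algebra laws are pulled back
  from matrices through injectivity of \<open>P\<close>, which is how matrix algebras, products and
  tensor products are shown to be star algebras. The conditions on \<open>P\<close> concern indices
  in \<open>I\<close> only.\<close>

locale star_rep =
  fixes A :: "'a::complex_vector cstar" and I :: "'i set" and P :: "'a \<Rightarrow> 'i \<Rightarrow> 'i \<Rightarrow> complex"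
  assumes fin: "finite I" and subsp: "cvs.subspace (acarr A)"
    and mulc: "\<And>x y. x \<in> acarr A \<Longrightarrow> y \<in> acarr A \<Longrightarrow> amul A x y \<in> acarr A"
    and onec: "aone A \<in> acarr A"
    and starc: "\<And>x. x \<in> acarr A \<Longrightarrow> astar A x \<in> acarr A"
    and P_add: "\<And>x y i j. x \<in> acarr A \<Longrightarrow> y \<in> acarr A \<Longrightarrow> i \<in> I \<Longrightarrow> j \<in> I \<Longrightarrow>
      P (x + y) i j = P x i j + P y i j"
    and P_scale: "\<And>c x i j. x \<in> acarr A \<Longrightarrow> i \<in> I \<Longrightarrow> j \<in> I \<Longrightarrow> P (c *\<^sub>C x) i j = c * P x i j"
    and P_mul: "\<And>x y i j. x \<in> acarr A \<Longrightarrow> y \<in> acarr A \<Longrightarrow> i \<in> I \<Longrightarrow> j \<in> I \<Longrightarrow>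
      P (amul A x y) i j = (\<Sum>k\<in>I. P x i k * P y k j)"
    and P_star: "\<And>x i j. x \<in> acarr A \<Longrightarrow> i \<in> I \<Longrightarrow> j \<in> I \<Longrightarrow> P (astar A x) i j = cnj (P x j i)"
    and P_one: "\<And>i j. i \<in> I \<Longrightarrow> j \<in> I \<Longrightarrow> P (aone A) i j = (if i = j then 1 else 0)"
    and P_inj: "\<And>x. x \<in> acarr A \<Longrightarrow> (\<And>i j. i \<in> I \<Longrightarrow> j \<in> I \<Longrightarrow> P x i j = 0) \<Longrightarrow> x = 0"
begin

lemma P_diff: "x \<in> acarr A \<Longrightarrow> y \<in> acarr A \<Longrightarrow> i \<in> I \<Longrightarrow> j \<in> I \<Longrightarrow> P (x - y) i j = P x i j - P y i j"
  using P_add[of "x - y" y i j] cvs.subspace_diff[OF subsp, of x y] by simp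

lemma P_zero: "i \<in> I \<Longrightarrow> j \<in> I \<Longrightarrow> P 0 i j = 0"
  using P_diff[of 0 0 i j] cvs.subspace_0[OF subsp] by simp

lemma P_sum: "(\<And>e. e \<in> E \<Longrightarrow> f e \<in> acarr A) \<Longrightarrow> i \<in> I \<Longrightarrow> j \<in> I \<Longrightarrow>
    P (\<Sum>e\<in>E. f e) i j = (\<Sum>e\<in>E. P (f e) i j)"
  by (rule sum_additive_on[OF subsp]) (auto simp: P_add)

lemma P_eqI:
  assumes "x \<in> acarr A" "y \<in> acarr A" "\<And>i j. i \<in> I \<Longrightarrow> j \<in> I \<Longrightarrow> P x i j = P y i j"
  shows "x = y"
  using P_inj[of "x - y"] assms by (simp add: P_diff cvs.subspace_diff[OF subsp])

lemmas closed = mulc onec starc cvs.subspace_add[OF subsp] cvs.subspace_scale[OF subsp]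

lemma unital_star_algebra: "unital_star_algebra A"
  unfolding unital_star_algebra_def
proof (intro conjI allI ballI)
  fix x y z assume xyz: "x \<in> acarr A" "y \<in> acarr A" "z \<in> acarr A"
  show "amul A (x + y) z = amul A x z + amul A y z"
    by (rule P_eqI) (use xyz in \<open>simp_all add: closed P_add P_mul distrib_right sum.distrib\<close>)
  show "amul A x (y + z) = amul A x y + amul A x z"
    by (rule P_eqI) (use xyz in \<open>simp_all add: closed P_add P_mul distrib_left sum.distrib\<close>)
  show "amul A (amul A x y) z = amul A x (amul A y z)"
  proof (rule P_eqI)
    fix i j assume "i \<in> I" "j \<in> I"
    then have "P (amul A (amul A x y) z) i j = (\<Sum>k\<in>I. \<Sum>l\<in>I. P x i l * (P y l k * P z k j))"
      using xyz by (simp add: closed P_mul sum_distrib_right mult.assoc)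
    also have "\<dots> = (\<Sum>l\<in>I. \<Sum>k\<in>I. P x i l * (P y l k * P z k j))" by (rule sum.swap)
    finally show "P (amul A (amul A x y) z) i j = P (amul A x (amul A y z)) i j"
      using xyz \<open>i \<in> I\<close> \<open>j \<in> I\<close> by (simp add: closed P_mul sum_distrib_left)
  qed (use xyz in \<open>simp_all add: closed\<close>)
next
  fix c x y assume xy: "x \<in> acarr A" "y \<in> acarr A"
  show "amul A (c *\<^sub>C x) y = c *\<^sub>C amul A x y"
    by (rule P_eqI) (use xy in \<open>simp_all add: closed P_scale P_mul sum_distrib_left mult_ac\<close>)
  show "amul A x (c *\<^sub>C y) = c *\<^sub>C amul A x y"
    by (rule P_eqI) (use xy in \<open>simp_all add: closed P_scale P_mul sum_distrib_left mult_ac\<close>)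
next
  fix x assume x: "x \<in> acarr A"
  show "amul A (aone A) x = x"
    by (rule P_eqI)
      (use x fin in \<open>simp_all add: closed P_mul P_one if_distrib[of "\<lambda>u. u * _"] sum.delta cong: if_cong\<close>)
  show "amul A x (aone A) = x"
    by (rule P_eqI) (use x fin in \<open>simp_all add: closed P_mul P_one if_distrib sum.delta cong: if_cong\<close>)
  show "astar A (astar A x) = x"
    by (rule P_eqI) (use x in \<open>simp_all add: closed P_star\<close>)
next
  fix x y assume xy: "x \<in> acarr A" "y \<in> acarr A"
  show "astar A (x + y) = astar A x + astar A y"
    by (rule P_eqI) (use xy in \<open>simp_all add: closed P_star P_add\<close>)
  show "astar A (amul A x y) = amul A (astar A y) (astar A x)"
    by (rule P_eqI) (use xy in \<open>simp_all add: closed P_star P_mul mult_ac\<close>)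
next
  fix c x assume x: "x \<in> acarr A"
  show "astar A (c *\<^sub>C x) = cnj c *\<^sub>C astar A x"
    by (rule P_eqI) (use x in \<open>simp_all add: closed P_star P_scale\<close>)
qed (use closed subsp in auto)

sublocale star_alg A by unfold_locales (rule unital_star_algebra)

lemma norm_on: "is_norm_on (acarr A) (\<lambda>x. gnorm I (P x))"
  unfolding is_norm_on_def
proof (intro conjI ballI allI)
  fix x y assume x: "x \<in> acarr A" and y: "y \<in> acarr A"
  have "gnorm I (P (x + y)) = gnorm I (\<lambda>i j. P x i j + P y i j)"
    by (rule gnorm_cong) (use x y in \<open>simp add: P_add\<close>)
  then show "gnorm I (P (x + y)) \<le> gnorm I (P x) + gnorm I (P y)"
    using gnorm_add[OF fin] by simp
next
  fix x c assume x: "x \<in> acarr A"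
  show "0 \<le> gnorm I (P x)" using fin by simp
  have "gnorm I (P (c *\<^sub>C x)) = gnorm I (\<lambda>i j. c * P x i j)"
    by (rule gnorm_cong) (use x in \<open>simp add: P_scale\<close>)
  then show "gnorm I (P (c *\<^sub>C x)) = cmod c * gnorm I (P x)"
    using gnorm_scale[OF fin] by simp
  have "x = 0" if "gnorm I (P x) = 0"
    by (rule P_inj[OF x]) (use gnorm_entry[OF fin, of _ _ "P x"] that in auto)
  moreover have "gnorm I (P 0) = 0" by (rule gnorm_0[OF fin]) (rule P_zero)
  ultimately show "gnorm I (P x) = 0 \<longleftrightarrow> x = 0" by blast
qed

lemma cstar_norm:
  assumes "fd_space (acarr A)"
  shows "is_cstar_norm A (\<lambda>x. gnorm I (P x))"
  unfolding is_cstar_norm_def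
proof (intro conjI ballI norm_on)
  interpret normed_subspace "acarr A" "\<lambda>x. gnorm I (P x)"
    using subsp norm_on by unfold_locales
  show "is_complete_on (acarr A) (\<lambda>x. gnorm I (P x))" by (rule complete[OF assms])
next
  fix x y assume x: "x \<in> acarr A" and y: "y \<in> acarr A"
  have "gnorm I (P (amul A x y)) = gnorm I (\<lambda>i j. \<Sum>k\<in>I. P x i k * P y k j)"
    by (rule gnorm_cong) (use x y in \<open>simp add: P_mul\<close>)
  then show "gnorm I (P (amul A x y)) \<le> gnorm I (P x) * gnorm I (P y)"
    using gnorm_mult[OF fin] by simp
next
  fix x assume x: "x \<in> acarr A"
  have "gnorm I (P (amul A (astar A x) x)) = gnorm I (\<lambda>i j. \<Sum>k\<in>I. cnj (P x k i) * P x k j)"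
    by (rule gnorm_cong) (use x in \<open>simp add: P_mul P_star\<close>)
  then show "gnorm I (P (amul A (astar A x) x)) = (gnorm I (P x))\<^sup>2"
    using gnorm_cstar[OF fin] by simp
qed

text \<open>Allows any C*-norm, such as \<open>anorm\<close> or the one selected by
  \<open>THE\<close> in \<open>mat_alg\<close>, to be replaced by the operator norm of any faithful
  representation at hand.\<close>

lemma norm_eq:
  assumes "fd_space (acarr A)" "is_cstar_norm A M" "x \<in> acarr A"
  shows "M x = gnorm I (P x)"
  by (rule cstar_norm_unique[OF unital_star_algebra assms(1,2) cstar_norm[OF assms(1)] assms(3)])

end

section \<open>Finite-dimensional subspaces of matrices, tensors and pairs\<close>

lemma sum_fun: "(\<Sum>e\<in>E. f e) x = (\<Sum>e\<in>E. f e x :: 'b::comm_monoid_add)"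
  by (induction E rule: infinite_finite_induct) auto

lemma fd_spaceI:
  assumes "cvs.subspace V" "finite B" "B \<subseteq> V" "V \<subseteq> cvs.span B"
  shows "fd_space V"
  unfolding fd_space_def using assms cvs.span_minimal[of B V] by blast

lemma span_image_linear:
  assumes "\<And>x y. f (x + y) = f x + f y" "\<And>c x. f (c *\<^sub>C x) = c *\<^sub>C f x" "x \<in> cvs.span B"
  shows "f x \<in> cvs.span (f ` B)"
  using assms(3)
proof (induction rule: cvs.span_induct_alt)
  case base
  have "f 0 = 0" using assms(2)[of 0 0] by simp
  then show ?case by (simp add: cvs.span_zero)
next
  case (step c x y)
  then show ?case by (simp add: assms cvs.span_add cvs.span_scale cvs.span_base)
qed

definition matrix_unit :: "nat \<Rightarrow> nat \<Rightarrow> 'a::zero \<Rightarrow> nat \<Rightarrow> nat \<Rightarrow> 'a" where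
  "matrix_unit i j v = (\<lambda>k l. if k = i \<and> l = j then v else 0)"

lemma mats_expand:
  assumes "x \<in> mats n V"
  shows "x = (\<Sum>i<n. \<Sum>j<n. matrix_unit i j (x i j :: 'a::complex_vector))"
proof (intro ext)
  fix k l
  have "(\<Sum>i<n. \<Sum>j<n. matrix_unit i j (x i j)) k l
      = (\<Sum>i<n. if i = k then (\<Sum>j<n. if j = l then x i j else 0) else 0)"
    unfolding sum_fun by (intro sum.cong refl) (auto simp: matrix_unit_def intro!: sum.neutral sum.cong)
  also have "\<dots> = (if k < n \<and> l < n then x k l else 0)" by (simp add: sum.delta)
  finally show "x k l = (\<Sum>i<n. \<Sum>j<n. matrix_unit i j (x i j)) k l"
    using assms by (auto simp: mats_def)
qed

lemma single_in_mats: "x \<in> V \<Longrightarrow> single x \<in> mats 1 V"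
  by (simp add: single_def mats_def)

lemma subspace_mats: "cvs.subspace V \<Longrightarrow> cvs.subspace (mats n V)"
  by (rule cvs.subspaceI)
    (auto simp: mats_def cvs.subspace_0 cvs.subspace_add cvs.subspace_scale scaleC_fun_def)

lemma fd_space_mats:
  assumes "fd_space V"
  shows "fd_space (mats n V)"
proof -
  from assms obtain B where V: "cvs.subspace V" and B: "finite B" "cvs.span B = V"
    by (auto simp: fd_space_def)
  have BV: "B \<subseteq> V" using B cvs.span_superset by blast
  let ?B = "\<Union>i<n. \<Union>j<n. matrix_unit i j ` B"
  show ?thesis
  proof (rule fd_spaceI)
    show "cvs.subspace (mats n V)" by (rule subspace_mats[OF V])
    show "finite ?B" using B by simp
    show "?B \<subseteq> mats n V" using BV V by (auto simp: mats_def matrix_unit_def cvs.subspace_0)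
    show "mats n V \<subseteq> cvs.span ?B"
    proof
      fix x assume x: "x \<in> mats n V"
      have "matrix_unit i j (x i j) \<in> cvs.span ?B" if "i < n" "j < n" for i j
      proof -
        have "matrix_unit i j (x i j) \<in> cvs.span (matrix_unit i j ` B)"
          using x that B
          by (intro span_image_linear) (auto simp: matrix_unit_def fun_eq_iff scaleC_fun_def mats_def)
        also have "\<dots> \<subseteq> cvs.span ?B" using that by (intro cvs.span_mono) blast
        finally show ?thesis .
      qed
      then have "(\<Sum>i<n. \<Sum>j<n. matrix_unit i j (x i j)) \<in> cvs.span ?B"
        by (intro cvs.span_sum) auto
      then show "x \<in> cvs.span ?B" using mats_expand[OF x] by simp
    qed
  qed
qed

lemma subspace_tens: "cvs.subspace V \<Longrightarrow> cvs.subspace W \<Longrightarrow> cvs.subspace (tens V W)"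
  unfolding tens_def by (intro lin_subspace) auto

lemma fd_space_tens:
  assumes V: "fd_space V" and W: "fd_space W"
  shows "fd_space (tens V W)"
proof -
  have s: "cvs.subspace V" "cvs.subspace W" using assms by (auto simp: fd_space_def)
  from V obtain B where B: "finite B" "cvs.span B = V" by (auto simp: fd_space_def)
  have BV: "B \<subseteq> V" using B cvs.span_superset by blast
  obtain E d where E: "finite E" "E \<subseteq> W" and d: "\<And>e. e \<in> E \<Longrightarrow> d e \<in> lin W UNIV"
    "\<And>y. y \<in> W \<Longrightarrow> y = (\<Sum>e\<in>E. d e y *\<^sub>C e)"
    using fd_space_coordinates[OF W] by metis
  let ?B = "\<Union>e\<in>E. (\<lambda>x. pure W x e) ` B"
  show ?thesis
  proof (rule fd_spaceI)
    show "cvs.subspace (tens V W)" by (rule subspace_tens[OF s])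
    show "finite ?B" using B E by simp
    show "?B \<subseteq> tens V W" using BV E s by (auto intro!: pure_in_tens)
    show "tens V W \<subseteq> cvs.span ?B"
    proof
      fix t assume t: "t \<in> tens V W"
      have "pure W (t (d e)) e \<in> cvs.span ?B" if "e \<in> E" for e
      proof -
        have "t (d e) \<in> cvs.span B" using t d that lin_mem B by (fastforce simp: tens_def)
        then have "pure W (t (d e)) e \<in> cvs.span ((\<lambda>x. pure W x e) ` B)"
          by (intro span_image_linear[of "\<lambda>x. pure W x e"])
            (auto simp: pure_def restr0_def fun_eq_iff scaleC_fun_def scaleC_add_right scaleC_scaleC
              mult.commute)
        also have "\<dots> \<subseteq> cvs.span ?B" using that by (intro cvs.span_mono) blast
        finally show ?thesis .
      qed
      then have "(\<Sum>e\<in>E. pure W (t (d e)) e) \<in> cvs.span ?B" by (intro cvs.span_sum) auto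
      then show "t \<in> cvs.span ?B" using tens_expand[OF V W E d t] by simp
    qed
  qed
qed

lemma subspace_Times: "cvs.subspace V \<Longrightarrow> cvs.subspace W \<Longrightarrow> cvs.subspace (V \<times> W)"
  by (rule cvs.subspaceI)
    (auto simp: zero_prod_def scaleC_prod_def cvs.subspace_0 cvs.subspace_add cvs.subspace_scale)

lemma fd_space_Times:
  assumes V: "fd_space V" and W: "fd_space W"
  shows "fd_space (V \<times> W)"
proof -
  have s: "cvs.subspace V" "cvs.subspace W" using assms by (auto simp: fd_space_def)
  from V W obtain B D where B: "finite B" "cvs.span B = V" and D: "finite D" "cvs.span D = W"
    by (auto simp: fd_space_def)
  have sub: "B \<subseteq> V" "D \<subseteq> W" using B D cvs.span_superset by blast+
  let ?B = "(\<lambda>x. (x, 0)) ` B \<union> (\<lambda>y. (0, y)) ` D"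
  show ?thesis
  proof (rule fd_spaceI)
    show "cvs.subspace (V \<times> W)" by (rule subspace_Times[OF s])
    show "finite ?B" using B D by simp
    show "?B \<subseteq> V \<times> W" using sub s by (auto simp: cvs.subspace_0)
    show "V \<times> W \<subseteq> cvs.span ?B"
    proof
      fix z assume z: "z \<in> V \<times> W"
      have "(fst z, 0) \<in> cvs.span ((\<lambda>x. (x, 0)) ` B)"
        using z B by (intro span_image_linear[of "\<lambda>x. (x, 0)"]) (auto simp: scaleC_prod_def)
      moreover have "(0, snd z) \<in> cvs.span ((\<lambda>y. (0, y)) ` D)"
        using z D by (intro span_image_linear[of "\<lambda>y. (0, y)"]) (auto simp: scaleC_prod_def)
      ultimately have "(fst z, 0) \<in> cvs.span ?B" "(0, snd z) \<in> cvs.span ?B"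
        using cvs.span_mono[of "(\<lambda>x. (x, 0)) ` B" ?B] cvs.span_mono[of "(\<lambda>y. (0, y)) ` D" ?B] by auto
      then have "(fst z, 0) + (0, snd z) \<in> cvs.span ?B" by (rule cvs.span_add)
      then show "z \<in> cvs.span ?B" by simp
    qed
  qed
qed

section \<open>The operator space of an algebra\<close>

text \<open>The norms in the definitions are normalised off the carrier and operator norms of
  representations are not; this passes between the two.\<close>

lemma (in star_alg) cstar_norm_cong:
  assumes eq: "\<And>x. x \<in> acarr A \<Longrightarrow> N x = M x" and N: "is_cstar_norm A N"
  shows "is_cstar_norm A M"
proof -
  have n: "is_norm_on (acarr A) N" and c: "is_complete_on (acarr A) N"
    and m: "\<And>x y. x \<in> acarr A \<Longrightarrow> y \<in> acarr A \<Longrightarrow> N (amul A x y) \<le> N x * N y"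
    and s: "\<And>x. x \<in> acarr A \<Longrightarrow> N (amul A (astar A x) x) = (N x)\<^sup>2"
    using N by (auto simp: is_cstar_norm_def)
  have "is_norm_on (acarr A) M" using n by (simp add: is_norm_on_def eq)
  moreover have "is_complete_on (acarr A) M"
    unfolding is_complete_on_def
  proof (intro allI impI, elim conjE)
    fix u :: "nat \<Rightarrow> 'a"
    assume u: "\<forall>k. u k \<in> acarr A" and "\<forall>e>0. \<exists>K. \<forall>m\<ge>K. \<forall>k\<ge>K. M (u m - u k) < e"
    then have "\<forall>e>0. \<exists>K. \<forall>m\<ge>K. \<forall>k\<ge>K. N (u m - u k) < e" by (simp add: eq)
    with c u obtain l where l: "l \<in> acarr A" "(\<lambda>k. N (u k - l)) \<longlonglongrightarrow> 0"
      unfolding is_complete_on_def by blast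
    with u have "(\<lambda>k. M (u k - l)) \<longlonglongrightarrow> 0" by (simp add: eq)
    with l show "\<exists>l\<in>acarr A. (\<lambda>k. M (u k - l)) \<longlonglongrightarrow> 0" by blast
  qed
  moreover have "M (amul A x y) \<le> M x * M y" if "x \<in> acarr A" "y \<in> acarr A" for x y
    using m[OF that] that by (simp add: eq)
  moreover have "M (amul A (astar A x) x) = (M x)\<^sup>2" if "x \<in> acarr A" for x
    using s[OF that] that by (simp add: eq)
  ultimately show ?thesis by (simp add: is_cstar_norm_def)
qed

text \<open>The amplification of \<open>P\<close> to matrices over \<open>A\<close>, acting on the
  tensor product of C^n with the space of \<open>P\<close>; the matrix index comes first.\<close>

definition matrep :: "('a \<Rightarrow> 'i \<Rightarrow> 'i \<Rightarrow> complex) \<Rightarrow> (nat \<Rightarrow> nat \<Rightarrow> 'a) \<Rightarrow> nat \<times> 'i \<Rightarrow> nat \<times> 'i \<Rightarrow> complex" where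
  "matrep P x = (\<lambda>p q. P (x (fst p) (fst q)) (snd p) (snd q))"

lemma acarr_mat_star_alg [simp]: "acarr (mat_star_alg n A) = mats n (acarr A)"
  by (simp add: mat_star_alg_def)

lemma carr_os_of [simp]: "carr (os_of A) = acarr A"
  by (simp add: os_of_def)

context star_rep
begin

lemma mat_star_rep: "star_rep (mat_star_alg n A) ({..<n} \<times> I) (matrep P)"
proof
  show "finite ({..<n} \<times> I)" using fin by simp
  show "cvs.subspace (acarr (mat_star_alg n A))" by (simp add: subspace_mats subsp)
  fix x y assume "x \<in> acarr (mat_star_alg n A)" "y \<in> acarr (mat_star_alg n A)"
  then have x: "x \<in> mats n (acarr A)" and y: "y \<in> mats n (acarr A)" by simp_all
  show "amul (mat_star_alg n A) x y \<in> acarr (mat_star_alg n A)"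
    using x y by (auto simp: mat_star_alg_def mats_def intro!: cvs.subspace_sum subsp)
  fix i j assume ij: "i \<in> {..<n} \<times> I" "j \<in> {..<n} \<times> I"
  show "matrep P (x + y) i j = matrep P x i j + matrep P y i j"
    using x y ij by (auto simp: matrep_def mats_def P_add)
  have "matrep P (amul (mat_star_alg n A) x y) i j
      = (\<Sum>k<n. P (amul A (x (fst i) k) (y k (fst j))) (snd i) (snd j))"
    unfolding matrep_def mat_star_alg_def using x y ij by (auto simp: mats_def intro!: P_sum)
  also have "\<dots> = (\<Sum>k\<in>{..<n} \<times> I. matrep P x i k * matrep P y k j)"
    using x y ij by (auto simp: mats_def matrep_def sum_Times P_mul intro!: sum.cong)
  finally show "matrep P (amul (mat_star_alg n A) x y) i j
      = (\<Sum>k\<in>{..<n} \<times> I. matrep P x i k * matrep P y k j)" .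
next
  show "aone (mat_star_alg n A) \<in> acarr (mat_star_alg n A)"
    by (auto simp: mat_star_alg_def mats_def)
next
  fix x assume "x \<in> acarr (mat_star_alg n A)"
  then have x: "x \<in> mats n (acarr A)" by simp
  show "astar (mat_star_alg n A) x \<in> acarr (mat_star_alg n A)"
    using x by (auto simp: mat_star_alg_def mats_def)
  fix i j assume ij: "i \<in> {..<n} \<times> I" "j \<in> {..<n} \<times> I"
  show "matrep P (c *\<^sub>C x) i j = c * matrep P x i j" for c
    using x ij by (auto simp: matrep_def mats_def P_scale scaleC_fun_def)
  show "matrep P (astar (mat_star_alg n A) x) i j = cnj (matrep P x j i)"
    using x ij by (auto simp: matrep_def mats_def P_star mat_star_alg_def)
next
  fix i j assume ij: "i \<in> {..<n} \<times> I" "j \<in> {..<n} \<times> I"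
  then show "matrep P (aone (mat_star_alg n A)) i j = (if i = j then 1 else 0)"
    by (auto simp: matrep_def mat_star_alg_def P_one P_zero prod_eq_iff)
next
  fix x assume "x \<in> acarr (mat_star_alg n A)"
    and 0: "\<And>i j. i \<in> {..<n} \<times> I \<Longrightarrow> j \<in> {..<n} \<times> I \<Longrightarrow> matrep P x i j = 0"
  then have x: "x \<in> mats n (acarr A)" by simp
  have inner: "x i j = 0" if "i < n" "j < n" for i j
  proof (rule P_inj)
    fix p q assume "p \<in> I" "q \<in> I"
    then show "P (x i j) p q = 0" using 0[of "(i, p)" "(j, q)"] that by (simp add: matrep_def)
  qed (use x that in \<open>simp add: mats_def\<close>)
  show "x = 0"
  proof (intro ext)
    fix i j
    show "x i j = 0 i j" using inner[of i j] x by (cases "i < n \<and> j < n") (auto simp: mats_def)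
  qed
qed

text \<open>Resolves the \<open>THE\<close> in \<open>mat_alg\<close>: the operator norm of the
  amplified representation is a C*-norm, and uniqueness makes it the only candidate.\<close>

lemma mnorm_os_of:
  assumes "fd_space (acarr A)"
  shows "mnorm (os_of A) n = restr0 (mats n (acarr A)) (\<lambda>x. gnorm ({..<n} \<times> I) (matrep P x))"
proof -
  interpret M: star_rep "mat_star_alg n A" "{..<n} \<times> I" "matrep P" by (rule mat_star_rep)
  let ?N = "restr0 (mats n (acarr A)) (\<lambda>x. gnorm ({..<n} \<times> I) (matrep P x))"
  have fd: "fd_space (acarr (mat_star_alg n A))" using assms by (simp add: fd_space_mats)
  have "(THE N. is_cstar_norm (mat_star_alg n A) N \<and> (\<forall>x. x \<notin> mats n (acarr A) \<longrightarrow> N x = 0)) = ?N"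
  proof (rule the_equality, intro conjI)
    show "is_cstar_norm (mat_star_alg n A) ?N"
      by (rule M.cstar_norm_cong[OF _ M.cstar_norm[OF fd]]) (simp add: restr0_def)
    show "\<forall>x. x \<notin> mats n (acarr A) \<longrightarrow> ?N x = 0" by (simp add: restr0_def)
    fix N assume "is_cstar_norm (mat_star_alg n A) N \<and> (\<forall>x. x \<notin> mats n (acarr A) \<longrightarrow> N x = 0)"
    then show "N = ?N" using M.norm_eq[OF fd, of N] by (auto simp: restr0_def fun_eq_iff)
  qed
  then show ?thesis by (simp add: os_of_def mat_alg_def)
qed

lemma mnorm_mats:
  assumes "fd_space (acarr A)" "x \<in> mats n (acarr A)"
  shows "mnorm (os_of A) n x = gnorm ({..<n} \<times> I) (matrep P x)"
  using assms by (simp add: mnorm_os_of restr0_def)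

lemma vnorm_os_of:
  assumes "fd_space (acarr A)" "x \<in> acarr A"
  shows "vnorm (os_of A) x = gnorm I (P x)"
proof -
  have "bij_betw (\<lambda>i. (0::nat, i)) I ({..<1} \<times> I)"
    by (auto simp: bij_betw_def inj_on_def)
  from gnorm_reindex[OF this fin]
  have "gnorm ({..<1} \<times> I) (matrep P (single x)) = gnorm I (P x)"
    by (simp add: matrep_def single_def)
  then show ?thesis by (simp only: vnorm_def mnorm_mats[OF assms(1) single_in_mats[OF assms(2)]])
qed

text \<open>In the amplified representation a direct sum of matrices is block diagonal, and scalar
  matrices act as amplifications \<open>\<alpha> \<otimes> 1\<close> and
  \<open>\<beta> \<otimes> 1\<close>; completeness comes from finite dimension.\<close>

lemma fd_operator_space:
  assumes fd: "fd_space (acarr A)"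
  shows "fd_operator_space (os_of A)"
proof -
  note norm = mnorm_mats[OF fd]
  have nrm: "is_norm_on (mats n (acarr A)) (mnorm (os_of A) n)" for n
  proof -
    interpret M: star_rep "mat_star_alg n A" "{..<n} \<times> I" "matrep P" by (rule mat_star_rep)
    show ?thesis using M.norm_on by (simp add: is_norm_on_def norm
      cvs.subspace_scale[OF subspace_mats[OF subsp]] cvs.subspace_add[OF subspace_mats[OF subsp]])
  qed
  interpret M1: normed_subspace "mats 1 (acarr A)" "mnorm (os_of A) 1"
    using nrm subspace_mats[OF subsp] by unfold_locales
  have dsum: "mnorm (os_of A) (m + n) (dsum m n x y) = max (mnorm (os_of A) m x) (mnorm (os_of A) n y)"
    if x: "x \<in> mats m (acarr A)" and y: "y \<in> mats n (acarr A)" for m n x y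
  proof -
    let ?z = "matrep P (dsum m n x y)"
    have z: "dsum m n x y \<in> mats (m + n) (acarr A)"
      using x y cvs.subspace_0[OF subsp] by (auto simp: dsum_def mats_def)
    have I: "{..<m + n} \<times> I = {..<m} \<times> I \<union> {m..<m + n} \<times> I" by auto
    have "gnorm ({..<m + n} \<times> I) ?z = max (gnorm ({..<m} \<times> I) ?z) (gnorm ({m..<m + n} \<times> I) ?z)"
      unfolding I by (rule gnorm_block_diag) (use fin in \<open>auto simp: matrep_def dsum_def P_zero\<close>)
    moreover have "gnorm ({..<m} \<times> I) ?z = gnorm ({..<m} \<times> I) (matrep P x)"
      by (rule gnorm_cong) (auto simp: matrep_def dsum_def)
    moreover have "gnorm ({m..<m + n} \<times> I) ?z = gnorm ({..<n} \<times> I) (matrep P y)"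
    proof -
      have "bij_betw (\<lambda>(i, p). (m + i, p)) ({..<n} \<times> I) ({m..<m + n} \<times> I)"
        by (rule bij_betw_byWitness[where f' = "\<lambda>(i, p). (i - m, p)"]) auto
      from gnorm_reindex[OF this, of ?z] have "gnorm ({m..<m + n} \<times> I) ?z
        = gnorm ({..<n} \<times> I) (\<lambda>i j. ?z (case i of (i, p) \<Rightarrow> (m + i, p)) (case j of (i, p) \<Rightarrow> (m + i, p)))"
        using fin by simp
      also have "\<dots> = gnorm ({..<n} \<times> I) (matrep P y)"
        by (rule gnorm_cong) (auto simp: matrep_def dsum_def)
      finally show ?thesis .
    qed
    ultimately show ?thesis using x y z by (simp add: norm)
  qed
  have bimult: "mnorm (os_of A) m (scalar_bimult m \<alpha> x \<beta>) \<le> opnorm m \<alpha> * mnorm (os_of A) m x * opnorm m \<beta>"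
    if x: "x \<in> mats m (acarr A)" and ab: "\<alpha> \<in> mats m UNIV" "\<beta> \<in> mats m UNIV" for m x \<alpha> \<beta>
  proof -
    have z: "scalar_bimult m \<alpha> x \<beta> \<in> mats m (acarr A)"
      using x ab by (auto simp: scalar_bimult_def mats_def intro!: cvs.subspace_sum subsp cvs.subspace_scale)
    have "gnorm ({..<m} \<times> I) (matrep P (scalar_bimult m \<alpha> x \<beta>))
      = gnorm ({..<m} \<times> I) (\<lambda>p q. \<Sum>k<m. \<Sum>l<m. (\<alpha> (fst p) k * \<beta> l (fst q)) * matrep P x (k, snd p) (l, snd q))"
    proof (rule gnorm_cong)
      fix p q assume pq: "p \<in> {..<m} \<times> I" "q \<in> {..<m} \<times> I"
      have c: "(\<alpha> (fst p) k * \<beta> l (fst q)) *\<^sub>C x k l \<in> acarr A" if "k < m" "l < m" for k l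
        using x that by (auto simp: mats_def intro: cvs.subspace_scale subsp)
      have "matrep P (scalar_bimult m \<alpha> x \<beta>) p q
          = (\<Sum>k<m. \<Sum>l<m. P ((\<alpha> (fst p) k * \<beta> l (fst q)) *\<^sub>C x k l) (snd p) (snd q))"
        unfolding matrep_def scalar_bimult_def
        using pq c by (subst P_sum, force intro!: cvs.subspace_sum subsp, force, force)
          (intro sum.cong refl P_sum, auto)
      also have "\<dots> = (\<Sum>k<m. \<Sum>l<m. (\<alpha> (fst p) k * \<beta> l (fst q)) * matrep P x (k, snd p) (l, snd q))"
        using pq x by (intro sum.cong refl) (auto simp: matrep_def P_scale mats_def)
      finally show "matrep P (scalar_bimult m \<alpha> x \<beta>) p q
        = (\<Sum>k<m. \<Sum>l<m. (\<alpha> (fst p) k * \<beta> l (fst q)) * matrep P x (k, snd p) (l, snd q))" .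
    qed
    also have "\<dots> \<le> gnorm {..<m} \<alpha> * gnorm ({..<m} \<times> I) (matrep P x) * gnorm {..<m} \<beta>"
      by (rule gnorm_bimult) (use fin in auto)
    finally show ?thesis using x z by (simp add: norm opnorm_eq_gnorm)
  qed
  show ?thesis
    unfolding fd_operator_space_def operator_space_def carr_os_of
    using fd subsp nrm M1.complete[OF fd_space_mats[OF fd]] dsum bimult
    by (auto simp: mnorm_os_of[OF fd] restr0_def)
qed

end

lemma fd_vn_algebraI:
  assumes "star_rep A I P" "fd_space (acarr A)" "\<And>x. x \<in> acarr A \<Longrightarrow> anorm A x = gnorm I (P x)"
  shows "fd_vn_algebra A"
proof -
  interpret star_rep A I P by fact
  show ?thesis
    unfolding fd_vn_algebra_def
    using unital_star_algebra assms(2) cstar_norm_cong[OF _ cstar_norm[OF assms(2)], of "anorm A"] assms(3)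
    by simp
qed

section \<open>The algebras \<open>\<complex>\<close>, \<open>0\<close> and \<open>A \<oplus> B\<close>\<close>

lemma star_rep_complex: "star_rep complex_alg {()} (\<lambda>z _ _. z)"
  by unfold_locales (auto simp: complex_alg_def cvs.subspace_UNIV)

lemma fd_space_complex: "fd_space (UNIV :: complex set)"
proof (rule fd_spaceI)
  show "(UNIV :: complex set) \<subseteq> cvs.span {1}"
  proof
    fix z :: complex
    have "z *\<^sub>C 1 \<in> cvs.span {1 :: complex}" by (intro cvs.span_scale cvs.span_base) simp
    then show "z \<in> cvs.span {1}" by simp
  qed
qed auto

lemma gnorm_singleton: "gnorm {i} a = cmod (a i i)"
proof (rule antisym)
  show "cmod (a i i) \<le> gnorm {i} a" by (rule gnorm_entry) auto
  show "gnorm {i} a \<le> cmod (a i i)"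
    by (rule gnorm_le) (simp_all add: bil_def norm_mult l2_def L2_set_def mult_ac)
qed

lemma fd_vn_complex: "fd_vn_algebra complex_alg"
  by (rule fd_vn_algebraI[OF star_rep_complex])
    (simp_all add: complex_alg_def fd_space_complex gnorm_singleton)

lemma os_of_complex: "os_of complex_alg = complex_os"
proof -
  interpret star_rep complex_alg "{()}" "\<lambda>z _ _. z" by (rule star_rep_complex)
  have ac: "acarr complex_alg = UNIV" by (simp add: complex_alg_def)
  have "gnorm ({..<n} \<times> {()}) (matrep (\<lambda>z _ _. z) x) = opnorm n x" for n x
  proof -
    have "bij_betw (\<lambda>i. (i, ())) {..<n} ({..<n} \<times> {()})" by (auto simp: bij_betw_def inj_on_def)
    from gnorm_reindex[OF this] show ?thesis by (simp add: matrep_def opnorm_eq_gnorm)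
  qed
  then have "mnorm (os_of complex_alg) = mnorm complex_os"
    by (simp add: fun_eq_iff mnorm_os_of ac fd_space_complex complex_os_def restr0_def)
  then show ?thesis by (simp add: os_of_def complex_os_def ac)
qed

lemma gnorm_empty [simp]: "gnorm {} a = 0"
  by (rule gnorm_0) auto

text \<open>The zero algebra acts on the zero space, whose identity is 0; hence the empty index
  set.\<close>

lemma star_rep_zero: "star_rep zero_alg {} P"
  by unfold_locales (auto simp: zero_alg_def)

lemma fd_space_zero: "fd_space {0}"
  by (rule fd_spaceI[of _ "{}"]) auto

lemma fd_vn_zero: "fd_vn_algebra zero_alg"
  by (rule fd_vn_algebraI[OF star_rep_zero[of "\<lambda>_ (_ :: unit) _. 0"]])
    (simp_all add: zero_alg_def fd_space_zero)

lemma os_of_zero: "os_of (zero_alg :: 'a::complex_vector cstar) = zero_os"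
proof -
  interpret star_rep "zero_alg :: 'a cstar" "{} :: unit set" "\<lambda>_ _ _. 0" by (rule star_rep_zero)
  have "acarr (zero_alg :: 'a cstar) = {0}" by (simp add: zero_alg_def)
  then have "mnorm (os_of (zero_alg :: 'a cstar)) = mnorm zero_os"
    by (simp add: fun_eq_iff mnorm_os_of fd_space_zero zero_os_def restr0_def)
  then show ?thesis by (simp add: os_of_def zero_os_def zero_alg_def)
qed

definition prodrep ::
  "('a \<Rightarrow> 'i \<Rightarrow> 'i \<Rightarrow> complex) \<Rightarrow> ('b \<Rightarrow> 'j \<Rightarrow> 'j \<Rightarrow> complex) \<Rightarrow> 'a \<times> 'b \<Rightarrow> 'i + 'j \<Rightarrow> 'i + 'j \<Rightarrow> complex" where
  "prodrep P Q z x y = (case x of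
     Inl i \<Rightarrow> (case y of Inl j \<Rightarrow> P (fst z) i j | Inr _ \<Rightarrow> 0)
   | Inr i \<Rightarrow> (case y of Inl _ \<Rightarrow> 0 | Inr j \<Rightarrow> Q (snd z) i j))"

lemma star_rep_prod:
  assumes "star_rep A I P" "star_rep B J Q"
  shows "star_rep (alg_prod A B) (I <+> J) (prodrep P Q)"
proof -
  interpret A: star_rep A I P by fact
  interpret B: star_rep B J Q by fact
  show ?thesis
  proof
    show "cvs.subspace (acarr (alg_prod A B))"
      by (simp add: alg_prod_def subspace_Times A.subsp B.subsp)
  next
    fix x y i j assume "x \<in> acarr (alg_prod A B)" "y \<in> acarr (alg_prod A B)" "i \<in> I <+> J" "j \<in> I <+> J"
    then show "prodrep P Q (x + y) i j = prodrep P Q x i j + prodrep P Q y i j"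
      by (auto simp: alg_prod_def prodrep_def A.P_add B.P_add)
  next
    fix c x i j assume "x \<in> acarr (alg_prod A B)" "i \<in> I <+> J" "j \<in> I <+> J"
    then show "prodrep P Q (c *\<^sub>C x) i j = c * prodrep P Q x i j"
      by (auto simp: alg_prod_def prodrep_def A.P_scale B.P_scale scaleC_prod_def)
  next
    fix x y i j assume "x \<in> acarr (alg_prod A B)" "y \<in> acarr (alg_prod A B)" "i \<in> I <+> J" "j \<in> I <+> J"
    then show "prodrep P Q (amul (alg_prod A B) x y) i j = (\<Sum>k\<in>I <+> J. prodrep P Q x i k * prodrep P Q y k j)"
      by (auto simp: alg_prod_def prodrep_def A.P_mul B.P_mul sum.Plus A.fin B.fin)
  next
    fix x i j assume "x \<in> acarr (alg_prod A B)" "i \<in> I <+> J" "j \<in> I <+> J"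
    then show "prodrep P Q (astar (alg_prod A B) x) i j = cnj (prodrep P Q x j i)"
      by (auto simp: alg_prod_def prodrep_def A.P_star B.P_star)
  next
    fix i j assume "i \<in> I <+> J" "j \<in> I <+> J"
    then show "prodrep P Q (aone (alg_prod A B)) i j = (if i = j then 1 else 0)"
      by (auto simp: alg_prod_def prodrep_def A.P_one B.P_one split: if_splits)
  next
    fix x assume x: "x \<in> acarr (alg_prod A B)"
      and 0: "\<And>i j. i \<in> I <+> J \<Longrightarrow> j \<in> I <+> J \<Longrightarrow> prodrep P Q x i j = 0"
    have "fst x = 0"
    proof (rule A.P_inj)
      fix i j assume "i \<in> I" "j \<in> I"
      then show "P (fst x) i j = 0" using 0[of "Inl i" "Inl j"] by (simp add: prodrep_def InlI)
    qed (use x in \<open>auto simp: alg_prod_def\<close>)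
    moreover have "snd x = 0"
    proof (rule B.P_inj)
      fix i j assume "i \<in> J" "j \<in> J"
      then show "Q (snd x) i j = 0" using 0[of "Inr i" "Inr j"] by (simp add: prodrep_def InrI)
    qed (use x in \<open>auto simp: alg_prod_def\<close>)
    ultimately show "x = 0" by (simp add: prod_eq_iff)
  qed (auto simp: alg_prod_def A.fin B.fin)
qed

text \<open>The extra index set \<open>K\<close> covers all matrix levels at once; a singleton
  \<open>K\<close> gives the norm of the product itself.\<close>

lemma gnorm_prodrep:
  assumes "finite K" "finite I" "finite J"
  shows "gnorm (K \<times> (I <+> J)) (\<lambda>p q. prodrep P Q (z (fst p) (fst q)) (snd p) (snd q))
    = max (gnorm (K \<times> I) (\<lambda>p q. P (fst (z (fst p) (fst q))) (snd p) (snd q)))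
          (gnorm (K \<times> J) (\<lambda>p q. Q (snd (z (fst p) (fst q))) (snd p) (snd q)))"
    (is "gnorm _ ?m = max ?l ?r")
proof -
  have K: "K \<times> (I <+> J) = K \<times> Inl ` I \<union> K \<times> Inr ` J" by auto
  have "gnorm (K \<times> (I <+> J)) ?m = max (gnorm (K \<times> Inl ` I) ?m) (gnorm (K \<times> Inr ` J) ?m)"
    unfolding K by (rule gnorm_block_diag) (use assms in \<open>auto simp: prodrep_def\<close>)
  moreover have "gnorm (K \<times> Inl ` I) ?m = ?l"
  proof -
    have "bij_betw (map_prod id Inl) (K \<times> I) (K \<times> Inl ` I)"
      by (rule bij_betw_byWitness[where f' = "map_prod id projl"]) auto
    from gnorm_reindex[OF this, of ?m] show ?thesis using assms by (simp add: prodrep_def)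
  qed
  moreover have "gnorm (K \<times> Inr ` J) ?m = ?r"
  proof -
    have "bij_betw (map_prod id Inr) (K \<times> J) (K \<times> Inr ` J)"
      by (rule bij_betw_byWitness[where f' = "map_prod id projr"]) auto
    from gnorm_reindex[OF this, of ?m] show ?thesis using assms by (simp add: prodrep_def)
  qed
  ultimately show ?thesis by simp
qed

lemma gnorm_unit_Times:
  assumes "finite K"
  shows "gnorm ({()} \<times> K) (\<lambda>p q. f (snd p) (snd q)) = gnorm K f"
proof -
  have "bij_betw (Pair ()) K ({()} \<times> K)" by (auto simp: bij_betw_def inj_on_def)
  from gnorm_reindex[OF this assms] show ?thesis by simp
qed

text \<open>The norms are operator norms by uniqueness, and the norm of a block diagonal matrix is
  the maximum over its blocks.\<close>

lemma alg_prod_facts: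
  assumes "star_rep A I P" "star_rep B J Q" "fd_vn_algebra A" "fd_vn_algebra B"
  shows fd_vn_prod: "fd_vn_algebra (alg_prod A B)"
    and os_of_prod: "os_of (alg_prod A B) = os_of A \<oplus>\<^sub>\<infinity> os_of B"
proof -
  interpret A: star_rep A I P by fact
  interpret B: star_rep B J Q by fact
  interpret C: star_rep "alg_prod A B" "I <+> J" "prodrep P Q" by (rule star_rep_prod[OF assms(1,2)])
  have fA: "fd_space (acarr A)" "is_cstar_norm A (anorm A)"
    and fB: "fd_space (acarr B)" "is_cstar_norm B (anorm B)"
    using assms by (auto simp: fd_vn_algebra_def)
  have ac: "acarr (alg_prod A B) = acarr A \<times> acarr B" by (simp add: alg_prod_def)
  then have fC: "fd_space (acarr (alg_prod A B))" using fA fB by (simp add: fd_space_Times)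
  have unit_prod: "gnorm (I <+> J) (prodrep P Q z) = max (gnorm I (P (fst z))) (gnorm J (Q (snd z)))" for z
    using gnorm_prodrep[of "{()}" I J P Q "\<lambda>_ _. z"] A.fin B.fin by (simp add: gnorm_unit_Times)
  show "fd_vn_algebra (alg_prod A B)"
  proof (rule fd_vn_algebraI[OF C.star_rep_axioms fC])
    fix z assume "z \<in> acarr (alg_prod A B)"
    then show "anorm (alg_prod A B) z = gnorm (I <+> J) (prodrep P Q z)"
      using A.norm_eq[OF fA] B.norm_eq[OF fB] by (auto simp: ac unit_prod) (simp add: alg_prod_def)
  qed
  have "mnorm (os_of (alg_prod A B)) n z = mnorm (os_of A \<oplus>\<^sub>\<infinity> os_of B) n z" for n z
  proof (cases "z \<in> mats n (acarr A \<times> acarr B)")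
    case True
    then have "amp fst z \<in> mats n (acarr A)" "amp snd z \<in> mats n (acarr B)"
      by (auto simp: mats_def amp_def mem_Times_iff)
    then show ?thesis using True
      using gnorm_prodrep[of "{..<n}" I J P Q z] A.fin B.fin
      by (simp add: C.mnorm_os_of[OF fC] A.mnorm_mats[OF fA(1)] B.mnorm_mats[OF fB(1)] sum_os_def restr0_def ac
          matrep_def amp_def)
  qed (simp add: C.mnorm_os_of[OF fC] sum_os_def restr0_def ac)
  then have "mnorm (os_of (alg_prod A B)) = mnorm (os_of A \<oplus>\<^sub>\<infinity> os_of B)" by (simp add: fun_eq_iff)
  then show "os_of (alg_prod A B) = os_of A \<oplus>\<^sub>\<infinity> os_of B" by (simp add: os_of_def sum_os_def ac)
qed

section \<open>Faithful representation of a finite-dimensional C*-algebra\<close>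

lemma strictly_upper_triangular_pow:
  fixes B :: "complex mat"
  assumes B: "B \<in> carrier_mat n n" and up: "\<And>i j. i < n \<Longrightarrow> j < n \<Longrightarrow> j \<le> i \<Longrightarrow> B $$ (i, j) = 0"
  shows "i < n \<Longrightarrow> j < n \<Longrightarrow> j < i + k \<Longrightarrow> (B ^\<^sub>m k) $$ (i, j) = 0"
proof (induction k arbitrary: i j)
  case 0
  then show ?case using B by simp
next
  case (Suc k)
  have Bk: "B ^\<^sub>m k \<in> carrier_mat n n" using B by simp
  have "(B ^\<^sub>m Suc k) $$ (i, j) = (\<Sum>l<n. (B ^\<^sub>m k) $$ (i, l) * B $$ (l, j))"
    using Suc.prems B Bk by (simp add: scalar_prod_def atLeast0LessThan)
  also have "\<dots> = 0"
  proof (rule sum.neutral, rule ballI)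
    fix l assume "l \<in> {..<n}"
    \<comment> \<open>If \<open>l < i + k\<close> the power vanishes by induction; otherwise
      \<open>j \<le> i + k \<le> l\<close>, so the entry of \<open>B\<close> is on or below the
      diagonal.\<close>
    then show "(B ^\<^sub>m k) $$ (i, l) * B $$ (l, j) = 0"
      using Suc.IH[of i l] Suc.prems up[of l j] by (cases "l < i + k") auto
  qed
  finally show ?case .
qed

text \<open>Schur triangularization makes the trace of the square the sum of the squared
  eigenvalues, all real by hypothesis. If it is 0 then all eigenvalues vanish and the matrix is
  nilpotent. Nilpotency is phrased by iterating a map on coefficient vectors, which is the form in
  which left multiplication supplies it.\<close>

lemma trace_square_real_spectrum:
  fixes m :: "nat \<Rightarrow> nat \<Rightarrow> complex"
  assumes real: "\<And>l v. \<exists>i<n. v i \<noteq> 0 \<Longrightarrow> (\<And>i. i < n \<Longrightarrow> (\<Sum>j<n. m i j * v j) = l * v i) \<Longrightarrow> Im l = 0"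
  shows "\<exists>r\<ge>0. (\<Sum>i<n. \<Sum>j<n. m i j * m j i) = complex_of_real r \<and>
    (r = 0 \<longrightarrow> (\<exists>k. \<forall>v. \<forall>i<n. ((\<lambda>v i. \<Sum>j<n. m i j * v j) ^^ k) v i = 0))"
proof -
  define A where "A = mat n n (\<lambda>(i, j). m i j)"
  have A: "A \<in> carrier_mat n n" by (simp add: A_def)
  obtain as where as: "char_poly A = (\<Prod>a\<leftarrow>as. [:- a, 1:])"
    using char_poly_factorized[OF A] by blast
  obtain B where B: "B \<in> carrier_mat n n" and ut: "upper_triangular B" and sim: "similar_mat A B"
    using schur_decomposition_exists[OF A as] by blast
  obtain P Q where wit: "similar_mat_wit A B P Q" using sim by (auto simp: similar_mat_def)
  have n: "n = dim_row A" using A by simp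
  note w = similar_mat_witD[OF n wit]
  have diag_real: "Im (B $$ (i, i)) = 0" if i: "i < n" for i
  proof -
    let ?l = "B $$ (i, i)"
    have "?l \<in> set (diag_mat B)" using i B by (auto simp: diag_mat_def)
    then have "poly (char_poly B) ?l = 0"
      unfolding char_poly_upper_triangular[OF B ut] by (force simp: poly_prod_list prod_list_zero_iff)
    then have "eigenvalue A ?l"
      by (simp add: eigenvalue_root_char_poly[OF A] char_poly_similar[OF sim])
    then obtain v where v: "v \<in> carrier_vec n" "v \<noteq> 0\<^sub>v n" "A *\<^sub>v v = ?l \<cdot>\<^sub>v v"
      using A by (auto simp: eigenvalue_def eigenvector_def)
    show ?thesis
    proof (rule real[of "\<lambda>i. v $ i"])
      show "\<exists>i<n. v $ i \<noteq> 0" using v by (metis carrier_vecD eq_vecI index_zero_vec)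
      fix i assume "i < n"
      then have "(A *\<^sub>v v) $ i = (\<Sum>j<n. m i j * v $ j)"
        using v(1) by (simp add: scalar_prod_def A_def atLeast0LessThan)
      moreover have "(A *\<^sub>v v) $ i = ?l * v $ i" unfolding v(3) using v(1) \<open>i < n\<close> by simp
      ultimately show "(\<Sum>j<n. m i j * v $ j) = ?l * v $ i" by simp
    qed
  qed
  define tr where "tr X = (\<Sum>i<n. X $$ (i, i))" for X :: "complex mat"
  have tr_mult: "tr (X * Y) = (\<Sum>i<n. \<Sum>j<n. X $$ (i, j) * Y $$ (j, i))"
    if "X \<in> carrier_mat n n" "Y \<in> carrier_mat n n" for X Y
    using that by (simp add: tr_def scalar_prod_def atLeast0LessThan)
  have tr_comm: "tr (X * Y) = tr (Y * X)"
    if "X \<in> carrier_mat n n" "Y \<in> carrier_mat n n" for X Y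
    unfolding tr_mult[OF that] tr_mult[OF that(2,1)] by (subst sum.swap) (simp add: mult.commute)
  have cancel: "Q * (P * X) = X" if "X \<in> carrier_mat n n" for X
    using that w(2,6,7) by (simp flip: assoc_mult_mat[of Q n n P n X n])
  have "(\<Sum>i<n. \<Sum>j<n. m i j * m j i) = tr (A * A)"
    using tr_mult[OF A A] by (simp add: A_def)
  also have "A * A = P * ((B * B) * Q)"
    using w(5-7) unfolding w(3) by (simp add: cancel assoc_mult_mat[of _ n n _ n _ n])
  also have "tr (P * ((B * B) * Q)) = tr (((B * B) * Q) * P)"
    using w(5-7) by (intro tr_comm) auto
  also have "((B * B) * Q) * P = B * B"
    using w(2,5-7) by (simp add: assoc_mult_mat[of _ n n _ n _ n])
  also have "tr (B * B) = (\<Sum>i<n. (B $$ (i, i))\<^sup>2)"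
    unfolding tr_mult[OF B B]
  proof (rule sum.cong[OF refl])
    fix i assume i: "i \<in> {..<n}"
    have "(\<Sum>j<n. B $$ (i, j) * B $$ (j, i)) = (\<Sum>j<n. if j = i then (B $$ (i, i))\<^sup>2 else 0)"
    proof (rule sum.cong[OF refl])
      fix j assume j: "j \<in> {..<n}"
      \<comment> \<open>For distinct indices one of the two entries lies below the diagonal, so only
        the squares on the diagonal survive.\<close>
      have "B $$ (i, j) = 0 \<or> B $$ (j, i) = 0" if "j \<noteq> i"
        using that i j B ut upper_triangularD[of B] by (cases "i < j") auto
      then show "B $$ (i, j) * B $$ (j, i) = (if j = i then (B $$ (i, i))\<^sup>2 else 0)"
        by (auto simp: power2_eq_square)
    qed
    then show "(\<Sum>j<n. B $$ (i, j) * B $$ (j, i)) = (B $$ (i, i))\<^sup>2" using i by (simp add: sum.delta)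
  qed
  also have "\<dots> = complex_of_real (\<Sum>i<n. (Re (B $$ (i, i)))\<^sup>2)"
    unfolding of_real_sum using diag_real by (intro sum.cong refl) (simp add: complex_eq_iff power2_eq_square)
  finally have tr: "(\<Sum>i<n. \<Sum>j<n. m i j * m j i) = complex_of_real (\<Sum>i<n. (Re (B $$ (i, i)))\<^sup>2)" .
  have nilp: "\<exists>k. \<forall>v. \<forall>i<n. ((\<lambda>v i. \<Sum>j<n. m i j * v j) ^^ k) v i = 0"
    if "(\<Sum>i<n. (Re (B $$ (i, i)))\<^sup>2) = 0"
  proof -
    have d0: "B $$ (i, i) = 0" if "i < n" for i
      using that \<open>_ = 0\<close> diag_real[OF that] by (simp add: sum_nonneg_eq_0_iff complex_eq_iff)
    have B0: "B $$ (i, j) = 0" if "i < n" "j < n" "j \<le> i" for i j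
      using that d0 ut B upper_triangularD[of B j i] by (cases "j = i") auto
    have "B ^\<^sub>m n = 0\<^sub>m n n"
      by (rule eq_matI) (use B strictly_upper_triangular_pow[OF B B0, of _ _ n] in auto)
    then have An: "A ^\<^sub>m n = 0\<^sub>m n n"
      using similar_mat_wit_pow_id[OF wit, of n] w by simp
    \<comment> \<open>Translates matrix powers back into iterates of the coefficient map.\<close>
    have it: "((\<lambda>v i. \<Sum>j<n. m i j * v j) ^^ k) v i = ((A ^\<^sub>m k) *\<^sub>v vec n v) $ i" if "i < n" for k v i
      using that
    proof (induction k arbitrary: v)
      case 0
      then show ?case using A by simp
    next
      case (Suc k)
      let ?f = "\<lambda>v i. \<Sum>j<n. m i j * v j"
      have "(?f ^^ Suc k) v i = (?f ^^ k) (?f v) i" by (simp only: funpow_Suc_right o_apply)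
      also have "\<dots> = ((A ^\<^sub>m k) *\<^sub>v vec n (?f v)) $ i" by (rule Suc.IH[OF Suc.prems])
      also have "vec n (?f v) = A *\<^sub>v vec n v"
        by (rule eq_vecI) (auto simp: A_def scalar_prod_def atLeast0LessThan)
      also have "(A ^\<^sub>m k) *\<^sub>v (A *\<^sub>v vec n v) = (A ^\<^sub>m Suc k) *\<^sub>v vec n v"
        using A by (simp add: assoc_mult_mat_vec[of _ n n _ n])
      finally show ?case .
    qed
    show ?thesis by (rule exI[of _ n]) (simp add: it An)
  qed
  show ?thesis
    using tr nilp by (intro exI[of _ "\<Sum>i<n. (Re (B $$ (i, i)))\<^sup>2"] conjI sum_nonneg) auto
qed

text \<open>The next vector \<open>b\<close> either equals its projection \<open>s\<close> onto the
  span found so far, or contributes the normalised difference \<open>b - s\<close>.\<close>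

lemma gram_schmidt:
  fixes ip :: "'a::complex_vector \<Rightarrow> 'a \<Rightarrow> complex"
  assumes V: "cvs.subspace V"
    and add: "\<And>x y z. x \<in> V \<Longrightarrow> y \<in> V \<Longrightarrow> z \<in> V \<Longrightarrow> ip x (y + z) = ip x y + ip x z"
    and scale: "\<And>c x y. x \<in> V \<Longrightarrow> y \<in> V \<Longrightarrow> ip x (c *\<^sub>C y) = c * ip x y"
    and herm: "\<And>x y. x \<in> V \<Longrightarrow> y \<in> V \<Longrightarrow> ip x y = cnj (ip y x)"
    and pos: "\<And>x. x \<in> V \<Longrightarrow> x \<noteq> 0 \<Longrightarrow> \<exists>r>0. ip x x = complex_of_real r"
    and B: "finite B" "B \<subseteq> V"
  shows "\<exists>F. finite F \<and> F \<subseteq> V \<and> B \<subseteq> cvs.span F \<and> (\<forall>e\<in>F. \<forall>f\<in>F. ip e f = (if e = f then 1 else 0))"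
  using B
proof (induction B rule: finite_induct)
  case (insert b B)
  then obtain F where F: "finite F" "F \<subseteq> V" "B \<subseteq> cvs.span F"
    and on: "\<And>e f. e \<in> F \<Longrightarrow> f \<in> F \<Longrightarrow> ip e f = (if e = f then 1 else 0)" by auto
  have b: "b \<in> V" using insert.prems by simp
  define s where "s = (\<Sum>f\<in>F. ip f b *\<^sub>C f)"
  have sV: "s \<in> V" unfolding s_def using F by (intro cvs.subspace_sum V cvs.subspace_scale) auto
  have sF: "s \<in> cvs.span F" unfolding s_def by (intro cvs.span_sum cvs.span_scale cvs.span_base)
  have bs: "b - s \<in> V" by (intro cvs.subspace_diff V b sV)
  have orth: "ip e (b - s) = 0" if e: "e \<in> F" for e
  proof -
    have eV: "e \<in> V" using e F by blast
    have "ip e s = (\<Sum>f\<in>F. ip e (ip f b *\<^sub>C f))"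
      unfolding s_def using F eV by (intro sum_additive_on[OF V]) (auto simp: add intro: cvs.subspace_scale V)
    also have "\<dots> = (\<Sum>f\<in>F. if f = e then ip f b else 0)"
      using F eV e by (intro sum.cong refl) (auto simp: scale on subset_iff)
    also have "\<dots> = ip e b" using F e by (simp add: sum.delta)
    finally have "ip e b = ip e (b - s) + ip e b" using add[OF eV bs sV] by simp
    then show ?thesis by simp
  qed
  show ?case
  proof (cases "b = s")
    case True
    then show ?thesis using F on sF by (intro exI[of _ F]) auto
  next
    case False
    then obtain r where r: "r > 0" "ip (b - s) (b - s) = complex_of_real r" using pos[OF bs] by auto
    define u where "u = complex_of_real (1 / sqrt r) *\<^sub>C (b - s)"
    have uV: "u \<in> V" unfolding u_def by (intro cvs.subspace_scale V bs)
    have orthu: "ip e u = 0" if "e \<in> F" for e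
      unfolding u_def using orth[OF that] that F bs by (subst scale) auto
    have "ip (b - s) u = complex_of_real (1 / sqrt r) * r" unfolding u_def using bs r by (subst scale) auto
    then have "ip u (b - s) = complex_of_real (1 / sqrt r) * r" using herm[OF uV bs] by simp
    then have "ip u u = complex_of_real (1 / sqrt r) * (complex_of_real (1 / sqrt r) * r)"
      using scale[OF uV bs, of "complex_of_real (1 / sqrt r)"] by (simp add: u_def)
    also have "\<dots> = complex_of_real ((1 / sqrt r) * ((1 / sqrt r) * r))"
      by (simp only: of_real_mult)
    also have "(1 / sqrt r) * ((1 / sqrt r) * r) = 1" using r by (simp add: field_simps)
    finally have uu: "ip u u = 1" by simp
    have "u \<notin> F" using orthu[of u] uu by auto
    have ue: "ip u e = 0" if "e \<in> F" for e
      using herm[OF uV, of e] orthu[OF that] that F by auto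
    have "sqrt r * (1 / sqrt r) = 1" using r by simp
    then have "complex_of_real (sqrt r) * complex_of_real (1 / sqrt r) = 1"
      by (metis of_real_1 of_real_mult)
    then have "complex_of_real (sqrt r) *\<^sub>C u = b - s"
      by (simp only: u_def scaleC_scaleC scaleC_one)
    then have "b = complex_of_real (sqrt r) *\<^sub>C u + s" by simp
    moreover have "s \<in> cvs.span (insert u F)" using sF cvs.span_mono[OF subset_insertI] by blast
    then have "complex_of_real (sqrt r) *\<^sub>C u + s \<in> cvs.span (insert u F)"
      by (rule cvs.span_add[OF cvs.span_scale[OF cvs.span_base], rotated]) simp
    ultimately have "b \<in> cvs.span (insert u F)" by simp
    moreover have "B \<subseteq> cvs.span (insert u F)" using F(3) cvs.span_mono[of F "insert u F"] by blast
    ultimately show ?thesis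
      using F uV on uu ue orthu \<open>u \<notin> F\<close> by (intro exI[of _ "insert u F"]) auto
  qed
qed auto

section \<open>The trace of left multiplication and the inner product it defines\<close>

context cstar_alg
begin

text \<open>For hermitian \<open>h\<close> the cross terms cancel and the C*-identity leaves the
  norm of h^2 + t^2. That the bound grows only like t^2 is exploited by letting \<open>t\<close> be
  large.\<close>

lemma norm_add_imaginary:
  assumes "h \<in> acarr A" "astar A h = h"
  shows "(N (h + (\<i> * complex_of_real t) *\<^sub>C aone A))\<^sup>2 \<le> (N h)\<^sup>2 + t\<^sup>2"
proof -
  let ?c = "\<i> * complex_of_real t"
  have "amul A (astar A (h + ?c *\<^sub>C aone A)) (h + ?c *\<^sub>C aone A)
      = amul A h h + (complex_of_real (t\<^sup>2)) *\<^sub>C aone A"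
    using assms
    by (simp add: star_add star_scale mul_add_left mul_add_right mul_diff_left mul_scale_left mul_scale_right
        scaleC_scaleC cvs.scale_minus_left power2_eq_square algebra_simps)
  then have "(N (h + ?c *\<^sub>C aone A))\<^sup>2 = N (amul A h h + (complex_of_real (t\<^sup>2)) *\<^sub>C aone A)"
    using assms by (metis cstar add_closed scale_closed one_closed)
  also have "\<dots> \<le> N (amul A h h) + t\<^sup>2 * N (aone A)"
    using triangle[of "amul A h h" "complex_of_real (t\<^sup>2) *\<^sub>C aone A"] assms by (simp add: scale norm_power)
  also have "\<dots> \<le> (N h)\<^sup>2 + t\<^sup>2"
    using cstar[of h] assms norm_one_le by (simp add: mult_left_le)
  finally show ?thesis .
qed

text \<open>An eigenvalue of left multiplication by \<open>h + it\<close> is at most its norm in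
  modulus. An imaginary part of \<open>l\<close> would make the left side grow linearly in
  \<open>t\<close> beyond the bound of \<open>norm_add_imaginary\<close>.\<close>

lemma hermitian_eigenvalue_real:
  assumes h: "h \<in> acarr A" "astar A h = h" and y: "y \<in> acarr A" "y \<noteq> 0" "amul A h y = l *\<^sub>C y"
  shows "Im l = 0"
proof (rule ccontr)
  assume l: "Im l \<noteq> 0"
  \<comment> \<open>Chosen so that the linear term \<open>2 * t * Im l\<close> equals
    \<open>(N h)\<^sup>2 + 1\<close>, one more than the bound permits.\<close>
  define t where "t = ((N h)\<^sup>2 + 1) / (2 * Im l)"
  let ?c = "\<i> * complex_of_real t"
  have Ny: "N y > 0" using y nonneg[of y] eq_0_iff[of y] by (simp add: less_le)
  have "amul A (h + ?c *\<^sub>C aone A) y = (l + ?c) *\<^sub>C y"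
    using h y by (simp add: mul_add_left mul_scale_left scaleC_add_left)
  then have "cmod (l + ?c) * N y \<le> N (h + ?c *\<^sub>C aone A) * N y"
    using submult[of "h + ?c *\<^sub>C aone A" y] h y by (simp add: scale)
  then have "(cmod (l + ?c))\<^sup>2 \<le> (N (h + ?c *\<^sub>C aone A))\<^sup>2"
    using Ny by (intro power_mono) auto
  also have "\<dots> \<le> (N h)\<^sup>2 + t\<^sup>2" by (rule norm_add_imaginary[OF h])
  finally have "(Re l)\<^sup>2 + (Im l + t)\<^sup>2 \<le> (N h)\<^sup>2 + t\<^sup>2" by (simp add: cmod_power2)
  moreover have "2 * t * Im l = (N h)\<^sup>2 + 1" using l by (simp add: t_def field_simps)
  ultimately have "(Re l)\<^sup>2 + (Im l)\<^sup>2 + 1 \<le> 0" by (simp add: power2_eq_square algebra_simps)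
  then show False using zero_le_power2[of "Re l"] zero_le_power2[of "Im l"] by linarith
qed

text \<open>A vanishing power of \<open>h\<close> makes the power with exponent 2^k vanish, since
  \<open>k \<le> 2 ^ k\<close>; its norm is a power of \<open>N h\<close>.\<close>

lemma hermitian_nilpotent:
  assumes h: "h \<in> acarr A" "astar A h = h" and 0: "((amul A h) ^^ k) (aone A) = 0"
  shows "h = 0"
proof -
  let ?p = "\<lambda>n. ((amul A h) ^^ n) (aone A)"
  have p [simp]: "?p n \<in> acarr A" for n by (induction n) (use h in auto)
  have padd: "?p (a + b) = amul A (?p a) (?p b)" for a b
    by (induction a) (use h in \<open>simp_all add: mul_assoc\<close>)
  have sq: "((\<lambda>x. amul A x x) ^^ n) h = ?p (2 ^ n)" for n
  proof (induction n)
    case (Suc n)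
    then show ?case using padd[of "2 ^ n" "2 ^ n"] by (simp add: mult_2)
  qed (use h in simp)
  have "k \<le> 2 ^ k" by (simp add: less_imp_le)
  then have "?p (2 ^ k) = amul A (?p (2 ^ k - k)) (?p k)" using padd[of "2 ^ k - k" k] by simp
  then have "N (((\<lambda>x. amul A x x) ^^ k) h) = 0" by (simp add: sq 0)
  then have "N h ^ (2 ^ k) = 0" using hermitian_iterated_square[OF h, of k] by simp
  then show ?thesis using h by (simp add: eq_0_iff)
qed

text \<open>\<open>\<tau>\<close> is the trace of left multiplication. Its value at \<open>h\<^sup>2\<close>, for hermitian \<open>h\<close>, is the sum of
  the squares of the eigenvalues of \<open>h\<close>.\<close>

lemma faithful_trace:
  assumes fd: "fd_space (acarr A)"
  obtains \<tau> :: "'a \<Rightarrow> complex" where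
    "\<And>x y. x \<in> acarr A \<Longrightarrow> y \<in> acarr A \<Longrightarrow> \<tau> (x + y) = \<tau> x + \<tau> y"
    "\<And>c x. x \<in> acarr A \<Longrightarrow> \<tau> (c *\<^sub>C x) = c * \<tau> x"
    "\<And>x y. x \<in> acarr A \<Longrightarrow> y \<in> acarr A \<Longrightarrow> \<tau> (amul A x y) = \<tau> (amul A y x)"
    "\<And>h. h \<in> acarr A \<Longrightarrow> astar A h = h \<Longrightarrow> \<exists>r\<ge>0. \<tau> (amul A h h) = complex_of_real r \<and> (r = 0 \<longrightarrow> h = 0)"
proof -
  obtain E d where E: "finite E" "E \<subseteq> acarr A" and d: "\<And>e. e \<in> E \<Longrightarrow> d e \<in> lin (acarr A) UNIV"
    "\<And>y. y \<in> acarr A \<Longrightarrow> y = (\<Sum>e\<in>E. d e y *\<^sub>C e)"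
    using fd_space_coordinates[OF fd] by metis
  obtain b where b: "bij_betw b {0..<card E} E" using ex_bij_betw_nat_finite[OF E(1)] by blast
  define n where "n = card E"
  have b: "bij_betw b {..<n} E" using b by (simp add: n_def atLeast0LessThan)
  define D where "D i = d (b i)" for i
  have bA [simp]: "b i \<in> acarr A" if "i < n" for i using b E that by (auto simp: bij_betw_def)
  have D: "D i \<in> lin (acarr A) UNIV" if "i < n" for i
    using b d that by (auto simp: D_def bij_betw_def)
  have expand: "y = (\<Sum>i<n. D i y *\<^sub>C b i)" if "y \<in> acarr A" for y
    using d(2)[OF that] sum.reindex_bij_betw[OF b, of "\<lambda>e. d e y *\<^sub>C e"] by (simp add: D_def)
  have Dlin: "D i (amul A x (\<Sum>j<n. v j *\<^sub>C b j)) = (\<Sum>j<n. D i (amul A x (b j)) * v j)"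
    if "i < n" "x \<in> acarr A" for i x v
  proof -
    have "D i (amul A x (\<Sum>j<n. v j *\<^sub>C b j)) = (\<Sum>j<n. D i (amul A x (v j *\<^sub>C b j)))"
      using that by (intro sum_additive_on[OF sub, where f = "\<lambda>y. D i (amul A x y)"])
        (auto simp: mul_add_right lin_add[OF D])
    also have "\<dots> = (\<Sum>j<n. D i (amul A x (b j)) * v j)"
      using that by (intro sum.cong refl) (simp add: mul_scale_right lin_scale[OF D] mult.commute)
    finally show ?thesis .
  qed
  have Dmul: "D i (amul A x y) = (\<Sum>j<n. D i (amul A x (b j)) * D j y)"
    if "i < n" "x \<in> acarr A" "y \<in> acarr A" for i x y
    using Dlin[OF that(1,2), of "\<lambda>j. D j y"] expand[OF that(3)] by simp
  define \<tau> where "\<tau> x = (\<Sum>i<n. D i (amul A x (b i)))" for x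
  have mul_tr: "\<tau> (amul A x y) = (\<Sum>i<n. \<Sum>j<n. D i (amul A x (b j)) * D j (amul A y (b i)))"
    if "x \<in> acarr A" "y \<in> acarr A" for x y
    unfolding \<tau>_def
  proof (rule sum.cong[OF refl])
    fix i assume i: "i \<in> {..<n}"
    then show "D i (amul A (amul A x y) (b i)) = (\<Sum>j<n. D i (amul A x (b j)) * D j (amul A y (b i)))"
      using Dmul[of i x "amul A y (b i)"] that by (simp add: mul_assoc)
  qed
  show ?thesis
  proof (rule that[of \<tau>])
    show "\<tau> (x + y) = \<tau> x + \<tau> y" if "x \<in> acarr A" "y \<in> acarr A" for x y
      using that by (simp add: \<tau>_def mul_add_left lin_add[OF D] sum.distrib)
    show "\<tau> (c *\<^sub>C x) = c * \<tau> x" if "x \<in> acarr A" for c x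
      using that by (simp add: \<tau>_def mul_scale_left lin_scale[OF D] sum_distrib_left)
    show "\<tau> (amul A x y) = \<tau> (amul A y x)" if "x \<in> acarr A" "y \<in> acarr A" for x y
      unfolding mul_tr[OF that] mul_tr[OF that(2,1)] by (subst sum.swap) (simp add: mult.commute)
    fix h assume h: "h \<in> acarr A" "astar A h = h"
    let ?m = "\<lambda>i j. D i (amul A h (b j))"
    have eig: "Im l = 0" if v: "\<exists>i<n. v i \<noteq> 0" and ev: "\<And>i. i < n \<Longrightarrow> (\<Sum>j<n. ?m i j * v j) = l * v i" for l v
    proof -
      define y where "y = (\<Sum>j<n. v j *\<^sub>C b j)"
      have y: "y \<in> acarr A" unfolding y_def by (intro cvs.subspace_sum sub) auto
      have Dy: "D i (amul A h y) = l * v i" if "i < n" for i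
        using Dlin[OF that h(1), of v] ev[OF that] by (simp add: y_def)
      show ?thesis
      proof (cases "y = 0")
        \<comment> \<open>The family \<open>b\<close> is only known to span, so a nonzero
          coefficient vector may assemble to \<open>y = 0\<close>. Then \<open>l * v i = 0\<close>
          for a nonzero \<open>v i\<close>, and the eigenvalue is 0.\<close>
        case True
        from v obtain i where i: "i < n" "v i \<noteq> 0" by blast
        have "D i 0 = 0" using lin_scale[OF D[OF i(1)], of 0 0] by simp
        then have "l * v i = 0" using Dy[OF i(1)] True h by simp
        then show ?thesis using i by simp
      next
        case False
        have "amul A h y = (\<Sum>i<n. D i (amul A h y) *\<^sub>C b i)" using expand h y by simp
        also have "\<dots> = (\<Sum>i<n. (l * v i) *\<^sub>C b i)" by (simp add: Dy)
        also have "\<dots> = l *\<^sub>C y" by (simp add: y_def cvs.scale_sum_right)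
        finally show ?thesis using hermitian_eigenvalue_real[OF h y False] by blast
      qed
    qed
    have "\<exists>r\<ge>0. (\<Sum>i<n. \<Sum>j<n. ?m i j * ?m j i) = complex_of_real r \<and>
        (r = 0 \<longrightarrow> (\<exists>k. \<forall>v. \<forall>i<n. ((\<lambda>v i. \<Sum>j<n. ?m i j * v j) ^^ k) v i = 0))"
      by (rule trace_square_real_spectrum) (rule eig)
    then obtain r where r: "r \<ge> 0" "(\<Sum>i<n. \<Sum>j<n. ?m i j * ?m j i) = complex_of_real r"
      and nilp: "r = 0 \<longrightarrow> (\<exists>k. \<forall>v. \<forall>i<n. ((\<lambda>v i. \<Sum>j<n. ?m i j * v j) ^^ k) v i = 0)"
      by (elim exE conjE) (rule that)
    have "h = 0" if "r = 0"
    proof -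
      from nilp that obtain k where k: "\<And>v i. i < n \<Longrightarrow> ((\<lambda>v i. \<Sum>j<n. ?m i j * v j) ^^ k) v i = 0"
        by blast
      have pc: "((amul A h) ^^ j) (aone A) \<in> acarr A" for j by (induction j) (use h in auto)
      \<comment> \<open>The iterates of the coefficient map, started at the coordinates of the unit,
        are the coordinates of the powers of \<open>h\<close>.\<close>
      have it: "((\<lambda>v i. \<Sum>j<n. ?m i j * v j) ^^ l) (\<lambda>i. D i (aone A)) i = D i (((amul A h) ^^ l) (aone A))"
        if "i < n" for l i
        using that
      proof (induction l arbitrary: i)
        case (Suc l)
        then show ?case using Dmul[OF Suc.prems h(1) pc[of l]] by simp
      qed simp
      have "D i (((amul A h) ^^ k) (aone A)) = 0" if "i < n" for i
        using k[OF that, of "\<lambda>i. D i (aone A)"] it[OF that, of k] by simp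
      then have "((amul A h) ^^ k) (aone A) = 0" using expand[OF pc[of k]] by simp
      then show ?thesis by (rule hermitian_nilpotent[OF h])
    qed
    then show "\<exists>r\<ge>0. \<tau> (amul A h h) = complex_of_real r \<and> (r = 0 \<longrightarrow> h = 0)"
      using r mul_tr[OF h(1) h(1)] by auto
  qed
qed

text \<open>The form is \<open>\<tau>\<close> of the adjoint of \<open>x\<close> times
  \<open>y\<close>. The trace is known to be positive on squares of hermitian elements only; writing
  other elements through such squares gives its reality on hermitian elements and then its
  positivity.\<close>

lemma faithful_inner_product:
  assumes fd: "fd_space (acarr A)"
  obtains ip :: "'a \<Rightarrow> 'a \<Rightarrow> complex" where
    "\<And>x y z. x \<in> acarr A \<Longrightarrow> y \<in> acarr A \<Longrightarrow> z \<in> acarr A \<Longrightarrow> ip x (y + z) = ip x y + ip x z"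
    "\<And>c x y. x \<in> acarr A \<Longrightarrow> y \<in> acarr A \<Longrightarrow> ip x (c *\<^sub>C y) = c * ip x y"
    "\<And>x y. x \<in> acarr A \<Longrightarrow> y \<in> acarr A \<Longrightarrow> ip x y = cnj (ip y x)"
    "\<And>x. x \<in> acarr A \<Longrightarrow> x \<noteq> 0 \<Longrightarrow> \<exists>r>0. ip x x = complex_of_real r"
    "\<And>a x y. a \<in> acarr A \<Longrightarrow> x \<in> acarr A \<Longrightarrow> y \<in> acarr A \<Longrightarrow> ip x (amul A a y) = ip (amul A (astar A a) x) y"
proof -
  obtain \<tau> where add: "\<And>x y. x \<in> acarr A \<Longrightarrow> y \<in> acarr A \<Longrightarrow> \<tau> (x + y) = \<tau> x + \<tau> y"
    and scl: "\<And>c x. x \<in> acarr A \<Longrightarrow> \<tau> (c *\<^sub>C x) = c * \<tau> x"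
    and comm: "\<And>x y. x \<in> acarr A \<Longrightarrow> y \<in> acarr A \<Longrightarrow> \<tau> (amul A x y) = \<tau> (amul A y x)"
    and sq: "\<And>h. h \<in> acarr A \<Longrightarrow> astar A h = h \<Longrightarrow> \<exists>r\<ge>0. \<tau> (amul A h h) = complex_of_real r \<and> (r = 0 \<longrightarrow> h = 0)"
    using faithful_trace[OF fd] by blast
  have dif: "\<tau> (x - y) = \<tau> x - \<tau> y" if "x \<in> acarr A" "y \<in> acarr A" for x y
    using add[of "x - y" y] that by simp
  have herm_real: "Im (\<tau> h) = 0" if h: "h \<in> acarr A" "astar A h = h" for h
  proof -
    obtain r where r: "\<tau> (amul A (h + aone A) (h + aone A)) = complex_of_real r"
      using sq[of "h + aone A"] h by (auto simp: star_add)
    obtain s where s: "\<tau> (amul A (h - aone A) (h - aone A)) = complex_of_real s"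
      using sq[of "h - aone A"] h by (auto simp: star_diff)
    \<comment> \<open>A hermitian \<open>h\<close> is a quarter of the difference of the squares of
      \<open>h + 1\<close> and \<open>h - 1\<close>, where the trace is real.\<close>
    have "\<tau> (amul A (h + aone A) (h + aone A)) - \<tau> (amul A (h - aone A) (h - aone A)) = 4 * \<tau> h"
      using h by (simp add: mul_add_left mul_add_right mul_diff_left mul_diff_right add dif)
    then have "4 * \<tau> h = complex_of_real (r - s)" using r s by simp
    then have "Im (4 * \<tau> h) = 0" by (simp only: Im_complex_of_real)
    then show ?thesis by simp
  qed
  have star: "\<tau> (astar A x) = cnj (\<tau> x)" if x: "x \<in> acarr A" for x
  proof -
    have "Im (\<tau> (x + astar A x)) = 0" using x by (intro herm_real) (simp_all add: star_add add.commute)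
    moreover have "Im (\<tau> (\<i> *\<^sub>C (x - astar A x))) = 0"
      using x by (intro herm_real) (simp_all add: star_scale star_diff cvs.scale_right_diff_distrib
        cvs.scale_minus_left)
    ultimately show ?thesis using x by (simp add: add dif scl complex_eq_iff)
  qed
  show ?thesis
  proof (rule that[of "\<lambda>x y. \<tau> (amul A (astar A x) y)"])
    show "\<tau> (amul A (astar A x) (y + z)) = \<tau> (amul A (astar A x) y) + \<tau> (amul A (astar A x) z)"
      if "x \<in> acarr A" "y \<in> acarr A" "z \<in> acarr A" for x y z
      using that by (simp add: mul_add_right add)
    show "\<tau> (amul A (astar A x) (c *\<^sub>C y)) = c * \<tau> (amul A (astar A x) y)"
      if "x \<in> acarr A" "y \<in> acarr A" for c x y
      using that by (simp add: mul_scale_right scl)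
    show "\<tau> (amul A (astar A x) y) = cnj (\<tau> (amul A (astar A y) x))"
      if "x \<in> acarr A" "y \<in> acarr A" for x y
      using that star[of "amul A (astar A y) x"] by (simp add: star_mul)
    show "\<tau> (amul A (astar A x) (amul A a y)) = \<tau> (amul A (astar A (amul A (astar A a) x)) y)"
      if "a \<in> acarr A" "x \<in> acarr A" "y \<in> acarr A" for a x y
      using that by (simp add: star_mul mul_assoc)
    fix x assume x: "x \<in> acarr A" "x \<noteq> 0"
    \<comment> \<open>Twice the real and, up to sign, the imaginary part of \<open>x\<close>. In the
      sum of their squares only the two products of \<open>x\<close> and its adjoint remain, each
      twice, and the trace identifies these.\<close>
    define p where "p = x + astar A x"
    define q where "q = \<i> *\<^sub>C (x - astar A x)"
    have p: "p \<in> acarr A" "astar A p = p" using x by (simp_all add: p_def star_add add.commute)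
    have q: "q \<in> acarr A" "astar A q = q"
      using x by (simp_all add: q_def star_scale star_diff cvs.scale_right_diff_distrib cvs.scale_minus_left)
    obtain r where r: "r \<ge> 0" "\<tau> (amul A p p) = complex_of_real r" "r = 0 \<longrightarrow> p = 0" using sq[OF p] by blast
    obtain s where s: "s \<ge> 0" "\<tau> (amul A q q) = complex_of_real s" "s = 0 \<longrightarrow> q = 0" using sq[OF q] by blast
    have "amul A q q = - amul A (x - astar A x) (x - astar A x)"
      using x by (simp add: q_def mul_scale_left mul_scale_right scaleC_scaleC cvs.scale_minus_left scaleC_one)
    then have "amul A p p + amul A q q
        = amul A (x + astar A x) (x + astar A x) - amul A (x - astar A x) (x - astar A x)"
      by (simp add: p_def)
    then have "\<tau> (amul A p p) + \<tau> (amul A q q)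
        = \<tau> (amul A (x + astar A x) (x + astar A x)) - \<tau> (amul A (x - astar A x) (x - astar A x))"
      using x p q by (simp flip: add dif)
    also have "\<dots> = 4 * \<tau> (amul A (astar A x) x)"
      using x comm[of x "astar A x"]
      by (simp add: mul_add_left mul_add_right mul_diff_left mul_diff_right add dif)
    finally have eq: "4 * \<tau> (amul A (astar A x) x) = complex_of_real (r + s)" using r s by simp
    have "r + s > 0"
    proof (rule ccontr)
      assume "\<not> r + s > 0"
      then have "r = 0" "s = 0" using r s by auto
      then have "p = 0" "q = 0" using r s by auto
      have "2 *\<^sub>C x = p + (- \<i>) *\<^sub>C q"
        using x scaleC_add_left[of 1 1 x] by (simp add: p_def q_def scaleC_scaleC scaleC_one)
      then have "2 *\<^sub>C x = 0" using \<open>p = 0\<close> \<open>q = 0\<close> by simp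
      then show False using x by simp
    qed
    moreover have "\<tau> (amul A (astar A x) x) = complex_of_real ((r + s) / 4)"
      using eq by (simp add: field_simps)
    ultimately show "\<exists>r>0. \<tau> (amul A (astar A x) x) = complex_of_real r"
      by (intro exI[of _ "(r + s) / 4"]) auto
  qed
qed

end

text \<open>\<open>A\<close> acts on itself by left multiplication, written in an orthonormal basis
  \<open>b\<close>. As \<open>x\<close> is recovered from \<open>x\<close> applied to the unit, a
  functional \<open>f\<close> is the vector functional with left vector \<open>f (b i)\<close> and
  right vector the coordinates of the unit.\<close>

lemma faithful_representation:
  assumes "fd_vn_algebra A"
  obtains n :: nat and P where "star_rep A {..<n} P"
    "\<And>f. f \<in> lin (acarr A) UNIV \<Longrightarrow>
      \<exists>\<xi> \<eta>. \<forall>x\<in>acarr A. f x = (\<Sum>i<n. \<Sum>j<n. \<xi> i * P x i j * \<eta> j)"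
proof -
  interpret cstar_alg A "anorm A"
    using assms by unfold_locales (auto simp: fd_vn_algebra_def)
  have fd: "fd_space (acarr A)" using assms by (simp add: fd_vn_algebra_def)
  obtain ip where add: "\<And>x y z. x \<in> acarr A \<Longrightarrow> y \<in> acarr A \<Longrightarrow> z \<in> acarr A \<Longrightarrow> ip x (y + z) = ip x y + ip x z"
    and scl: "\<And>c x y. x \<in> acarr A \<Longrightarrow> y \<in> acarr A \<Longrightarrow> ip x (c *\<^sub>C y) = c * ip x y"
    and herm: "\<And>x y. x \<in> acarr A \<Longrightarrow> y \<in> acarr A \<Longrightarrow> ip x y = cnj (ip y x)"
    and pos: "\<And>x. x \<in> acarr A \<Longrightarrow> x \<noteq> 0 \<Longrightarrow> \<exists>r>0. ip x x = complex_of_real r"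
    and adj: "\<And>a x y. a \<in> acarr A \<Longrightarrow> x \<in> acarr A \<Longrightarrow> y \<in> acarr A \<Longrightarrow> ip x (amul A a y) = ip (amul A (astar A a) x) y"
    using faithful_inner_product[OF fd] by blast
  obtain B where B: "finite B" "cvs.span B = acarr A" using fd by (auto simp: fd_space_def)
  have BA: "B \<subseteq> acarr A" using B cvs.span_superset by blast
  obtain F where F: "finite F" "F \<subseteq> acarr A" "B \<subseteq> cvs.span F"
    and on: "\<And>e f. e \<in> F \<Longrightarrow> f \<in> F \<Longrightarrow> ip e f = (if e = f then 1 else 0)"
    using gram_schmidt[where ip = ip, OF sub add scl herm pos B(1) BA] by blast
  have span: "acarr A \<subseteq> cvs.span F"
    using F(3) B cvs.span_minimal[OF F(3) cvs.subspace_span] by simp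
  have lin_sum: "ip x (\<Sum>e\<in>E. g e) = (\<Sum>e\<in>E. ip x (g e))"
    if "x \<in> acarr A" "\<And>e. e \<in> E \<Longrightarrow> g e \<in> acarr A" for x and E :: "'k set" and g
    by (rule sum_additive_on[OF sub]) (use that add in auto)
  have exp: "y = (\<Sum>e\<in>F. ip e y *\<^sub>C e)" if "y \<in> acarr A" for y
  proof -
    have "y \<in> cvs.span F" using that span by blast
    then have "y \<in> acarr A \<and> y = (\<Sum>e\<in>F. ip e y *\<^sub>C e)"
    proof (induction rule: cvs.span_induct_alt)
      case base
      have "ip e 0 = 0" if "e \<in> F" for e using scl[of e 0 0] that F by auto
      then show ?case by simp
    next
      case (step c x y)
      have "(\<Sum>e\<in>F. ip e (c *\<^sub>C x + y) *\<^sub>C e) = (\<Sum>e\<in>F. (if e = x then c *\<^sub>C e else 0)) + (\<Sum>e\<in>F. ip e y *\<^sub>C e)"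
        unfolding sum.distrib[symmetric]
        using step F by (intro sum.cong refl) (auto simp: add scl on scaleC_add_left subset_iff)
      also have "\<dots> = c *\<^sub>C x + y" using step F by (simp add: sum.delta)
      finally show ?case using step F by auto
    qed
    then show ?thesis by blast
  qed
  obtain b where b: "bij_betw b {0..<card F} F" using ex_bij_betw_nat_finite[OF F(1)] by blast
  define n where "n = card F"
  have b: "bij_betw b {..<n} F" using b by (simp add: n_def atLeast0LessThan)
  have bF: "b i \<in> F" if "i < n" for i using b that by (auto simp: bij_betw_def)
  have bA [simp]: "b i \<in> acarr A" if "i < n" for i using bF[OF that] F by blast
  have bon: "ip (b i) (b j) = (if i = j then 1 else 0)" if "i < n" "j < n" for i j
    using on[OF bF bF] that b by (auto simp: bij_betw_def inj_on_def)
  have bexp: "y = (\<Sum>i<n. ip (b i) y *\<^sub>C b i)" if "y \<in> acarr A" for y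
    using exp[OF that] sum.reindex_bij_betw[OF b, of "\<lambda>e. ip e y *\<^sub>C e"] by simp
  define P where "P x i j = ip (b i) (amul A x (b j))" for x i j
  have Papply: "ip (b i) (amul A x y) = (\<Sum>k<n. P x i k * ip (b k) y)"
    if "x \<in> acarr A" "y \<in> acarr A" "i < n" for x y i
  proof -
    have "ip (b i) (amul A x y) = ip (b i) (amul A x (\<Sum>k<n. ip (b k) y *\<^sub>C b k))"
      using bexp[OF that(2)] by simp
    also have "\<dots> = (\<Sum>k<n. ip (b i) (amul A x (ip (b k) y *\<^sub>C b k)))"
      using that by (intro sum_additive_on[OF sub, where f = "\<lambda>y. ip (b i) (amul A x y)"])
        (auto simp: add mul_add_right)
    also have "\<dots> = (\<Sum>k<n. P x i k * ip (b k) y)"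
      using that by (intro sum.cong refl) (simp add: mul_scale_right scl P_def)
    finally show ?thesis .
  qed
  show ?thesis
  proof (rule that[of n P])
    show "star_rep A {..<n} P"
    proof
      fix x y i j assume "x \<in> acarr A" "y \<in> acarr A" "i \<in> {..<n}" "j \<in> {..<n}"
      then show "P (x + y) i j = P x i j + P y i j"
        and "P (amul A x y) i j = (\<Sum>k\<in>{..<n}. P x i k * P y k j)"
        using Papply[of x "amul A y (b j)" i]
        by (simp_all add: P_def mul_add_left add mul_assoc)
    next
      fix x i j assume x: "x \<in> acarr A" and ij: "i \<in> {..<n}" "j \<in> {..<n}"
      then show "P (c *\<^sub>C x) i j = c * P x i j" for c by (simp add: P_def mul_scale_left scl)
      show "P (astar A x) i j = cnj (P x j i)"
        using x ij adj[of "astar A x" "b i" "b j"] herm[of "amul A x (b i)" "b j"] by (simp add: P_def)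
    next
      fix i j assume "i \<in> {..<n}" "j \<in> {..<n}"
      then show "P (aone A) i j = (if i = j then 1 else 0)" by (simp add: P_def bon)
    next
      fix x assume x: "x \<in> acarr A" and 0: "\<And>i j. i \<in> {..<n} \<Longrightarrow> j \<in> {..<n} \<Longrightarrow> P x i j = 0"
      \<comment> \<open>If the matrix of \<open>x\<close> vanishes then so do all coordinates of
        \<open>x\<close> times the unit, that is of \<open>x\<close>.\<close>
      have "ip (b i) (amul A x (aone A)) = 0" if "i < n" for i
        using Papply[OF x one_closed that] 0 that by simp
      then show "x = 0" using bexp[OF x] x by simp
    qed (auto simp: sub)
    fix f :: "'a \<Rightarrow> complex" assume f: "f \<in> lin (acarr A) UNIV"
    have fx: "f x = (\<Sum>i<n. \<Sum>j<n. f (b i) * P x i j * ip (b j) (aone A))" if x: "x \<in> acarr A" for x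
    proof -
      have "f x = f (\<Sum>i<n. ip (b i) x *\<^sub>C b i)" using bexp[OF x] by simp
      also have "\<dots> = (\<Sum>i<n. f (ip (b i) x *\<^sub>C b i))"
        by (rule sum_additive_on[OF sub]) (auto simp: lin_add[OF f])
      also have "\<dots> = (\<Sum>i<n. f (b i) * ip (b i) (amul A x (aone A)))"
        using x by (intro sum.cong refl) (simp add: lin_scale[OF f] mult.commute)
      also have "\<dots> = (\<Sum>i<n. \<Sum>j<n. f (b i) * P x i j * ip (b j) (aone A))"
        using x by (intro sum.cong refl) (simp add: Papply sum_distrib_left mult.assoc del: one_right)
      finally show ?thesis .
    qed
    show "\<exists>\<xi> \<eta>. \<forall>x\<in>acarr A. f x = (\<Sum>i<n. \<Sum>j<n. \<xi> i * P x i j * \<eta> j)"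
      by (rule exI[of _ "\<lambda>i. f (b i)"], rule exI[of _ "\<lambda>j. ip (b j) (aone A)"], rule ballI, rule fx)
  qed
qed

section \<open>Duals and states\<close>

lemma lin_zero: "f \<in> lin V W \<Longrightarrow> cvs.subspace V \<Longrightarrow> f 0 = 0"
  using lin_scale[of f V W 0 0] cvs.subspace_0[of V] by simp

lemma amp_mats:
  assumes "f \<in> lin V W" "cvs.subspace V" "x \<in> mats n V"
  shows "amp f x \<in> mats n W"
  using assms lin_mem[OF assms(1)] lin_zero[OF assms(1,2)] by (auto simp: mats_def amp_def)

lemma flatten_mats:
  assumes "z \<in> mats n (mats k V)"
  shows "Defs.flatten k z \<in> mats (n * k) V"
proof -
  have in_range: "p div k < n" "p mod k < k" if "p < n * k" for p
    using that by (auto simp: less_mult_imp_div_less) (metis mod_less_divisor mult_0_right not_gr_zero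
      not_less0)
  have out: "Defs.flatten k z p q = 0" if "\<not> (p < n * k \<and> q < n * k)" for p q
  proof (cases "k = 0")
    case True
    \<comment> \<open>Division by 0 gives 0 and the remainder is the number itself, so flattening
      with \<open>k = 0\<close> reads the block \<open>z 0 0\<close>.\<close>
    have "z 0 0 p q = 0"
    proof (cases "n = 0")
      case True
      then show ?thesis using assms by (simp add: mats_def)
    next
      case False
      then have "z 0 0 \<in> mats k V" using assms by (simp add: mats_def)
      then show ?thesis using \<open>k = 0\<close> by (simp add: mats_def)
    qed
    then show ?thesis using True by (simp add: Defs.flatten_def)
  next
    case False
    then have "\<not> (p div k < n \<and> q div k < n)" using that by (auto simp: div_less_iff_less_mult)
    then have "z (p div k) (q div k) = 0" using assms by (auto simp: mats_def)
    then show ?thesis by (simp add: Defs.flatten_def)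
  qed
  have "Defs.flatten k z p q \<in> V" if "p < n * k" "q < n * k" for p q
  proof -
    have "z (p div k) (q div k) \<in> mats k V" using in_range that assms by (simp add: mats_def)
    then show ?thesis using in_range that by (simp add: mats_def Defs.flatten_def)
  qed
  then show ?thesis using out by (simp add: mats_def)
qed

section \<open>Matrix norms on the dual\<close>

lemma mnorm_complex_os: "x \<in> mats n UNIV \<Longrightarrow> mnorm complex_os n x = gnorm {..<n} x"
  by (simp add: complex_os_def restr0_def opnorm_eq_gnorm)

lemma mnorm_mat_os_complex:
  assumes "z \<in> mats n (mats k UNIV)"
  shows "mnorm (mat_os k complex_os) n z
    = gnorm ({..<n} \<times> {..<k}) (\<lambda>p q. z (fst p) (fst q) (snd p) (snd q))"
  using assms mnorm_complex_os[OF flatten_mats[OF assms]]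
  by (simp add: mat_os_def restr0_def gnorm_flatten) (simp add: complex_os_def)

lemma carr_complex_os [simp]: "carr complex_os = UNIV"
  by (simp add: complex_os_def)

lemma carr_dual_def: "carr (dual X) = {f \<in> lin (carr X) UNIV. bdd_above (cb_values X complex_os f)}"
  by (simp add: dual_def CB_def Let_def)

lemma mnorm_dual:
  assumes "g \<in> mats k (carr (dual X))"
  shows "mnorm (dual X) k g = Sup (cb_values X (mat_os k complex_os) (\<lambda>x i j. g i j x))"
  using assms unfolding carr_dual_def by (simp add: dual_def CB_def Let_def restr0_def)

lemma dual_amp_mats:
  assumes g: "g \<in> mats k (lin V UNIV)" and V: "cvs.subspace V" and x: "x \<in> mats n V"
  shows "amp (\<lambda>x i j. g i j x) x \<in> mats n (mats k UNIV)"
proof -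
  have "g i j 0 = 0" for i j
    using g lin_zero[OF _ V] by (cases "i < k \<and> j < k") (auto simp: mats_def)
  then show ?thesis using g x by (auto simp: mats_def amp_def fun_eq_iff)
qed

text \<open>A k by k matrix of functionals sends an n by n matrix to a scalar matrix of size nk,
  here indexed by pairs so that \<open>gnorm\<close> lemmas apply without flattening.\<close>

lemma dual_cb_values:
  assumes g: "g \<in> mats k (lin (carr X) UNIV)" and V: "cvs.subspace (carr X)"
  shows "cb_values X (mat_os k complex_os) (\<lambda>x i j. g i j x) =
    {gnorm ({..<n} \<times> {..<k}) (\<lambda>p q. g (snd p) (snd q) (x (fst p) (fst q))) |n x.
      x \<in> mats n (carr X) \<and> mnorm X n x \<le> 1}"
proof -
  have eq: "mnorm (mat_os k complex_os) n (amp (\<lambda>x i j. g i j x) x)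
      = gnorm ({..<n} \<times> {..<k}) (\<lambda>p q. g (snd p) (snd q) (x (fst p) (fst q)))"
    if "x \<in> mats n (carr X)" for n x
    using mnorm_mat_os_complex[OF dual_amp_mats[OF g V that]] by (simp add: amp_def)
  show ?thesis unfolding cb_values_def by (intro Collect_cong ex_cong1) (auto simp: eq)
qed

lemma gnorm_Times_unit:
  assumes "finite I"
  shows "gnorm (I \<times> {..<1::nat}) a = gnorm I (\<lambda>i j. a (i, 0) (j, 0))"
proof -
  have "bij_betw (\<lambda>i. (i, 0::nat)) I (I \<times> {..<1})" by (auto simp: bij_betw_def inj_on_def)
  from gnorm_reindex[OF this assms] show ?thesis .
qed

lemma gnorm_unit_Times_nat:
  assumes "finite I"
  shows "gnorm ({..<1::nat} \<times> I) a = gnorm I (\<lambda>i j. a (0, i) (0, j))"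
proof -
  have "bij_betw (\<lambda>i. (0::nat, i)) I ({..<1} \<times> I)" by (auto simp: bij_betw_def inj_on_def)
  from gnorm_reindex[OF this assms] show ?thesis .
qed

lemma vnorm_dual:
  assumes f: "f \<in> carr (dual X)" and V: "cvs.subspace (carr X)"
  shows "vnorm (dual X) f = Sup {gnorm {..<n} (amp f x) |n x. x \<in> mats n (carr X) \<and> mnorm X n x \<le> 1}"
proof -
  have f': "f \<in> lin (carr X) UNIV" using f by (simp add: carr_dual_def)
  have "vnorm (dual X) f = Sup (cb_values X (mat_os 1 complex_os) (\<lambda>x i j. single f i j x))"
    unfolding vnorm_def by (rule mnorm_dual[OF single_in_mats[OF f]])
  also have "cb_values X (mat_os 1 complex_os) (\<lambda>x i j. single f i j x) =
    {gnorm {..<n} (amp f x) |n x. x \<in> mats n (carr X) \<and> mnorm X n x \<le> 1}"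
    unfolding dual_cb_values[OF single_in_mats[OF f'] V]
    by (simp only: gnorm_Times_unit[OF finite_lessThan]) (simp add: single_def amp_def)
  finally show ?thesis .
qed

lemma cb_values_complex:
  assumes f: "f \<in> lin (carr X) UNIV" and V: "cvs.subspace (carr X)"
  shows "cb_values X complex_os f = {gnorm {..<n} (amp f x) |n x. x \<in> mats n (carr X) \<and> mnorm X n x \<le> 1}"
  unfolding cb_values_def
  by (intro Collect_cong ex_cong1) (auto simp: mnorm_complex_os[OF amp_mats[OF f V]])

context star_rep
begin

lemma bil_P_add: "x \<in> acarr A \<Longrightarrow> y \<in> acarr A \<Longrightarrow> bil I (P (x + y)) u v = bil I (P x) u v + bil I (P y) u v"
  by (simp add: bil_def P_add algebra_simps sum.distrib)

lemma bil_P_scale: "x \<in> acarr A \<Longrightarrow> bil I (P (c *\<^sub>C x)) u v = c * bil I (P x) u v"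
  by (simp add: bil_def P_scale sum_distrib_left mult_ac)

lemma bil_P_one: "bil I (P (aone A)) u v = (\<Sum>i\<in>I. u i * v i)"
proof -
  have "(\<Sum>j\<in>I. u i * P (aone A) i j * v j) = (\<Sum>j\<in>I. if j = i then u i * v i else 0)" if "i \<in> I" for i
    using that by (intro sum.cong refl) (auto simp: P_one)
  then show ?thesis using fin by (simp add: bil_def sum.delta)
qed

end

text \<open>The second assumption is the special feature of the regular representation. Through
  \<open>gnorm_compress\<close> it makes every functional completely bounded, and through
  polarization it makes the vector states span the dual.\<close>

locale vn_rep = star_rep A "{..<d}" P
  for A :: "'a::complex_vector cstar" and d :: nat and P :: "'a \<Rightarrow> nat \<Rightarrow> nat \<Rightarrow> complex" +
  assumes fd: "fd_space (acarr A)"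
    and functionals: "\<And>f. f \<in> lin (acarr A) UNIV \<Longrightarrow>
      \<exists>\<xi> \<eta>. \<forall>x\<in>acarr A. f x = (\<Sum>i<d. \<Sum>j<d. \<xi> i * P x i j * \<eta> j)"
begin

sublocale M: normed_subspace "mats n (acarr A)" "mnorm (os_of A) n" for n
proof -
  have "is_norm_on (mats n (acarr A)) (mnorm (os_of A) n)"
    using fd_operator_space[OF fd] by (simp add: fd_operator_space_def operator_space_def)
  then show "normed_subspace (mats n (acarr A)) (mnorm (os_of A) n)"
    using subspace_mats[OF subsp] by unfold_locales
qed

lemma functional_bounded:
  assumes f: "f \<in> lin (acarr A) UNIV"
  shows "\<exists>C\<ge>0. \<forall>n. \<forall>x\<in>mats n (acarr A). gnorm {..<n} (amp f x) \<le> C * mnorm (os_of A) n x"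
proof -
  obtain \<xi> \<eta> where f': "\<And>x. x \<in> acarr A \<Longrightarrow> f x = (\<Sum>i<d. \<Sum>j<d. \<xi> i * P x i j * \<eta> j)"
    using functionals[OF f] by blast
  have "gnorm {..<n} (amp f x) \<le> l2 {..<d} \<xi> * l2 {..<d} \<eta> * mnorm (os_of A) n x"
    if x: "x \<in> mats n (acarr A)" for n x
  proof -
    have "gnorm {..<n} (amp f x) = gnorm {..<n} (\<lambda>i j. \<Sum>p<d. \<Sum>q<d. \<xi> p * matrep P x (i, p) (j, q) * \<eta> q)"
      by (rule gnorm_cong) (use x in \<open>auto simp: amp_def matrep_def f' mats_def\<close>)
    then show ?thesis
      using gnorm_compress[of "{..<n}" "{..<d}" \<xi> "matrep P x" \<eta>] mnorm_mats[OF fd x] by simp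
  qed
  then show ?thesis by (intro exI[of _ "l2 {..<d} \<xi> * l2 {..<d} \<eta>"]) simp
qed

text \<open>By compression all linear functionals are completely bounded, so the boundedness
  condition in \<open>CB\<close> cuts nothing out.\<close>

lemma carr_dual: "carr (dual (os_of A)) = lin (acarr A) UNIV"
proof -
  have "bdd_above (cb_values (os_of A) complex_os f)" if f: "f \<in> lin (acarr A) UNIV" for f
  proof -
    obtain C where C: "C \<ge> 0" "\<And>n x. x \<in> mats n (acarr A) \<Longrightarrow> gnorm {..<n} (amp f x) \<le> C * mnorm (os_of A) n x"
      using functional_bounded[OF f] by blast
    have "v \<le> C" if "v \<in> cb_values (os_of A) complex_os f" for v
    proof -
      from that obtain n x where v: "v
        = gnorm {..<n} (amp f x)" "x \<in> mats n (acarr A)" "mnorm (os_of A) n x \<le> 1"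
        using f subsp by (auto simp: cb_values_complex)
      have "v \<le> C * mnorm (os_of A) n x" using C(2) v by simp
      also have "\<dots> \<le> C" using C(1) v by (simp add: mult_left_le)
      finally show ?thesis .
    qed
    then show ?thesis by (rule bdd_aboveI)
  qed
  then show ?thesis by (auto simp: carr_dual_def)
qed

text \<open>Replaces the supremum over unit balls by a homogeneous inequality, obtained by
  normalising \<open>x\<close>. The supremum is finite because each entry is completely bounded and
  \<open>gnorm_entries\<close> sums the bounds.\<close>

lemma mnorm_dual_le_1_iff:
  assumes g: "g \<in> mats k (lin (acarr A) UNIV)"
  shows "mnorm (dual (os_of A)) k g \<le> 1 \<longleftrightarrow> (\<forall>n. \<forall>x\<in>mats n (acarr A).
    gnorm ({..<n} \<times> {..<k}) (\<lambda>p q. g (snd p) (snd q) (x (fst p) (fst q))) \<le> mnorm (os_of A) n x)"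
    (is "_ \<longleftrightarrow> (\<forall>n. \<forall>x\<in>_. ?G n x \<le> _)")
proof -
  let ?S = "{?G n x |n x. x \<in> mats n (acarr A) \<and> mnorm (os_of A) n x \<le> 1}"
  have glin: "g p q \<in> lin (acarr A) UNIV" for p q
    using g cvs.subspace_0[OF lin_subspace[OF subsp cvs.subspace_UNIV]]
      by (cases "p < k \<and> q < k") (auto simp: mats_def)
  have norm: "mnorm (dual (os_of A)) k g = Sup ?S"
    using g mnorm_dual[of g k "os_of A"] dual_cb_values[of g k "os_of A"] subsp by (simp add: carr_dual)
  have "\<forall>p q. \<exists>C\<ge>0. \<forall>n. \<forall>x\<in>mats n (acarr A). gnorm {..<n} (amp (g p q) x) \<le> C * mnorm (os_of A) n x"
    using functional_bounded[OF glin] by blast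
  then obtain C where C: "\<And>p q. C p q \<ge> 0"
    "\<And>p q n x. x \<in> mats n (acarr A) \<Longrightarrow> gnorm {..<n} (amp (g p q) x) \<le> C p q * mnorm (os_of A) n x" by metis
  have "bdd_above ?S"
  proof (rule bdd_aboveI)
    fix v assume "v \<in> ?S"
    then obtain n x where v: "v = ?G n x" and x: "x \<in> mats n (acarr A)" "mnorm (os_of A) n x \<le> 1" by blast
    have "v \<le> (\<Sum>p<k. \<Sum>q<k. gnorm {..<n} (amp (g p q) x))"
      unfolding v using gnorm_entries[of "{..<n}" "{..<k}" "\<lambda>p q. g (snd p) (snd q) (x (fst p) (fst q))"]
      by (simp add: amp_def)
    also have "\<dots> \<le> (\<Sum>p<k. \<Sum>q<k. C p q)"
    proof (intro sum_mono)
      fix p q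
      show "gnorm {..<n} (amp (g p q) x) \<le> C p q"
        using C(2)[OF x(1), of p q] mult_left_mono[OF x(2) C(1)[of p q]] by simp
    qed
    finally show "v \<le> (\<Sum>p<k. \<Sum>q<k. C p q)" .
  qed
  moreover have "?S \<noteq> {}"
    using cvs.subspace_0[OF subspace_mats[OF subsp, of 0]] M.zero[of 0] by force
  ultimately have sup: "Sup ?S \<le> 1 \<longleftrightarrow> (\<forall>v\<in>?S. v \<le> 1)" by (rule cSup_le_iff[rotated])
  show ?thesis
    unfolding norm sup
  proof (intro iffI allI ballI)
    fix n x assume le: "\<forall>v\<in>?S. v \<le> 1" and x: "x \<in> mats n (acarr A)"
    show "?G n x \<le> mnorm (os_of A) n x"
    proof (cases "mnorm (os_of A) n x = 0")
      case True
      then have "x = 0" using M.eq_0_iff[OF x] by simp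
      then have "?G n x = 0" using lin_zero[OF glin subsp] by (intro gnorm_0) auto
      then show ?thesis using True by simp
    next
      case False
      define c where "c = mnorm (os_of A) n x"
      have c: "c > 0" using False M.nonneg[OF x] by (simp add: c_def less_le)
      let ?x = "complex_of_real (inverse c) *\<^sub>C x"
      have "?x \<in> mats n (acarr A)" by (rule cvs.subspace_scale[OF M.sub x])
      moreover have "mnorm (os_of A) n ?x \<le> 1" using M.scale[OF x] c by (simp add: norm_inverse flip: c_def)
      ultimately have "?G n ?x \<le> 1" using le by blast
      moreover have "?G n ?x = gnorm ({..<n} \<times> {..<k}) (\<lambda>p q. complex_of_real (inverse c)
        * g (snd p) (snd q) (x (fst p) (fst q)))"
        using x by (intro gnorm_cong) (auto simp: scaleC_fun_def lin_scale[OF glin] mats_def)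
      ultimately have "inverse c * ?G n x \<le> 1" using c by (simp add: gnorm_scale norm_inverse)
      then show ?thesis using c by (simp add: field_simps flip: c_def)
    qed
  next
    fix v assume "\<forall>n. \<forall>x\<in>mats n (acarr A). ?G n x \<le> mnorm (os_of A) n x" "v \<in> ?S"
    then show "v \<le> 1" by force
  qed
qed

lemma vnorm_dual_le_1_iff:
  assumes f: "f \<in> lin (acarr A) UNIV"
  shows "vnorm (dual (os_of A)) f \<le> 1 \<longleftrightarrow>
    (\<forall>n. \<forall>x\<in>mats n (acarr A). gnorm {..<n} (amp f x) \<le> mnorm (os_of A) n x)"
  unfolding vnorm_def mnorm_dual_le_1_iff[OF single_in_mats[OF f]]
  by (simp only: gnorm_Times_unit[OF finite_lessThan]) (simp add: single_def amp_def)

section \<open>Vector states, the polar of the unit and its bipolar\<close>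

definition vector_state :: "(nat \<Rightarrow> complex) \<Rightarrow> 'a \<Rightarrow> complex" where
  "vector_state u = restr0 (acarr A) (\<lambda>x. bil {..<d} (P x) (\<lambda>i. cnj (u i)) u)"

lemma vector_state_lin: "vector_state u \<in> lin (acarr A) UNIV"
  by (auto simp: lin_def vector_state_def restr0_def bil_P_add bil_P_scale closed)

text \<open>Complete contractivity is \<open>gnorm_compress\<close> with two unit vectors; the value
  at the unit is the squared norm of \<open>u\<close>.\<close>

lemma vector_state_polar:
  assumes u: "l2 {..<d} u = 1"
  shows "vector_state u \<in> polar (os_of A) {aone A}"
proof -
  have "gnorm {..<n} (amp (vector_state u) x) \<le> mnorm (os_of A) n x" if x: "x \<in> mats n (acarr A)" for n x
  proof -
    have "gnorm {..<n} (amp (vector_state u) x)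
        = gnorm {..<n} (\<lambda>i j. \<Sum>p<d. \<Sum>q<d. cnj (u p) * matrep P x (i, p) (j, q) * u q)"
      by (rule gnorm_cong)
        (use x in \<open>auto simp: amp_def matrep_def vector_state_def restr0_def bil_def mats_def\<close>)
    then show ?thesis
      using gnorm_compress[of "{..<n}" "{..<d}" "\<lambda>p. cnj (u p)" "matrep P x" u] mnorm_mats[OF fd x] u by simp
  qed
  moreover have "vector_state u (aone A) = 1"
    using l2_power2_complex[of "{..<d}" u] u by (simp add: vector_state_def restr0_def bil_P_one)
  ultimately show ?thesis
    by (simp add: polar_def unit_ball_def carr_dual vector_state_lin vnorm_dual_le_1_iff)
qed

text \<open>Vector states scale quadratically in \<open>u\<close>, so the claim reduces to unit
  vectors, except that \<open>u = 0\<close> gives the functional 0.\<close>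

lemma vector_state_span: "vector_state u \<in> cvs.span (polar (os_of A) {aone A})"
proof (cases "l2 {..<d} u = 0")
  case True
  then have "u i = 0" if "i < d" for i using l2_eq_0[of "{..<d}" u i] that by simp
  then have "vector_state u = 0" by (auto simp: vector_state_def restr0_def bil_def)
  then show ?thesis by (simp add: cvs.span_zero)
next
  case False
  define w where "w i = complex_of_real (inverse (l2 {..<d} u)) * u i" for i
  have w: "l2 {..<d} w = 1" unfolding w_def l2_scale using False by (simp add: norm_inverse)
  have "u i = complex_of_real (l2 {..<d} u) * w i" for i using False by (simp add: w_def)
  then have u: "u = (\<lambda>i. complex_of_real (l2 {..<d} u) * w i)" by (rule ext)
  have "vector_state u = (complex_of_real (l2 {..<d} u))\<^sup>2 *\<^sub>C vector_state w"
    by (subst u, rule ext)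
      (simp add: vector_state_def restr0_def scaleC_fun_def bil_scale[of _ _ "complex_of_real (l2 {..<d}
        u)"] power2_eq_square)
  then show ?thesis using vector_state_polar[OF w] by (simp add: cvs.span_scale cvs.span_base)
qed

text \<open>Every functional is a vector functional, and polarization writes it as a combination of
  four functionals \<open>vector_state\<close>.\<close>

lemma states_span:
  assumes f: "f \<in> lin (acarr A) UNIV"
  shows "f \<in> cvs.span (polar (os_of A) {aone A})"
proof -
  obtain \<xi> v where f': "\<And>x. x \<in> acarr A \<Longrightarrow> f x = (\<Sum>i<d. \<Sum>j<d. \<xi> i * P x i j * v j)"
    using functionals[OF f] by blast
  define u where "u i = cnj (\<xi> i)" for i
  let ?s = "vector_state"
  have "f = (1/4) *\<^sub>C (?s (\<lambda>i. u i + v i) - ?s (\<lambda>i. u i - v i)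
     - \<i> *\<^sub>C ?s (\<lambda>i. u i + \<i> * v i) + \<i> *\<^sub>C ?s (\<lambda>i. u i - \<i> * v i))" (is "_ = ?r")
  proof
    fix x
    show "f x = ?r x"
    proof (cases "x \<in> acarr A")
      case True
      have "f x = bil {..<d} (P x) (\<lambda>i. cnj (u i)) v" using f'[OF True] by (simp add: bil_def u_def)
      then show ?thesis
        using bil_polarization[of "{..<d}" "P x" u v] True
        by (simp add: vector_state_def restr0_def scaleC_fun_def mult.commute[of _ "4 :: complex"])
    next
      case False
      then show ?thesis using f by (simp add: lin_off vector_state_def restr0_def scaleC_fun_def)
    qed
  qed
  then show ?thesis
    by (simp only:) (intro cvs.span_scale cvs.span_add cvs.span_diff vector_state_span)
qed

lemma functionals_separate:
  assumes x: "x \<in> acarr A" and 0: "\<And>f :: 'a \<Rightarrow> complex. f \<in> lin (acarr A) UNIV \<Longrightarrow> f x = 0"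
  shows "x = 0"
proof -
  obtain E e where e: "\<And>b. b \<in> E \<Longrightarrow> e b \<in> lin (acarr A) UNIV"
    "\<And>y. y \<in> acarr A \<Longrightarrow> y = (\<Sum>b\<in>E. e b y *\<^sub>C b)"
    using fd_space_coordinates[OF fd] by metis
  have "x = (\<Sum>b\<in>E. e b x *\<^sub>C b)" by (rule e(2)[OF x])
  also have "\<dots> = 0" using 0[OF e(1)] by (intro sum.neutral) simp
  finally show ?thesis .
qed

lemma states_separate:
  assumes x: "x \<in> acarr A" and 0: "\<And>f. f \<in> polar (os_of A) {aone A} \<Longrightarrow> f x = 0"
  shows "x = 0"
proof (rule functionals_separate[OF x])
  fix f :: "'a \<Rightarrow> complex" assume "f \<in> lin (acarr A) UNIV"
  then have "f \<in> cvs.span (polar (os_of A) {aone A})" by (rule states_span)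
  then show "f x = 0"
    by (induction rule: cvs.span_induct_alt) (simp_all add: 0 scaleC_fun_def)
qed

lemma vnorm_one: "vnorm (os_of A) (aone A) \<le> 1"
proof -
  interpret cstar_alg A "\<lambda>x. gnorm {..<d} (P x)"
    by unfold_locales (rule cstar_norm[OF fd])
  show ?thesis using norm_one_le by (simp add: vnorm_os_of[OF fd onec])
qed

text \<open>The bound on a matrix \<open>g\<close> of functionals is applied to the 1 by 1 matrix
  with entry the unit, whose norm is at most 1.\<close>

lemma canon_one: "canon (os_of A) (aone A) \<in> unit_ball (dual (dual (os_of A)))"
proof -
  let ?D = "dual (os_of A)" and ?c = "canon (os_of A) (aone A)"
  have sD: "cvs.subspace (carr ?D)" unfolding carr_dual by (intro lin_subspace subsp cvs.subspace_UNIV)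
  have lin: "?c \<in> lin (carr ?D) UNIV"
    using cvs.subspace_add[OF sD] cvs.subspace_scale[OF sD]
    by (auto simp: lin_def[of "carr ?D"] canon_def restr0_def scaleC_fun_def)
  have le: "gnorm {..<k} (amp ?c g) \<le> 1" if g: "g \<in> mats k (carr ?D)" "mnorm ?D k g \<le> 1" for k g
  proof -
    have "gnorm ({..<1} \<times> {..<k}) (\<lambda>p q. g (snd p) (snd q) (single (aone A) (fst p) (fst q)))
        \<le> mnorm (os_of A) 1 (single (aone A))"
      using g single_in_mats[OF onec] mnorm_dual_le_1_iff[of g k] unfolding carr_dual by blast
    also have "\<dots> \<le> 1" using vnorm_one by (simp add: vnorm_def)
    finally have "gnorm {..<k} (\<lambda>i j. g i j (aone A)) \<le> 1"
      by (simp only: gnorm_unit_Times_nat[OF finite_lessThan]) (simp add: single_def)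
    moreover have "gnorm {..<k} (amp ?c g) = gnorm {..<k} (\<lambda>i j. g i j (aone A))"
      by (rule gnorm_cong) (use g in \<open>auto simp: amp_def canon_def restr0_def mats_def\<close>)
    ultimately show ?thesis by simp
  qed
  have "bdd_above (cb_values ?D complex_os ?c)"
    unfolding cb_values_complex[OF lin sD] using le by (intro bdd_aboveI[of _ 1]) blast
  with lin have c: "?c \<in> carr (dual ?D)" by (simp add: carr_dual_def[of ?D])
  \<comment> \<open>Matrices of size 0 show that the supremum defining the norm is over a nonempty
    set.\<close>
  have "0 \<in> mats 0 (carr ?D)" by (simp add: mats_def)
  moreover from this have "mnorm ?D 0 0 \<le> 1"
    unfolding carr_dual by (simp add: mnorm_dual_le_1_iff M.nonneg)
  ultimately have "vnorm (dual ?D) ?c \<le> 1"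
    unfolding vnorm_dual[OF c sD] using le by (intro cSup_least) blast+
  then show ?thesis using c by (simp add: unit_ball_def)
qed

text \<open>If \<open>f x = 1\<close> for all \<open>f\<close> in \<open>T\<close>, then
  \<open>T\<close> annihilates \<open>x - 1\<close>. The set \<open>T\<close> is kept general
  because the lemma is applied both to the states of one algebra and to the products of states on a
  tensor product.\<close>

lemma polar_back_separating:
  assumes T: "T \<subseteq> carr (dual (os_of A))" and one: "\<And>f. f \<in> T \<Longrightarrow> f (aone A) = 1"
    and sep: "\<And>x. x \<in> acarr A \<Longrightarrow> (\<And>f. f \<in> T \<Longrightarrow> f x = 0) \<Longrightarrow> x = 0"
  shows "polar_back (os_of A) T = {aone A}"
proof
  have ev: "canon (os_of A) x f = f x" if "f \<in> T" for x f
    using that T by (auto simp: canon_def restr0_def)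
  show "{aone A} \<subseteq> polar_back (os_of A) T"
    using canon_one ev one by (simp add: polar_back_def polar_def onec)
  show "polar_back (os_of A) T \<subseteq> {aone A}"
  proof
    fix x assume "x \<in> polar_back (os_of A) T"
    then have x: "x \<in> acarr A" and 1: "\<And>f. f \<in> T \<Longrightarrow> f x = 1"
      using ev by (auto simp: polar_back_def polar_def)
    have "f (x - aone A) = 0" if "f \<in> T" for f
    proof -
      have "f \<in> lin (acarr A) UNIV" using that T by (auto simp: carr_dual)
      from lin_add[OF this, of "x - aone A" "aone A"] show ?thesis
        using x 1[OF that] one[OF that] by simp
    qed
    then have "x - aone A = 0" using x by (intro sep) auto
    then show "x \<in> {aone A}" by simp
  qed
qed

lemma Q_obj: "Q_obj (functor_obj A)"
proof -
  have "polar_back (os_of A) (polar (os_of A) {aone A}) = {aone A}"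
    by (rule polar_back_separating)
      (auto simp: polar_def unit_ball_def intro: states_separate[unfolded polar_def unit_ball_def])
  then show ?thesis
    using fd_operator_space[OF fd] vnorm_one
    by (simp add: Q_obj_def functor_obj_def bipolar_def unit_ball_def onec)
qed

end

lemma fd_vn_rep:
  assumes "fd_vn_algebra A"
  obtains d P where "vn_rep A d P"
proof -
  obtain d :: nat and P where P: "star_rep A {..<d} P"
    and f: "\<And>f. f \<in> lin (acarr A) UNIV \<Longrightarrow>
      \<exists>\<xi> \<eta>. \<forall>x\<in>acarr A. f x = (\<Sum>i<d. \<Sum>j<d. \<xi> i * P x i j * \<eta> j)"
    using faithful_representation[OF assms] by blast
  have "fd_space (acarr A)" using assms by (simp add: fd_vn_algebra_def)
  then have "vn_rep A d P" using P f by (intro vn_rep.intro vn_rep_axioms.intro)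
  then show ?thesis by (rule that)
qed

section \<open>Tensor products\<close>

lemma tens_value: "t \<in> tens V W \<Longrightarrow> h \<in> lin W UNIV \<Longrightarrow> t h \<in> V"
  unfolding tens_def by (rule lin_mem[where V = "lin W UNIV"])

lemma tens_apply:
  assumes "fd_space V" "fd_space W" "finite E" "E \<subseteq> W"
    and "\<And>e. e \<in> E \<Longrightarrow> d e \<in> lin W UNIV" "\<And>y. y \<in> W \<Longrightarrow> y = (\<Sum>e\<in>E. d e y *\<^sub>C e)"
    and "t \<in> tens V W" and h: "h \<in> lin W UNIV"
  shows "t h = (\<Sum>e\<in>E. h e *\<^sub>C t (d e))"
proof -
  have "t h = (\<Sum>e\<in>E. pure W (t (d e)) e) h" using tens_expand[OF assms(1-7)] by simp
  then show ?thesis using h by (simp add: sum_fun pure_def restr0_def)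
qed

text \<open>Evaluates the extension as a finite sum in coordinates of \<open>W\<close>. The balance
  condition is stated without pulling out scalars, so it also covers the conjugate-bilinear map
  behind the involution.\<close>

lemma tensor_ext_eq:
  assumes V: "fd_space V" and W: "fd_space W" and E: "finite E" "E \<subseteq> W"
    and d: "\<And>e. e \<in> E \<Longrightarrow> d e \<in> lin W UNIV" "\<And>y. y \<in> W \<Longrightarrow> y = (\<Sum>e\<in>E. d e y *\<^sub>C e)"
    and b: "\<And>x x' y. x \<in> V \<Longrightarrow> x' \<in> V \<Longrightarrow> y \<in> W \<Longrightarrow> b (x + x') y = b x y + b x' y"
      "\<And>x y y'. x \<in> V \<Longrightarrow> y \<in> W \<Longrightarrow> y' \<in> W \<Longrightarrow> b x (y + y') = b x y + b x y'"
      "\<And>c x y. x \<in> V \<Longrightarrow> y \<in> W \<Longrightarrow> b (c *\<^sub>C x) y = b x (c *\<^sub>C y)"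
    and t: "t \<in> tens V W"
  shows "tensor_ext V W b t = (\<Sum>e\<in>E. b (t (d e)) e)"
proof -
  let ?F = "tensor_ext V W b"
  have "\<exists>!F. extends_pure V W b F" by (rule tensor_universal[OF V W]) (use b in auto)
  then have F: "extends_pure V W b ?F" unfolding tensor_ext_def by (rule theI')
  have F_add: "?F (x + y) = ?F x + ?F y" if "x \<in> tens V W" "y \<in> tens V W" for x y
    using F that unfolding extends_pure_def by blast
  have s: "cvs.subspace V" "cvs.subspace W" using V W by (auto simp: fd_space_def)
  have tV: "t (d e) \<in> V" if "e \<in> E" for e using t d(1)[OF that] lin_mem by (fastforce simp: tens_def)
  have "?F t = ?F (\<Sum>e\<in>E. pure W (t (d e)) e)" using tens_expand[OF V W E d t] by simp
  also have "\<dots> = (\<Sum>e\<in>E. ?F (pure W (t (d e)) e))"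
    by (rule sum_additive_on[OF subspace_tens[OF s]])
      (use F_add E tV s in \<open>blast intro: pure_in_tens\<close>)+
  also have "\<dots> = (\<Sum>e\<in>E. b (t (d e)) e)"
    using F E tV by (intro sum.cong refl) (auto simp: extends_pure_def)
  finally show ?thesis .
qed

lemma pure_add_left: "pure W (x + x') y = pure W x y + pure W x' y"
  by (auto simp: pure_def restr0_def fun_eq_iff scaleC_add_right)

lemma pure_add_right: "y \<in> W \<Longrightarrow> y' \<in> W \<Longrightarrow> pure W x (y + y') = pure W x y + pure W x y'"
  by (auto simp: pure_def restr0_def fun_eq_iff scaleC_add_left lin_add)

lemma pure_scale: "y \<in> W \<Longrightarrow> pure W (c *\<^sub>C x) y = pure W x (c *\<^sub>C y)"
  by (auto simp: pure_def restr0_def fun_eq_iff scaleC_scaleC lin_scale mult.commute)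

text \<open>The asymmetry is deliberate. Tensors are maps from the dual of \<open>B\<close> to
  \<open>A\<close>, so only functionals on \<open>B\<close> must be expressible through the
  representation. The left factor can then be a matrix algebra in its standard representation, where
  a functional such as the trace is in general not a single vector functional.\<close>

locale rep_pair = A: star_rep A "{..<m}" P + B: vn_rep B n Q
  for A :: "'a::complex_vector cstar" and m :: nat and P and B :: "'b::complex_vector cstar" and n Q +
  assumes fd_left: "fd_space (acarr A)"
begin

abbreviation T :: "(('b \<Rightarrow> complex) \<Rightarrow> 'a) set" where
  "T \<equiv> tens (acarr A) (acarr B)"

definition coef :: "nat \<Rightarrow> nat \<Rightarrow> 'b \<Rightarrow> complex" where
  "coef c d = restr0 (acarr B) (\<lambda>y. Q y c d)"

text \<open>The tensor product of the representations: \<open>t\<close> is evaluated at the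
  coefficient functionals of \<open>Q\<close>, and \<open>P\<close> is applied to the results. On
  pure tensors it is the Kronecker product, see \<open>R_pure\<close>.\<close>

definition R :: "(('b \<Rightarrow> complex) \<Rightarrow> 'a) \<Rightarrow> nat \<times> nat \<Rightarrow> nat \<times> nat \<Rightarrow> complex" where
  "R t x y = P (t (coef (snd x) (snd y))) (fst x) (fst y)"

lemma coef_lin: "c < n \<Longrightarrow> d < n \<Longrightarrow> coef c d \<in> lin (acarr B) UNIV"
  by (auto simp: lin_def coef_def restr0_def B.P_add B.P_scale B.closed)

lemma tens_mem: "t \<in> T \<Longrightarrow> h \<in> lin (acarr B) UNIV \<Longrightarrow> t h \<in> acarr A"
  by (rule tens_value)

lemma T_subspace: "cvs.subspace T"
  by (rule subspace_tens[OF A.subsp B.subsp])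

lemma T_fd: "fd_space T"
  by (rule fd_space_tens[OF fd_left B.fd])

text \<open>Every functional on \<open>B\<close> is a combination of the coefficient functionals, so
  these determine a tensor.\<close>

lemma tens_eqI:
  assumes "s \<in> T" "t \<in> T" "\<And>c d. c < n \<Longrightarrow> d < n \<Longrightarrow> s (coef c d) = t (coef c d)"
  shows "s = t"
proof
  fix f
  have L: "cvs.subspace (lin (acarr B) (UNIV :: complex set))"
    by (intro lin_subspace B.subsp cvs.subspace_UNIV)
  show "s f = t f"
  proof (cases "f \<in> lin (acarr B) UNIV")
    case False
    then show ?thesis using assms by (simp add: tens_def lin_off)
  next
    case True
    obtain \<xi> \<eta> where f: "\<And>x. x \<in> acarr B \<Longrightarrow> f x = (\<Sum>i<n. \<Sum>j<n. \<xi> i * Q x i j * \<eta> j)"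
      using B.functionals[OF True] by blast
    have f_eq: "f = (\<Sum>z\<in>{..<n} \<times> {..<n}. (\<xi> (fst z) * \<eta> (snd z)) *\<^sub>C coef (fst z) (snd z))" (is "f = ?g")
    proof
      fix x
      show "f x = ?g x"
        using f[of x] lin_off[OF True, of x]
        by (cases "x \<in> acarr B") (simp_all add: sum_fun scaleC_fun_def coef_def restr0_def sum_Times mult_ac)
    qed
    have ev: "u ?g = (\<Sum>z\<in>{..<n} \<times> {..<n}. (\<xi> (fst z) * \<eta> (snd z)) *\<^sub>C u (coef (fst z) (snd z)))"
      if "u \<in> T" for u
    proof -
      have u: "u \<in> lin (lin (acarr B) UNIV) (acarr A)" using that by (simp add: tens_def)
      have "u ?g = (\<Sum>z\<in>{..<n} \<times> {..<n}. u ((\<xi> (fst z) * \<eta> (snd z)) *\<^sub>C coef (fst z) (snd z)))"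
        by (rule sum_additive_on[OF L], rule lin_add[OF u]) (auto intro!: cvs.subspace_scale L coef_lin)
      then show ?thesis by (auto simp: lin_scale[OF u] coef_lin intro!: sum.cong)
    qed
    show ?thesis
      unfolding f_eq ev[OF assms(1)] ev[OF assms(2)] using assms(3) by (intro sum.cong refl) auto
  qed
qed

lemma R_add: "s \<in> T \<Longrightarrow> t \<in> T \<Longrightarrow> x \<in> {..<m} \<times> {..<n} \<Longrightarrow> y \<in> {..<m} \<times> {..<n} \<Longrightarrow>
    R (s + t) x y = R s x y + R t x y"
  by (auto simp: R_def A.P_add tens_mem coef_lin)

lemma R_sum: "(\<And>e. e \<in> E \<Longrightarrow> f e \<in> T) \<Longrightarrow> x \<in> {..<m} \<times> {..<n} \<Longrightarrow> y \<in> {..<m} \<times> {..<n} \<Longrightarrow>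
    R (\<Sum>e\<in>E. f e) x y = (\<Sum>e\<in>E. R (f e) x y)"
  by (rule sum_additive_on[OF T_subspace, where f = "\<lambda>t. R t x y"]) (auto simp: R_add)

lemma R_pure: "a \<in> acarr A \<Longrightarrow> b \<in> acarr B \<Longrightarrow> x \<in> {..<m} \<times> {..<n} \<Longrightarrow> y \<in> {..<m} \<times> {..<n} \<Longrightarrow>
    R (pure (acarr B) a b) x y = P a (fst x) (fst y) * Q b (snd x) (snd y)"
  by (auto simp: R_def pure_def restr0_def coef_lin A.P_scale) (simp add: coef_def restr0_def)

lemma acarr_alg_tensor [simp]: "acarr (alg_tensor A B) = T"
  by (simp add: alg_tensor_def)

context
  fixes E :: "'b set" and d :: "'b \<Rightarrow> 'b \<Rightarrow> complex"
  assumes E: "finite E" "E \<subseteq> acarr B"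
    and d: "\<And>e. e \<in> E \<Longrightarrow> d e \<in> lin (acarr B) UNIV"
      "\<And>y. y \<in> acarr B \<Longrightarrow> y = (\<Sum>e\<in>E. d e y *\<^sub>C e)"
begin

lemmas ext_eq = tensor_ext_eq[OF fd_left B.fd E d]
lemmas pure_T = pure_in_tens[OF A.subsp B.subsp]

lemma E_mem: "e \<in> E \<Longrightarrow> e \<in> acarr B"
  using E by blast

lemma coord_mem: "t \<in> T \<Longrightarrow> e \<in> E \<Longrightarrow> t (d e) \<in> acarr A"
  by (rule tens_mem[OF _ d(1)])

lemma amul_tensor_eq:
  assumes s: "s \<in> T" and t: "t \<in> T"
  shows "amul (alg_tensor A B) s t
    = (\<Sum>e'\<in>E. \<Sum>e\<in>E. pure (acarr B) (amul A (s (d e')) (t (d e))) (amul B e' e))"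
proof -
  have inner: "tensor_ext (acarr A) (acarr B) (\<lambda>c e. pure (acarr B) (amul A a c) (amul B b e)) t
      = (\<Sum>e\<in>E. pure (acarr B) (amul A a (t (d e))) (amul B b e))"
    if "a \<in> acarr A" "b \<in> acarr B" for a b
    by (rule ext_eq[OF _ _ _ _ _ t])
      (use that in \<open>simp_all add: A.mul_add_right B.mul_add_right pure_add_left pure_add_right
        A.mul_scale_right B.mul_scale_right pure_scale E_mem d(1)\<close>)
  have "tensor_ext (acarr A) (acarr B)
      (\<lambda>a b. tensor_ext (acarr A) (acarr B) (\<lambda>c e. pure (acarr B) (amul A a c) (amul B b e)) t) s
    = (\<Sum>e'\<in>E. tensor_ext (acarr A) (acarr B) (\<lambda>c e. pure (acarr B) (amul A (s (d e')) c) (amul B e' e)) t)"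
    by (rule ext_eq[OF _ _ _ _ _ s])
      (simp_all add: inner E_mem coord_mem t A.mul_add_left B.mul_add_left pure_add_left pure_add_right
        A.mul_scale_left B.mul_scale_left pure_scale sum.distrib d(1))
  also have "\<dots> = (\<Sum>e'\<in>E. \<Sum>e\<in>E. pure (acarr B) (amul A (s (d e')) (t (d e))) (amul B e' e))"
    by (intro sum.cong refl inner coord_mem s E_mem)
  finally show ?thesis by (simp add: alg_tensor_def)
qed

lemma astar_tensor_eq:
  assumes t: "t \<in> T"
  shows "astar (alg_tensor A B) t = (\<Sum>e\<in>E. pure (acarr B) (astar A (t (d e))) (astar B e))"
proof -
  have "tensor_ext (acarr A) (acarr B) (\<lambda>a b. pure (acarr B) (astar A a) (astar B b)) t
      = (\<Sum>e\<in>E. pure (acarr B) (astar A (t (d e))) (astar B e))"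
    by (rule ext_eq[OF _ _ _ _ _ t])
      (simp_all add: A.star_add B.star_add A.star_scale B.star_scale pure_add_left pure_add_right
        pure_scale E_mem d(1))
  then show ?thesis by (simp add: alg_tensor_def)
qed

lemma R_eq:
  assumes t: "t \<in> T" and xy: "x \<in> {..<m} \<times> {..<n}" "y \<in> {..<m} \<times> {..<n}"
  shows "R t x y = (\<Sum>e\<in>E. P (t (d e)) (fst x) (fst y) * Q e (snd x) (snd y))"
proof -
  have "R t x y = R (\<Sum>e\<in>E. pure (acarr B) (t (d e)) e) x y"
    using tens_expand[OF fd_left B.fd E d t] by simp
  also have "\<dots> = (\<Sum>e\<in>E. R (pure (acarr B) (t (d e)) e) x y)"
    by (rule R_sum) (use xy t in \<open>auto intro: pure_T coord_mem E_mem\<close>)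
  also have "\<dots> = (\<Sum>e\<in>E. P (t (d e)) (fst x) (fst y) * Q e (snd x) (snd y))"
    using xy t by (intro sum.cong refl R_pure coord_mem E_mem)
  finally show ?thesis .
qed

lemma amul_tensor_mem: "s \<in> T \<Longrightarrow> t \<in> T \<Longrightarrow> amul (alg_tensor A B) s t \<in> T"
  by (simp add: amul_tensor_eq coord_mem E_mem pure_T cvs.subspace_sum[OF T_subspace])

lemma astar_tensor_mem: "t \<in> T \<Longrightarrow> astar (alg_tensor A B) t \<in> T"
  by (simp add: astar_tensor_eq coord_mem E_mem pure_T cvs.subspace_sum[OF T_subspace])

lemma R_mul:
  assumes s: "s \<in> T" and t: "t \<in> T" and xy: "x \<in> {..<m} \<times> {..<n}" "y \<in> {..<m} \<times> {..<n}"
  shows "R (amul (alg_tensor A B) s t) x y = (\<Sum>z\<in>{..<m} \<times> {..<n}. R s x z * R t z y)"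
proof -
  let ?F = "\<lambda>w z. (P (s (d (fst w))) (fst x) (fst z) * Q (fst w) (snd x) (snd z))
    * (P (t (d (snd w))) (fst z) (fst y) * Q (snd w) (snd z) (snd y))"
  have "R (amul (alg_tensor A B) s t) x y
      = R (\<Sum>w\<in>E \<times> E. pure (acarr B) (amul A (s (d (fst w))) (t (d (snd w)))) (amul B (fst w) (snd w))) x y"
    by (simp add: amul_tensor_eq[OF s t] sum_Times)
  also have "\<dots>
    = (\<Sum>w\<in>E \<times> E. R (pure (acarr B) (amul A (s (d (fst w))) (t (d (snd w)))) (amul B (fst w) (snd w))) x y)"
    by (rule R_sum) (use xy s t in \<open>auto intro!: pure_T coord_mem A.mulc B.mulc intro: E_mem\<close>)
  also have "\<dots> = (\<Sum>w\<in>E \<times> E. \<Sum>z\<in>{..<m} \<times> {..<n}. ?F w z)"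
  proof (rule sum.cong[OF refl])
    fix w assume "w \<in> E \<times> E"
    then have w: "fst w \<in> E" "snd w \<in> E" by auto
    have "R (pure (acarr B) (amul A (s (d (fst w))) (t (d (snd w)))) (amul B (fst w) (snd w))) x y
      = (\<Sum>k<m. P (s (d (fst w))) (fst x) k * P (t (d (snd w))) k (fst y))
        * (\<Sum>l<n. Q (fst w) (snd x) l * Q (snd w) l (snd y))"
      using xy s t w by (subst R_pure) (auto simp: A.mulc B.mulc coord_mem E_mem A.P_mul B.P_mul)
    also have "\<dots> = (\<Sum>z\<in>{..<m} \<times> {..<n}. (P (s (d (fst w))) (fst x) (fst z) * P (t (d (snd w))) (fst z) (fst y))
        * (Q (fst w) (snd x) (snd z) * Q (snd w) (snd z) (snd y)))"
      by (simp add: sum_product sum_Times)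
    also have "\<dots> = (\<Sum>z\<in>{..<m} \<times> {..<n}. ?F w z)"
      by (intro sum.cong refl) (simp only: mult_ac)
    finally show "R (pure (acarr B) (amul A (s (d (fst w))) (t (d (snd w)))) (amul B (fst w) (snd w))) x y
      = (\<Sum>z\<in>{..<m} \<times> {..<n}. ?F w z)" .
  qed
  also have "\<dots> = (\<Sum>z\<in>{..<m} \<times> {..<n}. \<Sum>w\<in>E \<times> E. ?F w z)" by (rule sum.swap)
  also have "\<dots> = (\<Sum>z\<in>{..<m} \<times> {..<n}. R s x z * R t z y)"
    using xy by (intro sum.cong refl) (simp add: R_eq[OF s] R_eq[OF t] sum_product sum_Times)
  finally show ?thesis .
qed

lemma R_star:
  assumes t: "t \<in> T" and xy: "x \<in> {..<m} \<times> {..<n}" "y \<in> {..<m} \<times> {..<n}"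
  shows "R (astar (alg_tensor A B) t) x y = cnj (R t y x)"
proof -
  have "R (astar (alg_tensor A B) t) x y
      = (\<Sum>e\<in>E. R (pure (acarr B) (astar A (t (d e))) (astar B e)) x y)"
    unfolding astar_tensor_eq[OF t]
    by (rule R_sum) (use xy t in \<open>auto intro!: pure_T coord_mem A.starc B.starc intro: E_mem\<close>)
  also have "\<dots> = (\<Sum>e\<in>E. cnj (P (t (d e)) (fst y) (fst x) * Q e (snd y) (snd x)))"
    using xy t by (intro sum.cong refl, subst R_pure)
      (auto simp: coord_mem E_mem A.starc B.starc A.P_star B.P_star)
  finally show ?thesis using xy by (simp add: R_eq[OF t])
qed

text \<open>For injectivity, \<open>P\<close> detects each value of \<open>t\<close> at a
  coefficient functional, and these values determine \<open>t\<close>. The star algebra laws of the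
  tensor product then follow from \<open>star_rep\<close>.\<close>

lemma star_rep_tensor_coordinates: "star_rep (alg_tensor A B) ({..<m} \<times> {..<n}) R"
proof (unfold_locales, unfold acarr_alg_tensor)
  show "cvs.subspace T" by (rule T_subspace)
  show "aone (alg_tensor A B) \<in> T" by (simp add: alg_tensor_def pure_T A.onec B.onec)
next
  fix c t x y assume "t \<in> T" "x \<in> {..<m} \<times> {..<n}" "y \<in> {..<m} \<times> {..<n}"
  then show "R (c *\<^sub>C t) x y = c * R t x y"
    by (auto simp: R_def scaleC_fun_def A.P_scale tens_mem coef_lin)
next
  fix x y assume "x \<in> {..<m} \<times> {..<n}" "y \<in> {..<m} \<times> {..<n}"
  then show "R (aone (alg_tensor A B)) x y = (if x = y then 1 else 0)"
    by (simp add: alg_tensor_def R_pure A.onec B.onec) (auto simp: A.P_one B.P_one split: if_splits)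
next
  fix t assume t: "t \<in> T"
    and 0: "\<And>x y. x \<in> {..<m} \<times> {..<n} \<Longrightarrow> y \<in> {..<m} \<times> {..<n} \<Longrightarrow> R t x y = 0"
  have "t (coef c d) = 0" if cd: "c < n" "d < n" for c d
  proof (rule A.P_inj)
    show "t (coef c d) \<in> acarr A" by (rule tens_mem[OF t coef_lin[OF cd]])
    fix i j assume "i \<in> {..<m}" "j \<in> {..<m}"
    then show "P (t (coef c d)) i j = 0" using 0[of "(i, c)" "(j, d)"] cd by (simp add: R_def)
  qed
  then show "t = 0" using cvs.subspace_0[OF T_subspace] by (intro tens_eqI[OF t]) auto
qed (auto simp: R_add R_mul R_star amul_tensor_mem astar_tensor_mem)

end

lemma star_rep_tensor: "star_rep (alg_tensor A B) ({..<m} \<times> {..<n}) R"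
proof -
  obtain E d where "finite E" "E \<subseteq> acarr B" "\<And>e. e \<in> E \<Longrightarrow> d e \<in> lin (acarr B) UNIV"
    "\<And>y. y \<in> acarr B \<Longrightarrow> y = (\<Sum>e\<in>E. d e y *\<^sub>C e)"
    using fd_space_coordinates[OF B.fd] by metis
  then show ?thesis by (rule star_rep_tensor_coordinates)
qed

sublocale C: star_rep "alg_tensor A B" "{..<m} \<times> {..<n}" R
  by (rule star_rep_tensor)

section \<open>The injective tensor norm is the operator norm of \<open>R\<close>\<close>

lemma mnorm_tensor_value:
  assumes F: "F \<in> mats N T" and g: "g \<in> mats k (lin (acarr B) UNIV)"
  shows "mnorm (mat_os N (os_of A)) k (amp (\<lambda>h i j. F i j h) g)
    = gnorm (({..<k} \<times> {..<N}) \<times> {..<m}) (\<lambda>x y.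
        P (F (snd (fst x)) (snd (fst y)) (g (fst (fst x)) (fst (fst y)))) (snd x) (snd y))"
proof -
  have L: "cvs.subspace (lin (acarr B) (UNIV :: complex set))"
    by (intro lin_subspace B.subsp cvs.subspace_UNIV)
  have F0: "F i j 0 = 0" for i j
    using F lin_zero[OF _ L] by (cases "i < N \<and> j < N") (auto simp: mats_def tens_def)
  let ?z = "amp (\<lambda>h i j. F i j h) g"
  have z: "?z \<in> mats k (mats N (acarr A))"
  proof -
    have "?z i j \<in> mats N (acarr A)" if "i < k" "j < k" for i j
      using F g that by (auto simp: mats_def amp_def intro!: tens_mem)
    moreover have "?z i j = 0" if "\<not> (i < k \<and> j < k)" for i j
    proof -
      have "g i j = 0" using g that by (auto simp: mats_def)
      then show ?thesis by (intro ext) (simp add: amp_def F0)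
    qed
    ultimately show ?thesis by (simp add: mats_def)
  qed
  have "mnorm (mat_os N (os_of A)) k ?z = mnorm (os_of A) (k * N) (Defs.flatten N ?z)"
    using z by (simp add: mat_os_def restr0_def)
  also have "\<dots> = gnorm ({..<k * N} \<times> {..<m}) (matrep P (Defs.flatten N ?z))"
    by (rule A.mnorm_mats[OF fd_left flatten_mats[OF z]])
  also have "\<dots> = gnorm (({..<k} \<times> {..<N}) \<times> {..<m}) (\<lambda>x y.
        P (F (snd (fst x)) (snd (fst y)) (g (fst (fst x)) (fst (fst y)))) (snd x) (snd y))"
    unfolding matrep_def by (subst gnorm_flatten_Times) (simp_all add: amp_def)
  finally show ?thesis .
qed

text \<open>The matrix \<open>F\<close> over \<open>A \<otimes> B\<close> is read as the \<open>Nm \<times> Nm\<close> matrix over \<open>B\<close> whose entries are the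
  \<open>B\<close>-valued matrix coefficients of \<open>F\<close> in the representation \<open>P\<close> of \<open>A\<close>. Applying \<open>g\<close> to its
  entries is contractive by definition of the norm of \<open>g\<close>.\<close>

lemma mnorm_tensor_value_le:
  assumes F: "F \<in> mats N T" and g: "g \<in> mats k (lin (acarr B) UNIV)"
    and le: "mnorm (dual (os_of B)) k g \<le> 1"
  shows "mnorm (mat_os N (os_of A)) k (amp (\<lambda>h i j. F i j h) g)
    \<le> gnorm ({..<N} \<times> ({..<m} \<times> {..<n})) (matrep R F)"
proof -
  obtain E d where E: "finite E" "E \<subseteq> acarr B" and d: "\<And>e. e \<in> E \<Longrightarrow> d e \<in> lin (acarr B) UNIV"
    "\<And>y. y \<in> acarr B \<Longrightarrow> y = (\<Sum>e\<in>E. d e y *\<^sub>C e)"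
    using fd_space_coordinates[OF B.fd] by metis
  \<comment> \<open>The \<open>(a, b)\<close> coefficient of \<open>F i j\<close> is a functional on
    the dual of \<open>B\<close>; \<open>z i j a b\<close> is the element of \<open>B\<close>
    representing it, as \<open>fz\<close> confirms.\<close>
  define z where "z i j a b = (if i < N \<and> j < N \<and> a < m \<and> b < m
    then (\<Sum>e\<in>E. P (F i j (d e)) a b *\<^sub>C e) else 0)" for i j a b
  have zm: "z \<in> mats N (mats m (acarr B))"
    using E by (auto simp: mats_def z_def fun_eq_iff intro!: cvs.subspace_sum cvs.subspace_scale B.subsp)
  have fz: "f (z i j a b) = P (F i j f) a b"
    if f: "f \<in> lin (acarr B) UNIV" and r: "i < N" "j < N" "a < m" "b < m" for f :: "'b \<Rightarrow> complex" and i j a b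
  proof -
    have FT: "F i j \<in> T" using F r by (simp add: mats_def)
    have "f (z i j a b) = (\<Sum>e\<in>E. f (P (F i j (d e)) a b *\<^sub>C e))"
      using r E by (simp add: z_def) (intro sum_additive_on[OF B.subsp], auto simp: lin_add[OF f]
        intro!: cvs.subspace_scale B.subsp)
    also have "\<dots> = (\<Sum>e\<in>E. P (f e *\<^sub>C F i j (d e)) a b)"
      using r E FT d(1) by (intro sum.cong refl) (auto simp: lin_scale[OF f] A.P_scale tens_mem subset_iff)
    also have "\<dots> = P (\<Sum>e\<in>E. f e *\<^sub>C F i j (d e)) a b"
      using r by (intro A.P_sum[symmetric] cvs.subspace_scale[OF A.subsp] tens_mem[OF FT] d(1)) auto
    also have "(\<Sum>e\<in>E. f e *\<^sub>C F i j (d e)) = F i j f"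
      by (rule tens_apply[OF fd_left B.fd E d FT f, symmetric])
    finally show ?thesis .
  qed
  have glin: "g p q \<in> lin (acarr B) UNIV" if "p < k" "q < k" for p q
    using g that by (simp add: mats_def)
  let ?y = "Defs.flatten m z"
  have "mnorm (mat_os N (os_of A)) k (amp (\<lambda>h i j. F i j h) g)
    = gnorm (({..<k} \<times> {..<N}) \<times> {..<m}) (\<lambda>x y.
        g (fst (fst x)) (fst (fst y)) (z (snd (fst x)) (snd (fst y)) (snd x) (snd y)))"
    unfolding mnorm_tensor_value[OF F g]
    by (rule gnorm_cong) (auto simp: fz glin)
  \<comment> \<open>The index of \<open>g\<close> moves to the last place, so that the rest is one
    matrix over \<open>B\<close> to which the norm bound of \<open>g\<close> applies.\<close>
  also have "\<dots> = gnorm (({..<N} \<times> {..<m}) \<times> {..<k}) (\<lambda>x y.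
        g (snd x) (snd y) (z (fst (fst x)) (fst (fst y)) (snd (fst x)) (snd (fst y))))"
  proof -
    have "bij_betw (\<lambda>((i, a), p). ((p, i), a)) (({..<N} \<times> {..<m}) \<times> {..<k}) (({..<k} \<times> {..<N}) \<times> {..<m})"
      by (rule bij_betw_byWitness[where f' = "\<lambda>((p, i), a). ((i, a), p)"]) auto
    from gnorm_reindex[OF this] show ?thesis by (simp add: case_prod_unfold)
  qed
  also have "\<dots> = gnorm ({..<N * m} \<times> {..<k}) (\<lambda>x y. g (snd x) (snd y) (?y (fst x) (fst y)))"
    using gnorm_flatten_Times[of "{..<k}" N m "\<lambda>v p q. g p q v" z] by simp
  also have "\<dots> \<le> mnorm (os_of B) (N * m) ?y"
    using le flatten_mats[OF zm] unfolding B.mnorm_dual_le_1_iff[OF g] by blast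
  also have "\<dots> = gnorm ({..<N * m} \<times> {..<n}) (matrep Q ?y)"
    by (rule B.mnorm_mats[OF B.fd flatten_mats[OF zm]])
  also have "\<dots> = gnorm (({..<N} \<times> {..<m}) \<times> {..<n}) (\<lambda>x y.
        Q (z (fst (fst x)) (fst (fst y)) (snd (fst x)) (snd (fst y))) (snd x) (snd y))"
    unfolding matrep_def by (rule gnorm_flatten_Times) simp
  also have "\<dots> = gnorm (({..<N} \<times> {..<m}) \<times> {..<n}) (\<lambda>x y.
        matrep R F (fst (fst x), (snd (fst x), snd x)) (fst (fst y), (snd (fst y), snd y)))"
  proof (rule gnorm_cong)
    fix x y assume xy: "x \<in> ({..<N} \<times> {..<m}) \<times> {..<n}" "y \<in> ({..<N} \<times> {..<m}) \<times> {..<n}"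
    then have "z (fst (fst x)) (fst (fst y)) (snd (fst x)) (snd (fst y)) \<in> acarr B"
      using zm by (auto simp: mats_def)
    then have "Q (z (fst (fst x)) (fst (fst y)) (snd (fst x)) (snd (fst y))) (snd x) (snd y)
        = coef (snd x) (snd y) (z (fst (fst x)) (fst (fst y)) (snd (fst x)) (snd (fst y)))"
      by (simp add: coef_def restr0_def)
    also have "\<dots> = matrep R F (fst (fst x), (snd (fst x), snd x)) (fst (fst y), (snd (fst y), snd y))"
      using xy by (auto simp: fz coef_lin matrep_def R_def)
    finally show "Q (z (fst (fst x)) (fst (fst y)) (snd (fst x)) (snd (fst y))) (snd x) (snd y)
        = matrep R F (fst (fst x), (snd (fst x), snd x)) (fst (fst y), (snd (fst y), snd y))" .
  qed
  also have "\<dots> = gnorm ({..<N} \<times> ({..<m} \<times> {..<n})) (matrep R F)"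
  proof -
    have "bij_betw (\<lambda>((i, a), c). (i, (a, c))) (({..<N} \<times> {..<m}) \<times> {..<n}) ({..<N} \<times> ({..<m} \<times> {..<n}))"
      by (rule bij_betw_byWitness[where f' = "\<lambda>(i, (a, c)). ((i, a), c)"]) auto
    from gnorm_reindex[OF this] show ?thesis by (simp add: case_prod_unfold)
  qed
  finally show ?thesis .
qed

text \<open>The bound is attained at the matrix of coefficient functionals of the representation \<open>Q\<close>.\<close>

lemma mnorm_tensor_value_attained:
  assumes F: "F \<in> mats N T"
  obtains g where "g \<in> mats n (lin (acarr B) UNIV)" "mnorm (dual (os_of B)) n g \<le> 1"
    "mnorm (mat_os N (os_of A)) n (amp (\<lambda>h i j. F i j h) g)
      = gnorm ({..<N} \<times> ({..<m} \<times> {..<n})) (matrep R F)"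
proof -
  define g where "g c d = (if c < n \<and> d < n then coef c d else 0)" for c d
  have g: "g \<in> mats n (lin (acarr B) UNIV)" by (auto simp: mats_def g_def coef_lin)
  have "gnorm ({..<k} \<times> {..<n}) (\<lambda>p q. g (snd p) (snd q) (x (fst p) (fst q))) \<le> mnorm (os_of B) k x"
    if x: "x \<in> mats k (acarr B)" for k x
  proof -
    have "gnorm ({..<k} \<times> {..<n}) (\<lambda>p q. g (snd p) (snd q) (x (fst p) (fst q)))
        = gnorm ({..<k} \<times> {..<n}) (matrep Q x)"
      by (rule gnorm_cong) (use x in \<open>auto simp: g_def coef_def restr0_def matrep_def mats_def\<close>)
    then show ?thesis using B.mnorm_mats[OF B.fd x] by simp
  qed
  then have le: "mnorm (dual (os_of B)) n g \<le> 1" by (simp add: B.mnorm_dual_le_1_iff[OF g])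
  have "mnorm (mat_os N (os_of A)) n (amp (\<lambda>h i j. F i j h) g)
    = gnorm (({..<n} \<times> {..<N}) \<times> {..<m}) (\<lambda>x y. matrep R F
        (snd (fst x), (snd x, fst (fst x))) (snd (fst y), (snd y, fst (fst y))))"
    unfolding mnorm_tensor_value[OF F g]
    by (rule gnorm_cong) (auto simp: g_def matrep_def R_def)
  also have "\<dots> = gnorm ({..<N} \<times> ({..<m} \<times> {..<n})) (matrep R F)"
  proof -
    have "bij_betw (\<lambda>((c, i), a). (i, (a, c))) (({..<n} \<times> {..<N}) \<times> {..<m}) ({..<N} \<times> ({..<m} \<times> {..<n}))"
      by (rule bij_betw_byWitness[where f' = "\<lambda>(i, (a, c)). ((c, i), a)"]) auto
    from gnorm_reindex[OF this] show ?thesis by (simp add: case_prod_unfold)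
  qed
  finally show ?thesis by (rule that[OF g le])
qed

text \<open>\<open>inj_tensor\<close> takes its carrier from \<open>tens\<close> and its norms from
  \<open>CB\<close>, which vanish off matrices over the carrier of \<open>CB\<close>; this
  identifies the two carriers.\<close>

lemma carr_CB_dual: "{t \<in> lin (carr (dual (os_of B))) (carr (os_of A)). bdd_above (cb_values (dual
  (os_of B)) (os_of A) t)} = T"
proof -
  have "bdd_above (cb_values (dual (os_of B)) (os_of A) t)" if t: "t \<in> T" for t
  proof (rule bdd_aboveI)
    fix v assume "v \<in> cb_values (dual (os_of B)) (os_of A) t"
    then obtain k g where v: "v = mnorm (os_of A) k (amp t g)" and g: "g \<in> mats k (lin (acarr B) UNIV)"
      "mnorm (dual (os_of B)) k g \<le> 1" by (auto simp: cb_values_def B.carr_dual)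
    have t': "t \<in> lin (lin (acarr B) UNIV) (acarr A)" using t by (simp add: tens_def)
    have "amp t g \<in> mats k (acarr A)"
      by (rule amp_mats[OF t' _ g(1)]) (intro lin_subspace B.subsp cvs.subspace_UNIV)
    then have "v = gnorm ({..<k} \<times> {..<m}) (\<lambda>x y. P (t (g (fst x) (fst y))) (snd x) (snd y))"
      unfolding v by (simp add: A.mnorm_mats[OF fd_left] matrep_def amp_def)
    \<comment> \<open>Rewritten as the case \<open>N = 1\<close> of the preceding estimate.\<close>
    also have "\<dots> = gnorm (({..<k} \<times> {..<1}) \<times> {..<m}) (\<lambda>x y.
        P (single t (snd (fst x)) (snd (fst y)) (g (fst (fst x)) (fst (fst y)))) (snd x) (snd y))"
    proof -
      have "bij_betw (\<lambda>((p, i), a). (p, a)) (({..<k} \<times> {..<1::nat}) \<times> {..<m}) ({..<k} \<times> {..<m})"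
        by (rule bij_betw_byWitness[where f' = "\<lambda>(p, a). ((p, 0), a)"]) auto
      from gnorm_reindex[OF this] have "gnorm ({..<k} \<times> {..<m})
        (\<lambda>x y. P (t (g (fst x) (fst y))) (snd x) (snd y))
        = gnorm (({..<k} \<times> {..<1::nat}) \<times> {..<m}) (\<lambda>x y. P (t (g (fst (fst x)) (fst (fst y)))) (snd x) (snd y))"
        by (simp add: case_prod_unfold)
      also have "\<dots> = gnorm (({..<k} \<times> {..<1}) \<times> {..<m}) (\<lambda>x y.
        P (single t (snd (fst x)) (snd (fst y)) (g (fst (fst x)) (fst (fst y)))) (snd x) (snd y))"
        by (rule gnorm_cong) (auto simp: single_def)
      finally show ?thesis .
    qed
    also have "\<dots> \<le> gnorm ({..<1} \<times> ({..<m} \<times> {..<n})) (matrep R (single t))"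
      using mnorm_tensor_value_le[OF single_in_mats[OF t] g]
      unfolding mnorm_tensor_value[OF single_in_mats[OF t] g(1)] .
    finally show "v \<le> gnorm ({..<1} \<times> ({..<m} \<times> {..<n})) (matrep R (single t))" .
  qed
  then show ?thesis by (auto simp: B.carr_dual tens_def)
qed

lemma os_of_tensor: "os_of (alg_tensor A B) = os_of A \<otimes>\<^sub>i os_of B"
proof -
  have "mnorm (CB (dual (os_of B)) (os_of A)) N F = mnorm (os_of (alg_tensor A B)) N F" for N F
  proof (cases "F \<in> mats N T")
    case False
    then show ?thesis
      using T_fd by (simp add: CB_def carr_CB_dual[unfolded carr_os_of] Let_def restr0_def C.mnorm_os_of)
  next
    case True
    let ?G = "\<lambda>h i j. F i j h"
    have "mnorm (CB (dual (os_of B)) (os_of A)) N F = Sup (cb_values (dual (os_of B)) (mat_os N (os_of A)) ?G)"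
      using True by (simp add: CB_def carr_CB_dual[unfolded carr_os_of] Let_def restr0_def)
    also have "\<dots> = gnorm ({..<N} \<times> ({..<m} \<times> {..<n})) (matrep R F)"
    proof (rule cSup_eq_maximum)
      obtain g where "g \<in> mats n (lin (acarr B) UNIV)" "mnorm (dual (os_of B)) n g \<le> 1"
        "mnorm (mat_os N (os_of A)) n (amp ?G g) = gnorm ({..<N} \<times> ({..<m} \<times> {..<n})) (matrep R F)"
        using mnorm_tensor_value_attained[OF True] by blast
      then show "gnorm ({..<N} \<times> ({..<m} \<times> {..<n})) (matrep R F)
          \<in> cb_values (dual (os_of B)) (mat_os N (os_of A)) ?G"
        unfolding cb_values_def B.carr_dual by (intro CollectI exI[of _ n] exI[of _ g]) simp
      fix v assume "v \<in> cb_values (dual (os_of B)) (mat_os N (os_of A)) ?G"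
      then show "v \<le> gnorm ({..<N} \<times> ({..<m} \<times> {..<n})) (matrep R F)"
        using mnorm_tensor_value_le[OF True] by (auto simp: cb_values_def B.carr_dual)
    qed
    also have "\<dots> = mnorm (os_of (alg_tensor A B)) N F"
      using C.mnorm_mats[of F N] T_fd True by simp
    finally show ?thesis .
  qed
  then have "mnorm (CB (dual (os_of B)) (os_of A)) = mnorm (os_of (alg_tensor A B))" by (simp add: fun_eq_iff)
  then show ?thesis by (simp add: inj_tensor_def)
qed

lemma fd_vn_tensor: "fd_vn_algebra (alg_tensor A B)"
proof (rule fd_vn_algebraI[OF star_rep_tensor])
  show "fd_space (acarr (alg_tensor A B))" using T_fd by simp
  fix t assume t: "t \<in> acarr (alg_tensor A B)"
  have "anorm (alg_tensor A B) t = vnorm (os_of (alg_tensor A B)) t"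
    unfolding os_of_tensor by (simp add: alg_tensor_def)
  also have "\<dots> = gnorm ({..<m} \<times> {..<n}) (R t)"
    using t T_fd by (intro C.vnorm_os_of) simp_all
  finally show "anorm (alg_tensor A B) t = gnorm ({..<m} \<times> {..<n}) (R t)" .
qed

section \<open>Product functionals and the distinguished set of the tensor product\<close>

lemma functional_tensor_eq:
  assumes f: "f \<in> lin (acarr A) UNIV" and g: "g \<in> lin (acarr B) UNIV" and t: "t \<in> T"
  shows "functional_tensor (os_of A) (os_of B) f g t = f (t g)"
proof -
  obtain E d where E: "finite E" "E \<subseteq> acarr B" and d: "\<And>e. e \<in> E \<Longrightarrow> d e \<in> lin (acarr B) UNIV"
    "\<And>y. y \<in> acarr B \<Longrightarrow> y = (\<Sum>e\<in>E. d e y *\<^sub>C e)"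
    using fd_space_coordinates[OF B.fd] by metis
  have "functional_tensor (os_of A) (os_of B) f g t = (\<Sum>e\<in>E. f (t (d e)) * g e)"
    unfolding functional_tensor_def carr_os_of
    by (rule tensor_ext_eq[OF fd_left B.fd E d _ _ _ t])
      (simp_all add: lin_add[OF f] lin_add[OF g] lin_scale[OF f] lin_scale[OF g] algebra_simps)
  also have "\<dots> = (\<Sum>e\<in>E. f (g e *\<^sub>C t (d e)))"
    using t d(1) by (intro sum.cong refl) (simp add: lin_scale[OF f] tens_mem)
  also have "\<dots> = f (\<Sum>e\<in>E. g e *\<^sub>C t (d e))"
    by (rule sum_additive_on[OF A.subsp, symmetric])
      (auto simp: lin_add[OF f] intro: cvs.subspace_scale[OF A.subsp tens_mem[OF t d(1)]])
  also have "(\<Sum>e\<in>E. g e *\<^sub>C t (d e)) = t g"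
    by (rule tens_apply[OF fd_left B.fd E d t g, symmetric])
  finally show ?thesis .
qed

text \<open>The defining property of the extension yields additivity only; homogeneity comes from
  the formula \<open>f (t g)\<close>.\<close>

lemma functional_tensor_lin:
  assumes f: "f \<in> lin (acarr A) UNIV" and g: "g \<in> lin (acarr B) UNIV"
  shows "functional_tensor (os_of A) (os_of B) f g \<in> lin T UNIV"
proof -
  have "\<exists>!F. extends_pure (acarr A) (acarr B) (\<lambda>x y. f x * g y) F"
    by (rule tensor_universal[OF fd_left B.fd])
      (simp_all add: lin_add[OF f] lin_add[OF g] lin_scale[OF f] lin_scale[OF g] algebra_simps)
  then have "extends_pure (acarr A) (acarr B) (\<lambda>x y. f x * g y) (functional_tensor (os_of A) (os_of B) f g)"
    unfolding functional_tensor_def tensor_ext_def carr_os_of by (rule theI')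
  moreover have "functional_tensor (os_of A) (os_of B) f g (c *\<^sub>C t)
    = c * functional_tensor (os_of A) (os_of B) f g t"
    if t: "t \<in> T" for c t
    using cvs.subspace_scale[OF T_subspace t, of c] t
    by (simp add: functional_tensor_eq[OF f g] scaleC_fun_def lin_scale[OF f] tens_mem g)
  ultimately show ?thesis by (auto simp: lin_def extends_pure_def)
qed

text \<open>Product states separate tensors in two stages: states of \<open>A\<close> show that
  \<open>t r = 0\<close> for every state \<open>r\<close> of \<open>B\<close>, and since these
  states span the dual of \<open>B\<close>, the map \<open>t\<close> vanishes.\<close>

lemma functor_obj_tensor:
  assumes "vn_rep A m P"
  shows "functor_obj (alg_tensor A B) = Q_tensor (functor_obj A) (functor_obj B)"
proof -
  interpret A': vn_rep A m P by fact
  let ?S = "polar (os_of A) {aone A}" and ?S' = "polar (os_of B) {aone B}"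
  let ?Z = "{functional_tensor (os_of A) (os_of B) s r |s r. s \<in> ?S \<and> r \<in> ?S'}"
  \<comment> \<open>A fresh regular representation of the tensor product, for which functionals are
    vector functionals by construction; \<open>os_of\<close> does not depend on the
    representation.\<close>
  obtain d U where U: "vn_rep (alg_tensor A B) d U" by (rule fd_vn_rep[OF fd_vn_tensor])
  interpret U: vn_rep "alg_tensor A B" d U by (rule U)
  have S: "s \<in> lin (acarr A) UNIV" "s (aone A) = 1" if "s \<in> ?S" for s
    using that by (auto simp: polar_def unit_ball_def A'.carr_dual)
  have S': "s \<in> lin (acarr B) UNIV" "s (aone B) = 1" if "s \<in> ?S'" for s
    using that by (auto simp: polar_def unit_ball_def B.carr_dual)
  have one: "aone (alg_tensor A B) = pure (acarr B) (aone A) (aone B)" by (simp add: alg_tensor_def)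
  have "polar_back (os_of (alg_tensor A B)) ?Z = {aone (alg_tensor A B)}"
  proof (rule U.polar_back_separating)
    show "?Z \<subseteq> carr (dual (os_of (alg_tensor A B)))"
      using S S' by (auto simp: U.carr_dual intro!: functional_tensor_lin)
    show "f (aone (alg_tensor A B)) = 1" if f: "f \<in> ?Z" for f
    proof -
      from f obtain s r where sr: "s \<in> ?S" "r \<in> ?S'" "f = functional_tensor (os_of A) (os_of B) s r" by blast
      have "f (aone (alg_tensor A B)) = s (pure (acarr B) (aone A) (aone B) r)"
        using functional_tensor_eq[OF S(1)[OF sr(1)] S'(1)[OF sr(2)]] U.onec sr(3) by (simp add: one)
      also have "\<dots> = 1" using S[OF sr(1)] S'[OF sr(2)] A.onec by (simp add: pure_def restr0_def scaleC_one)
      finally show ?thesis .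
    qed
    fix t assume "t \<in> acarr (alg_tensor A B)" and 0: "\<And>f. f \<in> ?Z \<Longrightarrow> f t = 0"
    then have t: "t \<in> T" by simp
    then have t': "t \<in> lin (lin (acarr B) UNIV) (acarr A)" by (simp add: tens_def)
    have L: "cvs.subspace (lin (acarr B) (UNIV :: complex set))"
      by (intro lin_subspace B.subsp cvs.subspace_UNIV)
    have tr: "t r = 0" if r: "r \<in> ?S'" for r
    proof (rule A'.states_separate)
      show "t r \<in> acarr A" by (rule tens_mem[OF t S'(1)[OF r]])
      fix s assume s: "s \<in> ?S"
      have "functional_tensor (os_of A) (os_of B) s r t = 0" using s r by (intro 0) blast
      then show "s (t r) = 0" using functional_tensor_eq[OF S(1)[OF s] S'(1)[OF r] t] by simp
    qed
    show "t = 0"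
    proof
      fix g :: "'b \<Rightarrow> complex"
      show "t g = 0 g"
      proof (cases "g \<in> lin (acarr B) UNIV")
        case True
        then have "g \<in> cvs.span ?S'" by (rule B.states_span)
        then have "g \<in> lin (acarr B) UNIV \<and> t g = 0"
        proof (induction rule: cvs.span_induct_alt)
          case base
          show ?case using cvs.subspace_0[OF L] lin_zero[OF t' L] by blast
        next
          case (step c x y)
          then have x: "x \<in> lin (acarr B) UNIV" "t x = 0" and y: "y \<in> lin (acarr B) UNIV" "t y = 0"
            using S'(1) tr by blast+
          have cx: "c *\<^sub>C x \<in> lin (acarr B) UNIV" by (rule cvs.subspace_scale[OF L x(1)])
          have "t (c *\<^sub>C x + y) = c *\<^sub>C t x + t y"
            unfolding lin_add[OF t' cx y(1)] lin_scale[OF t' x(1)] ..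
          also have "\<dots> = 0" unfolding x(2) y(2) by simp
          finally show ?case using cvs.subspace_add[OF L cx y(1)] by blast
        qed
        then show ?thesis by simp
      qed (simp add: lin_off[OF t'])
    qed
  qed
  then show ?thesis by (simp add: functor_obj_def Q_tensor_def os_of_tensor)
qed

end

section \<open>Complete positivity in terms of matrices over the algebra\<close>

lemma mat_alg_simps [simp]:
  "acarr (mat_alg n A) = mats n (acarr A)" "amul (mat_alg n A) = amul (mat_star_alg n A)"
  "aone (mat_alg n A) = aone (mat_star_alg n A)" "astar (mat_alg n A) = astar (mat_star_alg n A)"
  by (simp_all add: mat_alg_def)

lemma star_rep_matrices: "star_rep (mat_alg n complex_alg) {..<n} (\<lambda>\<alpha>. \<alpha>)"
proof (unfold_locales, unfold mat_alg_simps)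
  show "x = 0" if x: "x \<in> mats n (acarr complex_alg)" and 0: "\<And>i j. i \<in> {..<n} \<Longrightarrow> j \<in> {..<n} \<Longrightarrow> x i j = 0" for x
  proof (intro ext)
    fix i j
    show "x i j = 0 i j" using x 0[of i j] by (cases "i < n \<and> j < n") (auto simp: mats_def)
  qed
  show "cvs.subspace (mats n (acarr complex_alg))"
    by (intro subspace_mats) (simp add: complex_alg_def)
qed (auto simp: mat_star_alg_def complex_alg_def mats_def scaleC_fun_def)

text \<open>The image of a matrix over \<open>W\<close> under the identification \<open>M\<^sub>n(W) \<cong> M\<^sub>n \<otimes> W\<close>.\<close>

definition mat_tensor :: "'b::complex_vector set \<Rightarrow> (nat \<Rightarrow> nat \<Rightarrow> 'b) \<Rightarrow> ('b \<Rightarrow> complex) \<Rightarrow> nat \<Rightarrow> nat \<Rightarrow>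
  complex" where
  "mat_tensor W x = restr0 (lin W UNIV) (\<lambda>f. amp f x)"

lemma mat_tensor_apply: "f \<in> lin W UNIV \<Longrightarrow> mat_tensor W x f i j = f (x i j)"
  by (simp add: mat_tensor_def restr0_def amp_def)

lemma mat_tensor_mem:
  assumes W: "cvs.subspace W" and x: "x \<in> mats n W"
  shows "mat_tensor W x \<in> tens (mats n UNIV) W"
proof -
  have L: "cvs.subspace (lin W (UNIV :: complex set))"
    by (intro lin_subspace W cvs.subspace_UNIV)
  show ?thesis
    using cvs.subspace_add[OF L] cvs.subspace_scale[OF L] amp_mats[OF _ W x]
    by (auto simp: tens_def lin_def[of "lin W UNIV"] mat_tensor_def restr0_def amp_def fun_eq_iff
      scaleC_fun_def)
qed

lemma mat_tensor_eqI:
  assumes "s \<in> tens (mats n UNIV) W" "t \<in> tens (mats n UNIV) W"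
    and "\<And>f i j. f \<in> lin W UNIV \<Longrightarrow> i < n \<Longrightarrow> j < n \<Longrightarrow> s f i j = t f i j"
  shows "s = t"
proof
  fix f
  show "s f = t f"
  proof (cases "f \<in> lin W UNIV")
    case True
    then have "s f \<in> mats n UNIV" "t f \<in> mats n UNIV"
      using assms(1,2) by (blast intro: tens_value)+
    show ?thesis
    proof (intro ext)
      fix i j
      show "s f i j = t f i j"
        using assms(3)[OF True, of i j] \<open>s f \<in> _\<close> \<open>t f \<in> _\<close> by (cases "i < n \<and> j < n") (auto simp: mats_def)
    qed
  qed (use assms in \<open>simp add: tens_def lin_off\<close>)
qed

context vn_rep
begin

lemma mat_rep_pair: "rep_pair (mat_alg n complex_alg) n (\<lambda>\<alpha>. \<alpha>) A d P"
  by (intro rep_pair.intro star_rep_matrices vn_rep_axioms rep_pair_axioms.intro)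
    (simp add: complex_alg_def fd_space_mats fd_space_complex)

lemma functional_sum:
  assumes f: "f \<in> lin (acarr A) UNIV" and g: "\<And>k. k \<in> K \<Longrightarrow> g k \<in> acarr A"
  shows "f (\<Sum>k\<in>K. g k) = (\<Sum>k\<in>K. f (g k))"
  using g by (intro sum_additive_on[OF subsp]) (auto simp: lin_add[OF f])

lemma mat_tensor_surj:
  assumes t: "t \<in> tens (mats n UNIV) (acarr A)"
  shows "\<exists>x\<in>mats n (acarr A). t = mat_tensor (acarr A) x"
proof -
  obtain E e where E: "finite E" "E \<subseteq> acarr A" and e: "\<And>b. b \<in> E \<Longrightarrow> e b \<in> lin (acarr A) UNIV"
    "\<And>y. y \<in> acarr A \<Longrightarrow> y = (\<Sum>b\<in>E. e b y *\<^sub>C b)"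
    using fd_space_coordinates[OF fd] by blast
  have EA: "b \<in> acarr A" if "b \<in> E" for b using E that by blast
  \<comment> \<open>The entry \<open>x i j\<close> is the element whose coordinates are the
    \<open>(i, j)\<close> entries of \<open>t\<close> at the coordinate functionals.\<close>
  define x where "x i j = (\<Sum>b\<in>E. t (e b) i j *\<^sub>C b)" for i j
  have te: "t (e b) \<in> mats n UNIV" if "b \<in> E" for b
    by (rule tens_value[OF t e(1)[OF that]])
  have x: "x \<in> mats n (acarr A)"
    using te by (auto simp: mats_def x_def intro!: cvs.subspace_sum[OF subsp] cvs.subspace_scale[OF subsp]
        sum.neutral intro: EA)
  have "t = mat_tensor (acarr A) x"
  proof (rule mat_tensor_eqI[OF t mat_tensor_mem[OF subsp x]])
    fix f :: "'a \<Rightarrow> complex" and i j assume f: "f \<in> lin (acarr A) UNIV"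
    have "t f i j = (\<Sum>b\<in>E. f b *\<^sub>C t (e b)) i j"
      using tens_apply[OF fd_space_mats[OF fd_space_complex] fd E e t f] by simp
    also have "\<dots> = f (x i j)"
      by (simp add: sum_fun scaleC_fun_def x_def functional_sum[OF f] EA lin_scale[OF f] mult.commute)
    finally show "t f i j = mat_tensor (acarr A) x f i j" by (simp add: mat_tensor_apply[OF f])
  qed
  then show ?thesis using x by blast
qed

text \<open>\<open>mat_tensor\<close> is a bijection under which \<open>R\<close> and
  \<open>matrep P\<close> give the same matrices. As both representations are faithful, it respects
  product and involution, hence positivity.\<close>

lemma positive_tensor:
  "positive (alg_tensor (mat_alg n complex_alg) A) = mat_tensor (acarr A) ` positive (mat_star_alg n A)"
proof -
  let ?T = "alg_tensor (mat_alg n complex_alg) A" and ?M = "mat_star_alg n A" and ?\<Psi> = "mat_tensor (acarr A)"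
  interpret M: star_rep ?M "{..<n} \<times> {..<d}" "matrep P" by (rule mat_star_rep)
  interpret X: rep_pair "mat_alg n complex_alg" n "\<lambda>\<alpha>. \<alpha>" A d P by (rule mat_rep_pair)
  have "acarr complex_alg = UNIV" by (simp add: complex_alg_def)
  then have T: "acarr ?T = tens (mats n UNIV) (acarr A)" by simp
  have mem: "?\<Psi> x \<in> acarr ?T" if "x \<in> acarr ?M" for x
    using mat_tensor_mem[OF subsp] that by (simp add: T del: X.acarr_alg_tensor)
  have R: "X.R (?\<Psi> x) p q = matrep P x p q"
    if "x \<in> acarr ?M" "p \<in> {..<n} \<times> {..<d}" "q \<in> {..<n} \<times> {..<d}" for x p q
    using that by (auto simp: X.R_def mat_tensor_apply X.coef_lin matrep_def)
      (simp add: X.coef_def restr0_def mats_def)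
  have "amul ?T (astar ?T (?\<Psi> x)) (?\<Psi> x) = ?\<Psi> (amul ?M (astar ?M x) x)" if x: "x \<in> acarr ?M" for x
  proof (rule X.C.P_eqI)
    fix p q assume "p \<in> {..<n} \<times> {..<d}" "q \<in> {..<n} \<times> {..<d}"
    then show "X.R (amul ?T (astar ?T (?\<Psi> x)) (?\<Psi> x)) p q = X.R (?\<Psi> (amul ?M (astar ?M x) x)) p q"
      using mem[OF x] x M.mulc[OF M.starc[OF x] x]
      by (simp only: R X.C.P_mul X.C.P_star X.C.starc M.P_mul M.P_star M.starc cong: sum.cong)
  qed (use mem[OF x] mem[OF M.mulc[OF M.starc[OF x] x]] X.C.mulc X.C.starc in blast)+
  moreover have "acarr ?T = ?\<Psi> ` acarr ?M"
    using mat_tensor_surj mem unfolding T acarr_mat_star_alg by blast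
  ultimately show ?thesis
    unfolding positive_def by (force simp: image_iff)
qed

text \<open>Under the identification with matrices, tensoring \<open>\<phi>\<close> with the
  identity becomes entrywise application; functionals on \<open>W\<close> pulled back along
  \<open>\<phi>\<close> allow entries to be compared.\<close>

lemma tensor_map_mat_tensor:
  assumes \<phi>: "\<phi> \<in> lin (acarr A) W" and W: "cvs.subspace W" and x: "x \<in> mats n (acarr A)"
  shows "tensor_map (mats n UNIV) (acarr A) W id \<phi> (mat_tensor (acarr A) x) = mat_tensor W (amp \<phi> x)"
    (is "?l = ?r")
proof -
  obtain E e where E: "finite E" "E \<subseteq> acarr A" and e: "\<And>b. b \<in> E \<Longrightarrow> e b \<in> lin (acarr A) UNIV"
    "\<And>y. y \<in> acarr A \<Longrightarrow> y = (\<Sum>b\<in>E. e b y *\<^sub>C b)"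
    using fd_space_coordinates[OF fd] by blast
  have EA: "b \<in> acarr A" if "b \<in> E" for b using E that by blast
  have \<phi>W: "\<phi> y \<in> W" if "y \<in> acarr A" for y by (rule lin_mem[OF \<phi> that])
  have xT: "mat_tensor (acarr A) x \<in> tens (mats n UNIV) (acarr A)" by (rule mat_tensor_mem[OF subsp x])
  have eq: "?l = (\<Sum>b\<in>E. pure W (id (mat_tensor (acarr A) x (e b))) (\<phi> b))"
    unfolding tensor_map_def
    by (rule tensor_ext_eq[OF fd_space_mats[OF fd_space_complex] fd E e _ _ _ xT])
      (simp_all add: pure_add_left pure_add_right pure_scale lin_add[OF \<phi>] lin_scale[OF \<phi>] \<phi>W)
  have sub: "cvs.subspace (mats n (UNIV :: complex set))" by (intro subspace_mats cvs.subspace_UNIV)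
  show ?thesis
  proof (rule mat_tensor_eqI)
    show "?l \<in> tens (mats n UNIV) W"
      unfolding eq id_apply
      by (intro cvs.subspace_sum subspace_tens pure_in_tens sub W \<phi>W EA tens_value[OF xT] e(1))
    show "?r \<in> tens (mats n UNIV) W" by (rule mat_tensor_mem[OF W amp_mats[OF \<phi> subsp x]])
    fix f :: "'b \<Rightarrow> complex" and i j assume f: "f \<in> lin W UNIV" and ij: "i < n" "j < n"
    have xij: "x i j \<in> acarr A" using x ij by (simp add: mats_def)
    have f\<phi>: "(\<lambda>y. f (\<phi> y)) \<in> lin (acarr A) UNIV"
      using lin_off[OF \<phi>] lin_zero[OF f W]
      by (auto simp: lin_def lin_add[OF \<phi>] lin_scale[OF \<phi>] lin_add[OF f] lin_scale[OF f] \<phi>W)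
    have "?l f i j = (\<Sum>b\<in>E. f (\<phi> (e b (x i j) *\<^sub>C b)))"
      unfolding eq using f
      by (simp add: sum_fun pure_def restr0_def scaleC_fun_def mat_tensor_apply e(1) lin_scale[OF \<phi>]
          lin_scale[OF f] \<phi>W EA mult.commute)
    also have "\<dots> = f (\<phi> (\<Sum>b\<in>E. e b (x i j) *\<^sub>C b))"
      by (rule functional_sum[OF f\<phi>, symmetric]) (simp add: EA)
    also have "(\<Sum>b\<in>E. e b (x i j) *\<^sub>C b) = x i j" by (rule e(2)[OF xij, symmetric])
    finally show "?l f i j = ?r f i j" by (simp only: mat_tensor_apply[OF f] amp_def)
  qed
qed

lemma mat_tensor_inj:
  assumes x: "x \<in> mats n (acarr A)" and y: "y \<in> mats n (acarr A)"
    and eq: "mat_tensor (acarr A) x = mat_tensor (acarr A) y"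
  shows "x = y"
proof (intro ext)
  fix i j
  show "x i j = y i j"
  proof (cases "i < n \<and> j < n")
    case True
    then have xy: "x i j \<in> acarr A" "y i j \<in> acarr A" using x y by (auto simp: mats_def)
    have "f (x i j - y i j) = 0" if f: "f \<in> lin (acarr A) UNIV" for f :: "'a \<Rightarrow> complex"
      using mat_tensor_apply[OF f, of x i j] mat_tensor_apply[OF f, of y i j] eq
        lin_add[OF f, of "x i j - y i j" "y i j"] xy by simp
    then have "x i j - y i j = 0" by (intro functionals_separate) (use xy in auto)
    then show ?thesis by simp
  qed (use x y in \<open>auto simp: mats_def\<close>)
qed

lemma positive_mats: "x \<in> positive (mat_star_alg n A) \<Longrightarrow> x \<in> mats n (acarr A)"
proof -
  interpret M: star_rep "mat_star_alg n A" "{..<n} \<times> {..<d}" "matrep P" by (rule mat_star_rep)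
  show "x \<in> positive (mat_star_alg n A) \<Longrightarrow> x \<in> mats n (acarr A)"
    using M.mulc M.starc by (auto simp: positive_def)
qed

end

lemma completely_positive_iff:
  assumes "vn_rep A m P" "vn_rep B n Q"
  shows "completely_positive A B \<phi> \<longleftrightarrow> \<phi> \<in> lin (acarr A) (acarr B) \<and>
    (\<forall>k. \<forall>x\<in>positive (mat_star_alg k A). amp \<phi> x \<in> positive (mat_star_alg k B))"
proof -
  interpret A: vn_rep A m P by fact
  interpret B: vn_rep B n Q by fact
  have "tensor_map (mats k UNIV) (acarr A) (acarr B) id \<phi> (mat_tensor (acarr A) x)
      \<in> mat_tensor (acarr B) ` positive (mat_star_alg k B) \<longleftrightarrow> amp \<phi> x \<in> positive (mat_star_alg k B)"
    if \<phi>: "\<phi> \<in> lin (acarr A) (acarr B)" and x: "x \<in> positive (mat_star_alg k A)" for k x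
  proof -
    have xm: "x \<in> mats k (acarr A)" by (rule A.positive_mats[OF x])
    have "mat_tensor (acarr B) (amp \<phi> x) \<in> mat_tensor (acarr B) ` positive (mat_star_alg k B)
        \<longleftrightarrow> amp \<phi> x \<in> positive (mat_star_alg k B)"
      using B.mat_tensor_inj[OF amp_mats[OF \<phi> A.subsp xm] B.positive_mats] by blast
    then show ?thesis by (simp add: A.tensor_map_mat_tensor[OF \<phi> B.subsp xm])
  qed
  then show ?thesis
    unfolding completely_positive_def A.positive_tensor B.positive_tensor by auto
qed

section \<open>Unital complete contractions and completely positive maps\<close>

text \<open>With w = a v and s the adjoint of \<open>a\<close> applied to w, the squared norm of v -
  s is |v|^2 - 2 |w|^2 + |s|^2, and |s| \<le> |w| for a contraction \<open>a\<close>.\<close>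

lemma (in star_rep) norm_one_minus_square_le:
  assumes fd: "fd_space (acarr A)" and a: "a \<in> acarr A" and le: "gnorm I (P a) \<le> 1"
  shows "gnorm I (P (aone A - amul A (astar A a) a)) \<le> 1"
proof (rule gnorm_le_mulv)
  fix v
  let ?w = "mulv I (P a) v"
  define s where "s i = (\<Sum>k\<in>I. cnj (P a k i) * ?w k)" for i
  have "mulv I (P (aone A - amul A (astar A a) a)) v i = v i - s i" if i: "i \<in> I" for i
  proof -
    have "mulv I (P (aone A - amul A (astar A a) a)) v i
        = (\<Sum>j\<in>I. if j = i then v i else 0) - (\<Sum>j\<in>I. \<Sum>k\<in>I. cnj (P a k i) * (P a k j * v j))"
      unfolding mulv_def sum_subtractf[symmetric]
      using i a by (intro sum.cong refl)
        (auto simp: P_diff closed P_one P_mul P_star left_diff_distrib sum_distrib_right mult.assoc)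
    also have "(\<Sum>j\<in>I. \<Sum>k\<in>I. cnj (P a k i) * (P a k j * v j)) = s i"
      by (subst sum.swap) (simp add: s_def mulv_def sum_distrib_left)
    finally show ?thesis using i fin by (simp add: sum.delta)
  qed
  then have eq: "l2 I (mulv I (P (aone A - amul A (astar A a) a)) v) = l2 I (\<lambda>i. v i - s i)"
    by (rule l2_cong)
  have "s = mulv I (\<lambda>i j. cnj (P a j i)) ?w" by (rule ext) (simp add: s_def mulv_def)
  then have "l2 I s \<le> gnorm I (\<lambda>i j. cnj (P a j i)) * l2 I ?w"
    using mulv_bound[OF fin] by simp
  also have "\<dots> \<le> 1 * l2 I ?w" using le by (intro mult_right_mono) (simp_all add: gnorm_adjoint fin)
  finally have s_le: "(l2 I s)\<^sup>2 \<le> (l2 I ?w)\<^sup>2" by (intro power_mono) simp_all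
  have inner: "(\<Sum>i\<in>I. cnj (v i) * s i) = complex_of_real ((l2 I ?w)\<^sup>2)"
  proof -
    have "(\<Sum>i\<in>I. cnj (v i) * s i) = (\<Sum>i\<in>I. \<Sum>k\<in>I. cnj (P a k i * v i) * ?w k)"
      by (simp add: s_def sum_distrib_left mult_ac)
    also have "\<dots> = (\<Sum>k\<in>I. cnj (?w k) * ?w k)"
      by (subst sum.swap) (simp add: mulv_def sum_distrib_right)
    finally show ?thesis by (simp only: l2_power2_complex)
  qed
  have "(l2 I (\<lambda>i. v i - s i))\<^sup>2 = (l2 I v)\<^sup>2 - 2 * Re (\<Sum>i\<in>I. cnj (v i) * s i) + (l2 I s)\<^sup>2"
    unfolding l2_power2 Re_sum sum_distrib_left sum_subtractf[symmetric] sum.distrib[symmetric]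
    by (intro sum.cong refl) (simp only: cmod_power2, simp add: power2_eq_square algebra_simps)
  then have "(l2 I (\<lambda>i. v i - s i))\<^sup>2 \<le> (l2 I v)\<^sup>2"
    unfolding inner Re_complex_of_real using s_le zero_le_power2[of "l2 I ?w"] by linarith
  then have "l2 I (\<lambda>i. v i - s i) \<le> l2 I v" by (rule power2_le_imp_le) simp
  then show "l2 I (mulv I (P (aone A - amul A (astar A a) a)) v) \<le> 1 * l2 I v"
    unfolding eq by simp
qed simp

text \<open>\<open>\<psi>\<close> is not assumed to respect adjoints. Because it fixes the unit, the
  estimate for \<open>h + it\<close> passes to the quadratic form of its image, and large
  \<open>t\<close> rules out imaginary values. The map is abstract so that entrywise amplifications
  qualify.\<close>

lemma unital_contraction_hermitian:
  assumes "star_rep A I P" "fd_space (acarr A)" "star_rep B J Q"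
    and mem: "\<And>x. x \<in> acarr A \<Longrightarrow> \<psi> x \<in> acarr B"
    and add: "\<And>x y. x \<in> acarr A \<Longrightarrow> y \<in> acarr A \<Longrightarrow> \<psi> (x + y) = \<psi> x + \<psi> y"
    and scale: "\<And>c x. x \<in> acarr A \<Longrightarrow> \<psi> (c *\<^sub>C x) = c *\<^sub>C \<psi> x"
    and one: "\<psi> (aone A) = aone B"
    and contr: "\<And>x. x \<in> acarr A \<Longrightarrow> gnorm J (Q (\<psi> x)) \<le> gnorm I (P x)"
    and h: "h \<in> acarr A" "astar A h = h"
  shows "astar B (\<psi> h) = \<psi> h"
proof -
  interpret A: star_rep A I P by fact
  interpret B: star_rep B J Q by fact
  interpret CA: cstar_alg A "\<lambda>x. gnorm I (P x)" by unfold_locales (rule A.cstar_norm[OF assms(2)])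
  have \<psi>h: "\<psi> h \<in> acarr B" by (rule mem[OF h(1)])
  have real: "Im (bil J (Q (\<psi> h)) (\<lambda>i. cnj (u i)) u) = 0" for u
  proof -
    define z where "z = bil J (Q (\<psi> h)) (\<lambda>i. cnj (u i)) u"
    define U where "U = (l2 J u)\<^sup>2"
    have bound: "(Im z + t * U)\<^sup>2 \<le> ((gnorm I (P h))\<^sup>2 + t\<^sup>2) * U\<^sup>2" for t
    proof -
      let ?c = "\<i> * complex_of_real t"
      have bil_one: "bil J (Q (aone B)) (\<lambda>i. cnj (u i)) u = complex_of_real U"
        unfolding B.bil_P_one U_def l2_power2_complex ..
      have "\<psi> (h + ?c *\<^sub>C aone A) = \<psi> h + ?c *\<^sub>C aone B"
        using h A.onec by (simp add: add scale one)
      then have "bil J (Q (\<psi> (h + ?c *\<^sub>C aone A))) (\<lambda>i. cnj (u i)) u = z + ?c * complex_of_real U"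
        using \<psi>h B.onec by (simp add: B.bil_P_add B.bil_P_scale bil_one z_def)
      then have "cmod (z + ?c * complex_of_real U)
        \<le> gnorm J (Q (\<psi> (h + ?c *\<^sub>C aone A))) * l2 J (\<lambda>i. cnj (u i)) * l2 J u"
        using gnorm_bound[OF B.fin] by metis
      also have "\<dots> = gnorm J (Q (\<psi> (h + ?c *\<^sub>C aone A))) * U" by (simp add: U_def power2_eq_square)
      also have "\<dots> \<le> gnorm I (P (h + ?c *\<^sub>C aone A)) * U"
        using h by (intro mult_right_mono contr) (auto simp: U_def)
      finally have "(cmod (z + ?c * complex_of_real U))\<^sup>2 \<le> (gnorm I (P (h + ?c *\<^sub>C aone A)) * U)\<^sup>2"
        by (intro power_mono) simp_all
      also have "\<dots> \<le> ((gnorm I (P h))\<^sup>2 + t\<^sup>2) * U\<^sup>2"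
        using CA.norm_add_imaginary[OF h, of t] by (simp add: power_mult_distrib mult_right_mono)
      finally have "(cmod (z + ?c * complex_of_real U))\<^sup>2 \<le> ((gnorm I (P h))\<^sup>2 + t\<^sup>2) * U\<^sup>2" .
      then have "(Re z)\<^sup>2 + (Im z + t * U)\<^sup>2 \<le> ((gnorm I (P h))\<^sup>2 + t\<^sup>2) * U\<^sup>2"
        by (simp add: cmod_power2)
      then show ?thesis using zero_le_power2[of "Re z"] by linarith
    qed
    have "Im z = 0"
    proof (rule ccontr)
      assume z: "Im z \<noteq> 0"
      then have U: "U \<noteq> 0" using bound[of 0] by auto
      \<comment> \<open>Makes the linear term \<open>2 * t * U * Im z\<close> exceed the bound by 1;
        \<open>U\<close> is nonzero because the bound at \<open>t = 0\<close> would otherwise force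
        \<open>Im z = 0\<close>.\<close>
      define t where "t = ((gnorm I (P h))\<^sup>2 * U\<^sup>2 + 1) / (2 * U * Im z)"
      have "2 * t * U * Im z = (gnorm I (P h))\<^sup>2 * U\<^sup>2 + 1" using z U by (simp add: t_def field_simps)
      moreover have "(Im z)\<^sup>2 + 2 * t * U * Im z \<le> (gnorm I (P h))\<^sup>2 * U\<^sup>2"
        using bound[of t] by (simp add: power2_eq_square algebra_simps)
      ultimately show False using zero_le_power2[of "Im z"] by linarith
    qed
    then show ?thesis by (simp add: z_def)
  qed
  show ?thesis
  proof (rule B.P_eqI)
    fix i j assume ij: "i \<in> J" "j \<in> J"
    show "Q (astar B (\<psi> h)) i j = Q (\<psi> h) i j"
      unfolding B.P_star[OF \<psi>h ij] by (rule hermitian_of_real_form[OF B.fin real ij, symmetric])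
  qed (use \<psi>h in auto)
qed

text \<open>After scaling, a positive element is p with ||1 - p|| \<le> 1. A unital contraction
  keeps this inequality and keeps p hermitian, and these two properties suffice for a square root in
  \<open>B\<close>.\<close>

lemma unital_contraction_positive:
  assumes "star_rep A I P" "fd_space (acarr A)" "star_rep B J Q" "fd_space (acarr B)"
    and mem: "\<And>x. x \<in> acarr A \<Longrightarrow> \<psi> x \<in> acarr B"
    and add: "\<And>x y. x \<in> acarr A \<Longrightarrow> y \<in> acarr A \<Longrightarrow> \<psi> (x + y) = \<psi> x + \<psi> y"
    and scale: "\<And>c x. x \<in> acarr A \<Longrightarrow> \<psi> (c *\<^sub>C x) = c *\<^sub>C \<psi> x"
    and one: "\<psi> (aone A) = aone B"
    and contr: "\<And>x. x \<in> acarr A \<Longrightarrow> gnorm J (Q (\<psi> x)) \<le> gnorm I (P x)"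
    and x: "x \<in> positive A"
  shows "\<psi> x \<in> positive B"
proof -
  interpret A: star_rep A I P by fact
  interpret B: star_rep B J Q by fact
  interpret CA: cstar_alg A "\<lambda>x. gnorm I (P x)" by unfold_locales (rule A.cstar_norm[OF assms(2)])
  interpret CB: cstar_alg B "\<lambda>x. gnorm J (Q x)" by unfold_locales (rule B.cstar_norm[OF assms(4)])
  obtain a where a: "a \<in> acarr A" and x: "x = amul A (astar A a) a" using x by (auto simp: positive_def)
  \<comment> \<open>The value 1 for \<open>a = 0\<close> keeps the scaling factor positive.\<close>
  define c where "c = (if a = 0 then 1 else gnorm I (P a))"
  have c: "c > 0" using CA.nonneg[OF a] CA.eq_0_iff[OF a] by (auto simp: c_def less_le)
  define b where "b = complex_of_real (inverse c) *\<^sub>C a"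
  have b: "b \<in> acarr A" using a by (simp add: b_def)
  have b1: "gnorm I (P b) \<le> 1"
    using CA.scale[OF a, of "complex_of_real (inverse c)"] c CA.zero by (auto simp: b_def c_def norm_inverse)
  let ?p = "amul A (astar A b) b"
  have p: "?p \<in> acarr A" "astar A ?p = ?p" using b by (simp_all add: A.star_mul)
  have "gnorm I (P (aone A - ?p)) \<le> 1" by (rule A.norm_one_minus_square_le[OF assms(2) b b1])
  then have "gnorm J (Q (\<psi> (aone A - ?p))) \<le> 1"
    using contr[of "aone A - ?p"] p by simp
  moreover have "\<psi> (aone A - ?p) = aone B - \<psi> ?p"
    using add[of "aone A - ?p" ?p] p one by simp
  ultimately have le: "gnorm J (Q (aone B - \<psi> ?p)) \<le> 1" by simp
  have \<psi>p: "\<psi> ?p \<in> acarr B" by (rule mem[OF p(1)])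
  have "astar B (\<psi> ?p) = \<psi> ?p"
    by (rule unital_contraction_hermitian[OF assms(1-3) mem add scale one contr p])
  then obtain r where r: "r \<in> acarr B" "amul B (astar B r) r = \<psi> ?p"
    using CB.hermitian_square_root[OF \<psi>p _ le] by blast
  have "a = complex_of_real c *\<^sub>C b" using c by (simp add: b_def scaleC_scaleC scaleC_one)
  then have "x = (complex_of_real c * complex_of_real c) *\<^sub>C ?p"
    using b by (simp add: x A.star_scale A.mul_scale_left A.mul_scale_right scaleC_scaleC)
  then have "\<psi> x = (complex_of_real c * complex_of_real c) *\<^sub>C amul B (astar B r) r"
    using scale[OF p(1)] r by simp
  also have "\<dots> = amul B (astar B (complex_of_real c *\<^sub>C r)) (complex_of_real c *\<^sub>C r)"
    using r by (simp add: B.star_scale B.mul_scale_left B.mul_scale_right scaleC_scaleC)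
  finally show ?thesis using r by (auto simp: positive_def)
qed

section \<open>From complete positivity to complete contractivity\<close>

lemma sum_lessThan_add: "(\<Sum>i<m + n. f i) = (\<Sum>i<m. f i) + (\<Sum>i<n. f (m + i :: nat) :: 'x::comm_monoid_add)"
  by (induction n) (simp_all add: add.assoc)

lemma sum_two_blocks:
  fixes n :: nat
  shows "(\<Sum>x\<in>{..<n + n} \<times> J. f x)
    = (\<Sum>x\<in>{..<n} \<times> J. f x) + (\<Sum>x\<in>{..<n} \<times> J. f (n + fst x, snd x) :: 'x::comm_monoid_add)"
  unfolding sum_Times fst_conv snd_conv by (rule sum_lessThan_add)

text \<open>With \<open>s\<^sup>*s = 1 - x\<^sup>*x\<close>, the matrix \<open>X = (1, x; 0, s)\<close> satisfies \<open>X\<^sup>*X = (1, x; x\<^sup>*, 1)\<close>. A completely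
  positive unital map preserves the positivity of the latter, and Cauchy-Schwarz for the positive
  form of the image bounds its off-diagonal block.\<close>

lemma completely_positive_contraction:
  assumes "star_rep A I P" "fd_space (acarr A)" "star_rep B J Q"
    and \<phi>: "\<phi> \<in> lin (acarr A) (acarr B)" "\<phi> (aone A) = aone B"
    and pos: "\<And>y. y \<in> positive (mat_star_alg (n + n) A) \<Longrightarrow> amp \<phi> y \<in> positive (mat_star_alg (n + n) B)"
    and x: "x \<in> mats n (acarr A)" and le: "gnorm ({..<n} \<times> I) (matrep P x) \<le> 1"
  shows "gnorm ({..<n} \<times> J) (matrep Q (amp \<phi> x)) \<le> 1"
proof -
  interpret A: star_rep A I P by fact
  interpret B: star_rep B J Q by fact
  interpret M: star_rep "mat_star_alg n A" "{..<n} \<times> I" "matrep P" by (rule A.mat_star_rep)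
  interpret CM: cstar_alg "mat_star_alg n A" "\<lambda>x. gnorm ({..<n} \<times> I) (matrep P x)"
    by unfold_locales (rule M.cstar_norm, simp add: fd_space_mats assms(2))
  interpret M2: star_rep "mat_star_alg (n + n) A" "{..<n + n} \<times> I" "matrep P" by (rule A.mat_star_rep)
  interpret N2: star_rep "mat_star_alg (n + n) B" "{..<n + n} \<times> J" "matrep Q" by (rule B.mat_star_rep)
  let ?A = "mat_star_alg n A"
  let ?t = "aone ?A - amul ?A (astar ?A x) x"
  have xA: "x \<in> acarr ?A" using x by simp
  \<comment> \<open>Here \<open>1 - ?t\<close> is the adjoint of \<open>x\<close> times
    \<open>x\<close>, so a contraction \<open>x\<close> meets the hypothesis of
    \<open>hermitian_square_root\<close>.\<close>
  have "gnorm ({..<n} \<times> I) (matrep P (aone ?A - ?t)) = (gnorm ({..<n} \<times> I) (matrep P x))\<^sup>2"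
    using CM.cstar[OF xA] by simp
  also have "\<dots> \<le> 1" using le by (simp add: power_le_one M.fin)
  finally have t1: "gnorm ({..<n} \<times> I) (matrep P (aone ?A - ?t)) \<le> 1" .
  have t: "?t \<in> acarr ?A" "astar ?A ?t = ?t" using xA
    by (simp_all only: M.star_diff M.star_mul M.closed M.diff_closed M.star_one M.star_star)
  obtain s where sA: "s \<in> acarr ?A" and s: "amul ?A (astar ?A s) s = ?t"
    by (rule CM.hermitian_square_root[OF t t1])
  have sm: "s \<in> mats n (acarr A)" using sA by simp
  have ss: "(\<Sum>k<n. amul A (astar A (x k i)) (x k j)) + (\<Sum>k<n. amul A (astar A (s k i)) (s k j))
      = (if i = j then aone A else 0)" if "i < n" "j < n" for i j
  proof -
    have "amul ?A (astar ?A x) x i j + amul ?A (astar ?A s) s i j = aone ?A i j" unfolding s by simp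
    then show ?thesis using that by (simp add: mat_star_alg_def)
  qed
  define X where "X i j = (if i < n \<and> j < n then (if i = j then aone A else 0)
    else if i < n \<and> n \<le> j \<and> j < n + n then x i (j - n)
    else if n \<le> i \<and> i < n + n \<and> n \<le> j \<and> j < n + n then s (i - n) (j - n) else 0)" for i j
  have X: "X \<in> mats (n + n) (acarr A)"
    using x sm by (auto simp: mats_def X_def)
  define Y where "Y = amul (mat_star_alg (n + n) A) (astar (mat_star_alg (n + n) A) X) X"
  have Y: "Y i j
    = (\<Sum>k<n. amul A (astar A (X k i)) (X k j)) + (\<Sum>k<n. amul A (astar A (X (n + k) i)) (X (n + k) j))"
    if "i < n + n" "j < n + n" for i j
    using that by (simp add: Y_def mat_star_alg_def sum_lessThan_add)
  have Xc: "X i j \<in> acarr A" for i j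
    using X cvs.subspace_0[OF A.subsp] by (cases "i < n + n \<and> j < n + n") (auto simp: mats_def)
  have low: "X (n + k) i = 0" if "i < n" for k i using that by (simp add: X_def)
  have Y11: "Y i j = (if i = j then aone A else 0)" if "i < n" "j < n" for i j
  proof -
    have "amul A (astar A (X k i)) (X k j) = (if k = i then (if i = j then aone A else 0) else 0)"
      if "k < n" for k
      using that \<open>i < n\<close> \<open>j < n\<close> by (auto simp: X_def)
    then show ?thesis using that by (simp add: Y low Xc sum.delta)
  qed
  have Y12: "Y i (n + j) = x i j" if "i < n" "j < n" for i j
  proof -
    have "amul A (astar A (X k i)) (X k (n + j)) = (if k = i then x i j else 0)" if "k < n" for k
      using that \<open>i < n\<close> \<open>j < n\<close> x by (auto simp: X_def mats_def)
    then show ?thesis using that by (simp add: Y low Xc sum.delta)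
  qed
  have Y22: "Y (n + i) (n + j) = (if i = j then aone A else 0)" if "i < n" "j < n" for i j
    using that ss[OF that] by (simp add: Y X_def)
  have "Y \<in> positive (mat_star_alg (n + n) A)" using X by (auto simp: positive_def Y_def)
  then obtain D where D: "D \<in> mats (n + n) (acarr B)"
    and DD: "amp \<phi> Y = amul (mat_star_alg (n + n) B) (astar (mat_star_alg (n + n) B) D) D"
    using pos by (auto simp: positive_def)
  have sD: "astar (mat_star_alg (n + n) B) D \<in> mats (n + n) (acarr B)"
    using N2.starc[of D] D by simp
  let ?K = "{..<n + n} \<times> J" and ?m = "matrep Q (amp \<phi> Y)"
  have gram: "?m p q = (\<Sum>r\<in>?K. cnj (matrep Q D r p) * matrep Q D r q)" if "p \<in> ?K" "q \<in> ?K" for p q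
    using that D unfolding DD by (subst N2.P_mul) (auto simp: N2.P_star sD intro!: sum.cong)
  have \<phi>0: "\<phi> 0 = 0" by (rule lin_zero[OF \<phi>(1) A.subsp])
  have diag: "(\<Sum>p\<in>{..<n} \<times> J. \<Sum>q\<in>{..<n} \<times> J. cnj (u p) * (if fst p = fst q \<and> snd p = snd q then 1 else 0) * u q)
      = (complex_of_real (l2 ({..<n} \<times> J) u))\<^sup>2" for u
  proof -
    have "(\<Sum>p\<in>{..<n} \<times> J. \<Sum>q\<in>{..<n} \<times> J. cnj (u p) * (if fst p = fst q \<and> snd p = snd q then 1 else 0) * u q)
      = (\<Sum>p\<in>{..<n} \<times> J. \<Sum>q\<in>{..<n} \<times> J. if q = p then cnj (u p) * u p else 0)"
      by (intro sum.cong refl) (auto simp: prod_eq_iff)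
    also have "\<dots> = (\<Sum>p\<in>{..<n} \<times> J. cnj (u p) * u p)" using B.fin by (simp add: sum.delta)
    finally show ?thesis by (simp only: l2_power2_complex[symmetric] of_real_power)
  qed
  show ?thesis
  proof (rule gnorm_le)
    fix u v :: "nat \<times> 'd \<Rightarrow> complex"
    \<comment> \<open>Supported in the first block and \<open>v'\<close> in the second, so the mixed
      value of the form sees only the upper right block. The conjugate undoes the one in the
      sesquilinear form.\<close>
    define u' where "u' p = (if fst p < n then cnj (u p) else 0)" for p
    define v' where "v' p = (if fst p < n then 0 else v (fst p - n, snd p))" for p
    \<comment> \<open>In all three uses the lower left block meets a zero vector, so its entries are
      never computed.\<close>
    have bil2: "bil ?K ?m (\<lambda>p. cnj (a p)) b =
        (\<Sum>p\<in>{..<n} \<times> J. \<Sum>q\<in>{..<n} \<times> J. cnj (a p) * ?m p q * b q)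
      + (\<Sum>p\<in>{..<n} \<times> J. \<Sum>q\<in>{..<n} \<times> J. cnj (a p) * ?m p (n + fst q, snd q) * b (n + fst q, snd q))
      + (\<Sum>p\<in>{..<n} \<times> J. \<Sum>q\<in>{..<n} \<times> J. cnj (a (n + fst p, snd p)) * ?m (n + fst p, snd p) q * b q)
      + (\<Sum>p\<in>{..<n} \<times> J. \<Sum>q\<in>{..<n} \<times> J. cnj (a (n + fst p, snd p)) * ?m (n + fst p, snd p) (n
        + fst q, snd q) * b (n + fst q, snd q))"
      for a b
      unfolding bil_def sum_two_blocks by (simp add: sum.distrib add.assoc)
    have u'1: "u' p = cnj (u p)" and v'1: "v' p = 0" if "p \<in> {..<n} \<times> J" for p
      using that by (auto simp: u'_def v'_def)
    have u'2: "u' (n + fst p, snd p) = 0" and v'2: "v' (n + fst p, snd p) = v p" for p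
      by (auto simp: u'_def v'_def)
    have m11: "?m p q = (if fst p = fst q \<and> snd p = snd q then 1 else 0)"
      and m12: "?m p (n + fst q, snd q) = matrep Q (amp \<phi> x) p q"
      and m22: "?m (n + fst p, snd p) (n + fst q, snd q) = (if fst p = fst q \<and> snd p = snd q then 1 else 0)"
      if "p \<in> {..<n} \<times> J" "q \<in> {..<n} \<times> J" for p q
      using that by (auto simp: matrep_def amp_def Y11 Y12 Y22 \<phi>(2) \<phi>0 B.P_zero B.P_one)
    have uu: "bil ?K ?m (\<lambda>p. cnj (u' p)) u' = (complex_of_real (l2 ({..<n} \<times> J) u))\<^sup>2"
    proof -
      have "bil ?K ?m (\<lambda>p. cnj (u' p)) u' = (\<Sum>p\<in>{..<n} \<times> J. \<Sum>q\<in>{..<n} \<times> J.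
          cnj (cnj (u p)) * (if fst p = fst q \<and> snd p = snd q then 1 else 0) * cnj (u q))"
        unfolding bil2 by (simp add: u'1 u'2 m11 cong: sum.cong)
      then show ?thesis using diag[of "\<lambda>p. cnj (u p)"] by simp
    qed
    have vv: "bil ?K ?m (\<lambda>p. cnj (v' p)) v' = (complex_of_real (l2 ({..<n} \<times> J) v))\<^sup>2"
    proof -
      have "bil ?K ?m (\<lambda>p. cnj (v' p)) v' = (\<Sum>p\<in>{..<n} \<times> J. \<Sum>q\<in>{..<n} \<times> J.
          cnj (v p) * (if fst p = fst q \<and> snd p = snd q then 1 else 0) * v q)"
        unfolding bil2 by (simp add: v'1 v'2 m22 cong: sum.cong)
      then show ?thesis using diag[of v] by simp
    qed
    have "bil ?K ?m (\<lambda>p. cnj (u' p)) v' = bil ({..<n} \<times> J) (matrep Q (amp \<phi> x)) u v"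
      unfolding bil2 by (simp add: bil_def u'1 u'2 v'1 v'2 m12 cong: sum.cong)
    moreover have "cmod (bil ?K ?m (\<lambda>p. cnj (u' p)) v') \<le> l2 ({..<n} \<times> J) u * l2 ({..<n} \<times> J) v"
      by (rule gram_cauchy_schwarz[OF gram uu _ vv]) simp_all
    ultimately show "cmod (bil ({..<n} \<times> J) (matrep Q (amp \<phi> x)) u v)
      \<le> 1 * l2 ({..<n} \<times> J) u * l2 ({..<n} \<times> J) v"
      by simp
  qed simp
qed

text \<open>At matrix size k, contractivity of the amplification gives its positivity, while its
  contractivity is derived from positivity at size 2k. Preserving \<open>{1}\<close> is the same as
  being unital.\<close>

lemma H_hom_eq_Q_hom:
  assumes "vn_rep A m P" "vn_rep B n Q"
  shows "H_hom A B = Q_hom (functor_obj A) (functor_obj B)"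
proof -
  interpret A: vn_rep A m P by fact
  interpret B: vn_rep B n Q by fact
  have "completely_positive A B \<phi> \<longleftrightarrow> complete_contraction (os_of A) (os_of B) \<phi>"
    if one: "\<phi> (aone A) = aone B" for \<phi>
  proof
    assume "complete_contraction (os_of A) (os_of B) \<phi>"
    then have \<phi>: "\<phi> \<in> lin (acarr A) (acarr B)"
      and contr: "\<And>k x. x \<in> mats k (acarr A) \<Longrightarrow> mnorm (os_of B) k (amp \<phi> x) \<le> mnorm (os_of A) k x"
      by (auto simp: complete_contraction_def)
    have "amp \<phi> x \<in> positive (mat_star_alg k B)" if x: "x \<in> positive (mat_star_alg k A)" for k x
    proof (rule unital_contraction_positive[OF A.mat_star_rep _ B.mat_star_rep _ _ _ _ _ _ x])
      show "fd_space (acarr (mat_star_alg k A))" "fd_space (acarr (mat_star_alg k B))"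
        by (simp_all add: fd_space_mats A.fd B.fd)
      have amp: "amp \<phi> y \<in> mats k (acarr B)" if "y \<in> mats k (acarr A)" for y
        by (rule amp_mats[OF \<phi> A.subsp that])
      show "gnorm ({..<k} \<times> {..<n}) (matrep Q (amp \<phi> y)) \<le> gnorm ({..<k} \<times> {..<m}) (matrep P y)"
        if "y \<in> acarr (mat_star_alg k A)" for y
        using contr[of y k] that amp[of y] by (simp add: A.mnorm_mats[OF A.fd] B.mnorm_mats[OF B.fd])
      show "amp \<phi> (aone (mat_star_alg k A)) = aone (mat_star_alg k B)"
        using one lin_zero[OF \<phi> A.subsp] by (auto simp: mat_star_alg_def amp_def fun_eq_iff)
      show "amp \<phi> y \<in> acarr (mat_star_alg k B)" if "y \<in> acarr (mat_star_alg k A)" for y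
        using amp that by simp
      have entry: "y i j \<in> acarr A" if "y \<in> acarr (mat_star_alg k A)" for y i j
        using that cvs.subspace_0[OF A.subsp] by (cases "i < k \<and> j < k") (auto simp: mats_def)
      show "amp \<phi> (y + z) = amp \<phi> y + amp \<phi> z"
        if "y \<in> acarr (mat_star_alg k A)" "z \<in> acarr (mat_star_alg k A)" for y z
        using that entry by (auto simp: amp_def fun_eq_iff lin_add[OF \<phi>])
      show "amp \<phi> (c *\<^sub>C y) = c *\<^sub>C amp \<phi> y" if "y \<in> acarr (mat_star_alg k A)" for c y
        using that entry by (auto simp: amp_def fun_eq_iff scaleC_fun_def lin_scale[OF \<phi>])
    qed
    then show "completely_positive A B \<phi>" using \<phi> by (simp add: completely_positive_iff[OF assms])
  next
    assume "completely_positive A B \<phi>"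
    then have \<phi>: "\<phi> \<in> lin (acarr A) (acarr B)"
      and pos: "\<And>k x. x \<in> positive (mat_star_alg k A) \<Longrightarrow> amp \<phi> x \<in> positive (mat_star_alg k B)"
      by (auto simp: completely_positive_iff[OF assms])
    have "mnorm (os_of B) k (amp \<phi> x) \<le> mnorm (os_of A) k x" if x: "x \<in> mats k (acarr A)" for k x
    proof (cases "x = 0")
      case True
      then have "amp \<phi> x = 0" using lin_zero[OF \<phi> A.subsp] by (auto simp: amp_def fun_eq_iff)
      then show ?thesis using True by simp
    next
      case False
      \<comment> \<open>\<open>completely_positive_contraction\<close> speaks of the unit ball, so
        \<open>x\<close> is normalised first.\<close>
      define c where "c = mnorm (os_of A) k x"
      have c: "c > 0" using False A.M.nonneg[OF x] A.M.eq_0_iff[OF x] by (simp add: c_def less_le)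
      let ?c = "complex_of_real (inverse c)"
      have cx: "?c *\<^sub>C x \<in> mats k (acarr A)" by (rule cvs.subspace_scale[OF A.M.sub x])
      have "mnorm (os_of A) k (?c *\<^sub>C x) \<le> 1"
        using A.M.scale[OF x, of ?c] c by (simp add: norm_inverse flip: c_def)
      then have "gnorm ({..<k} \<times> {..<n}) (matrep Q (amp \<phi> (?c *\<^sub>C x))) \<le> 1"
        unfolding A.mnorm_mats[OF A.fd cx]
        using completely_positive_contraction[OF A.star_rep_axioms A.fd B.star_rep_axioms \<phi> one pos cx] by blast
      then have "mnorm (os_of B) k (amp \<phi> (?c *\<^sub>C x)) \<le> 1"
        unfolding B.mnorm_mats[OF B.fd amp_mats[OF \<phi> A.subsp cx]] .
      moreover have "amp \<phi> (?c *\<^sub>C x) = ?c *\<^sub>C amp \<phi> x"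
      proof (intro ext)
        fix i j
        have "x i j \<in> acarr A" using x cvs.subspace_0[OF A.subsp]
          by (cases "i < k \<and> j < k") (auto simp: mats_def)
        then show "amp \<phi> (?c *\<^sub>C x) i j = (?c *\<^sub>C amp \<phi> x) i j"
          by (simp add: amp_def scaleC_fun_def lin_scale[OF \<phi>])
      qed
      ultimately have "inverse c * mnorm (os_of B) k (amp \<phi> x) \<le> 1"
        using B.M.scale[OF amp_mats[OF \<phi> A.subsp x], of ?c] c by (simp add: norm_inverse)
      then show ?thesis using c by (simp add: field_simps flip: c_def)
    qed
    then show "complete_contraction (os_of A) (os_of B) \<phi>" using \<phi> by (simp add: complete_contraction_def)
  qed
  then show ?thesis by (auto simp: H_hom_def Q_hom_def functor_obj_def)
qed

theorem theorem49:
  fixes A :: "'a::complex_vector cstar" and B :: "'b::complex_vector cstar"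
    and C :: "'c::complex_vector cstar" and D :: "'d::complex_vector cstar"
  assumes "fd_vn_algebra A" and "fd_vn_algebra B" and "fd_vn_algebra C" and "fd_vn_algebra D"
  shows "Q_obj (functor_obj A) \<and>

    (\<forall>f\<in>H_hom A B. functor_hom f \<in> Q_hom (functor_obj A) (functor_obj B)) \<and>
    functor_hom (H_id A) = Q_id (functor_obj A) \<and>
    (\<forall>f\<in>H_hom A B. \<forall>g\<in>H_hom B C. functor_hom (g \<circ> f) = functor_hom g \<circ> functor_hom f) \<and>

    bij_betw functor_hom (H_hom A B) (Q_hom (functor_obj A) (functor_obj B)) \<and>

    fd_vn_algebra complex_alg \<and>
    functor_obj complex_alg = Q_unit \<and>
    fd_vn_algebra (alg_tensor A B) \<and>
    functor_obj (alg_tensor A B) = Q_tensor (functor_obj A) (functor_obj B) \<and>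
    (\<forall>f\<in>H_hom A C. \<forall>g\<in>H_hom B D. functor_hom (H_tensor_hom A B D f g)
       = Q_tensor_hom (functor_obj A) (functor_obj B) (functor_obj D) (functor_hom f) (functor_hom g)) \<and>
    functor_hom (H_assoc A B C) = Q_assoc (functor_obj A) (functor_obj B) (functor_obj C) \<and>
    functor_hom (H_lunit A) = Q_lunit (functor_obj A) \<and>
    functor_hom (H_runit A) = Q_runit (functor_obj A) \<and>

    fd_vn_algebra (zero_alg :: 'z::complex_vector cstar) \<and>
    functor_obj (zero_alg :: 'z cstar) = Q_terminal \<and>
    fd_vn_algebra (alg_prod A B) \<and>
    functor_obj (alg_prod A B) = Q_prod (functor_obj A) (functor_obj B) \<and>
    functor_hom (H_fst A B) = Q_fst (functor_obj A) (functor_obj B) \<and>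
    functor_hom (H_snd A B) = Q_snd (functor_obj A) (functor_obj B)"
proof -
  obtain m P where A: "vn_rep A m P" by (rule fd_vn_rep[OF assms(1)])
  obtain n Q where B: "vn_rep B n Q" by (rule fd_vn_rep[OF assms(2)])
  interpret A: vn_rep A m P by (rule A)
  interpret B: vn_rep B n Q by (rule B)
  interpret AB: rep_pair A m P B n Q by unfold_locales (rule A.fd)
  \<comment> \<open>\<open>functor_hom\<close> is the identity on functions, so full faithfulness
    amounts to equality of the two hom-sets.\<close>
  have hom: "functor_hom ` H_hom A B = Q_hom (functor_obj A) (functor_obj B)"
    by (simp add: functor_hom_def[abs_def] H_hom_eq_Q_hom[OF A B])
  show ?thesis
  proof (intro conjI ballI)
    show "Q_obj (functor_obj A)" by (rule A.Q_obj)
    show "functor_hom f \<in> Q_hom (functor_obj A) (functor_obj B)" if "f \<in> H_hom A B" for f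
      using that hom by blast
    show "bij_betw functor_hom (H_hom A B) (Q_hom (functor_obj A) (functor_obj B))"
      unfolding bij_betw_def hom by (simp add: inj_on_def functor_hom_def)
    show "functor_obj complex_alg = Q_unit"
      by (simp add: functor_obj_def Q_unit_def os_of_complex) (simp add: complex_alg_def)
    show "functor_obj (zero_alg :: 'z cstar) = Q_terminal"
      by (simp add: functor_obj_def Q_terminal_def os_of_zero) (simp add: zero_alg_def)
    show "functor_obj (alg_prod A B) = Q_prod (functor_obj A) (functor_obj B)"
      by (simp add: functor_obj_def Q_prod_def os_of_prod[OF A.star_rep_axioms B.star_rep_axioms assms(1,2)])
        (simp add: alg_prod_def)
  qed (simp_all add: functor_hom_def functor_obj_def fd_vn_complex fd_vn_zero AB.fd_vn_tensor
      AB.functor_obj_tensor[OF A, unfolded functor_obj_def]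
      fd_vn_prod[OF A.star_rep_axioms B.star_rep_axioms assms(1,2)]
      H_id_def Q_id_def H_tensor_hom_def Q_tensor_hom_def H_assoc_def Q_assoc_def H_lunit_def Q_lunit_def
      H_runit_def Q_runit_def H_fst_def Q_fst_def H_snd_def Q_snd_def)
qed

end
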